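(* There exist an absolute constant $C\in\mathbb{R}^+$ and a deterministic algorithm $\mathcal{A}:\mathbb{R}^D\to\mathbb{C}^d$ for which the following holds. Let $\epsilon\in(0,1]$, $\mathbf{x}\in\mathbb{C}^d$ with $d$ sufficiently large, and $s\in[d]=\{1,\dots,d\}$. Then one can select a random measurement matrix $\tilde M\in\mathbb{C}^{D\times d}$ such that $$\min_{\theta\in[0,2\pi]}\left\| e^{\mathrm{i}\theta}\mathbf{x} - \mathcal{A}\left(|\tilde M\mathbf{x}|^2\right)\right\|_2 \leq \left\|\mathbf{x}-\mathbf{x}^{\rm opt}_s\right\|_2 + \frac{22\,\epsilon\left\|\mathbf{x}-\mathbf{x}^{\rm opt}_{(s/\epsilon)}\right\|_1}{\sqrt{s}}$$ is true with probability at least $1-\frac{1}{C\cdot\ln^2(d)\cdot\ln^3(\ln d)}$. Here $D$ can be chosen to be $\mathcal{O}\left(\frac{s}{\epsilon}\cdot\ln^3\left(\frac{s}{\epsilon}\right)\cdot\ln^3\left(\ln\frac{s}{\epsilon}\right)\cdot\ln d\right)$. Furthermore, the algorithm runs in $\mathcal{O}\left(\frac{s}{\epsilon}\cdot\ln^4\left(\frac{s}{\epsilon}\right)\cdot\ln^3\left(\ln\frac{s}{\epsilon}\right)\cdot\ln d\right)$ time in that case. (For the measurement and runtime bounds it is assumed that $s=\Omega(\log d)$.)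
   Context: $|\cdot|^2$ denotes the componentwise squared magnitude of a vector. For $\mathbf{x}\in\mathbb{C}^d$ and a sparsity level $t$, $\mathbf{x}^{\rm opt}_t\in\mathbb{C}^d$ denotes an optimal $t$-sparse approximation to $\mathbf{x}$: it preserves the $t$ largest-magnitude entries of $\mathbf{x}$ and sets the remaining entries to $0$ (it may be non-unique because of ties); $s/\epsilon$ is used as a sparsity level. The recovery algorithm may use knowledge of the drawn measurement matrix $\tilde M$ (a recovery method $\mathcal{A}=\mathcal{A}_{\tilde M}$ associated with $\tilde M$), and the distribution of $\tilde M$ does not depend on $\mathbf{x}$. The probability is over the random choice of $\tilde M$, for a fixed $\mathbf{x}$ (nonuniform guarantee). *)

theory Defs
  imports "HOL-Probability.Probability" "Jordan_Normal_Form.Matrix"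
begin

unbundle no vec_syntax


definition norm1 :: "complex vec \<Rightarrow> real" where
  "norm1 v = (\<Sum>i<dim_vec v. cmod (v $ i))"

definition norm2 :: "complex vec \<Rightarrow> real" where
  "norm2 v = L2_set (\<lambda>i. cmod (v $ i)) {..<dim_vec v}"

definition sq_mag :: "complex vec \<Rightarrow> real vec" where
  "sq_mag v = map_vec (\<lambda>z. (cmod z)\<^sup>2) v"

text \<open>
  The sparsity level \<open>t\<close> is real: \<open>t\<close>-sparse means that at most \<open>t\<close> entries are nonzero, so
  \<open>\<lfloor>t\<rfloor>\<close> entries are kept (all of them if \<open>t\<close> is at least the dimension). This is a relation,
  because ties leave the choice of \<open>S\<close> open.
\<close>

definition opt_sparse_approx :: "complex vec \<Rightarrow> real \<Rightarrow> complex vec \<Rightarrow> bool" where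
  "opt_sparse_approx x t z \<longleftrightarrow>
     (\<exists>S \<subseteq> {..<dim_vec x}.
        card S = min (dim_vec x) (nat \<lfloor>t\<rfloor>) \<and>
        (\<forall>i\<in>S. \<forall>j\<in>{..<dim_vec x} - S. cmod (x $ j) \<le> cmod (x $ i)) \<and>
        z = vec (dim_vec x) (\<lambda>i. if i \<in> S then x $ i else 0))"

text \<open>The law of a random matrix: a probability measure on matrices for which every entry is a
  (Borel) random variable. The elements of its space are the possible realisations.\<close>

definition random_matrix_law :: "nat \<Rightarrow> nat \<Rightarrow> complex mat measure \<Rightarrow> bool" where
  "random_matrix_law D d \<mu> \<longleftrightarrow>
     prob_space \<mu> \<and> space \<mu> \<subseteq> carrier_mat D d \<and>
     (\<forall>i<D. \<forall>j<d. (\<lambda>M. M $$ (i, j)) \<in> borel_measurable \<mu>)"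



text \<open>
  Algorithms are programs of a real RAM with unit-cost instructions. It has a word memory (natural
  numbers below the word bound \<open>W\<close>, all word arithmetic being modulo \<open>W\<close>), a memory for exact real
  numbers, and a write-only complex output memory. All memories support indirect addressing by
  words. As usual, there is no rounding from reals to words, as unit-cost rounding would make the
  model unreasonably powerful, and there are no real constants in programs. Input are a matrix and
  a vector, which can be read entrywise; entries out of range read as \<open>0\<close>. Word subtraction is
  truncated at \<open>0\<close>, and division by \<open>0\<close> gives \<open>0\<close>. A program halts when the program counter leaves
  it.
\<close>

datatype instr =
    WConst nat nat
  | WAdd nat nat nat
  | WSub nat nat nat
  | WMul nat nat nat
  | WDiv nat nat nat
  | WMod nat nat nat
  | WLoad nat nat
  | WStore nat nat
  | RAdd nat nat nat
  | RSub nat nat nat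
  | RMul nat nat nat
  | RDiv nat nat nat
  | RSqrt nat nat
  | ROfW nat nat
  | RLoad nat nat
  | RStore nat nat
  | ReadY nat nat
  | ReadRe nat nat nat
  | ReadIm nat nat nat
  | Write nat nat nat
  | JumpW nat nat nat
  | JumpR nat nat nat

type_synonym program = "instr list"

record state =
  pc :: nat
  wmem :: "nat \<Rightarrow> nat"
  rmem :: "nat \<Rightarrow> real"
  outp :: "nat \<Rightarrow> complex"

definition set_w :: "nat \<Rightarrow> nat \<Rightarrow> nat \<Rightarrow> state \<Rightarrow> state" where
  "set_w W a n \<sigma> = \<sigma>\<lparr>pc := Suc (pc \<sigma>), wmem := (wmem \<sigma>)(a := n mod W)\<rparr>"

definition set_r :: "nat \<Rightarrow> real \<Rightarrow> state \<Rightarrow> state" where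
  "set_r a u \<sigma> = \<sigma>\<lparr>pc := Suc (pc \<sigma>), rmem := (rmem \<sigma>)(a := u)\<rparr>"

definition set_out :: "nat \<Rightarrow> complex \<Rightarrow> state \<Rightarrow> state" where
  "set_out a z \<sigma> = \<sigma>\<lparr>pc := Suc (pc \<sigma>), outp := (outp \<sigma>)(a := z)\<rparr>"

definition vec_entry :: "'a::zero vec \<Rightarrow> nat \<Rightarrow> 'a" where
  "vec_entry y i = (if i < dim_vec y then y $ i else 0)"

definition mat_entry :: "'a::zero mat \<Rightarrow> nat \<Rightarrow> nat \<Rightarrow> 'a" where
  "mat_entry M i j = (if i < dim_row M \<and> j < dim_col M then M $$ (i, j) else 0)"

fun exec :: "nat \<Rightarrow> complex mat \<Rightarrow> real vec \<Rightarrow> instr \<Rightarrow> state \<Rightarrow> state" where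
  "exec W M y (WConst a n) \<sigma> = set_w W a n \<sigma>"
| "exec W M y (WAdd a b c) \<sigma> = set_w W a (wmem \<sigma> b + wmem \<sigma> c) \<sigma>"
| "exec W M y (WSub a b c) \<sigma> = set_w W a (wmem \<sigma> b - wmem \<sigma> c) \<sigma>"
| "exec W M y (WMul a b c) \<sigma> = set_w W a (wmem \<sigma> b * wmem \<sigma> c) \<sigma>"
| "exec W M y (WDiv a b c) \<sigma> = set_w W a (wmem \<sigma> b div wmem \<sigma> c) \<sigma>"
| "exec W M y (WMod a b c) \<sigma> = set_w W a (wmem \<sigma> b mod wmem \<sigma> c) \<sigma>"
| "exec W M y (WLoad a b) \<sigma> = set_w W a (wmem \<sigma> (wmem \<sigma> b)) \<sigma>"
| "exec W M y (WStore a b) \<sigma> = set_w W (wmem \<sigma> a) (wmem \<sigma> b) \<sigma>"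
| "exec W M y (RAdd a b c) \<sigma> = set_r a (rmem \<sigma> b + rmem \<sigma> c) \<sigma>"
| "exec W M y (RSub a b c) \<sigma> = set_r a (rmem \<sigma> b - rmem \<sigma> c) \<sigma>"
| "exec W M y (RMul a b c) \<sigma> = set_r a (rmem \<sigma> b * rmem \<sigma> c) \<sigma>"
| "exec W M y (RDiv a b c) \<sigma> = set_r a (rmem \<sigma> b / rmem \<sigma> c) \<sigma>"
| "exec W M y (RSqrt a b) \<sigma> = set_r a (sqrt (rmem \<sigma> b)) \<sigma>"
| "exec W M y (ROfW a b) \<sigma> = set_r a (real (wmem \<sigma> b)) \<sigma>"
| "exec W M y (RLoad a b) \<sigma> = set_r a (rmem \<sigma> (wmem \<sigma> b)) \<sigma>"
| "exec W M y (RStore a b) \<sigma> = set_r (wmem \<sigma> a) (rmem \<sigma> b) \<sigma>"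
| "exec W M y (ReadY a b) \<sigma> = set_r a (vec_entry y (wmem \<sigma> b)) \<sigma>"
| "exec W M y (ReadRe a b c) \<sigma> = set_r a (Re (mat_entry M (wmem \<sigma> b) (wmem \<sigma> c))) \<sigma>"
| "exec W M y (ReadIm a b c) \<sigma> = set_r a (Im (mat_entry M (wmem \<sigma> b) (wmem \<sigma> c))) \<sigma>"
| "exec W M y (Write a b c) \<sigma> = set_out (wmem \<sigma> a) (Complex (rmem \<sigma> b) (rmem \<sigma> c)) \<sigma>"
| "exec W M y (JumpW a b l) \<sigma> =
     \<sigma>\<lparr>pc := (if wmem \<sigma> a \<le> wmem \<sigma> b then l else Suc (pc \<sigma>))\<rparr>"
| "exec W M y (JumpR a b l) \<sigma> =
     \<sigma>\<lparr>pc := (if rmem \<sigma> a \<le> rmem \<sigma> b then l else Suc (pc \<sigma>))\<rparr>"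

definition halted :: "program \<Rightarrow> state \<Rightarrow> bool" where
  "halted P \<sigma> \<longleftrightarrow> length P \<le> pc \<sigma>"

definition step :: "program \<Rightarrow> nat \<Rightarrow> complex mat \<Rightarrow> real vec \<Rightarrow> state \<Rightarrow> state" where
  "step P W M y \<sigma> = (if halted P \<sigma> then \<sigma> else exec W M y (P ! pc \<sigma>) \<sigma>)"

text \<open>Apart from the parameters, all memory cells are initially \<open>0\<close>; in particular, output entries
  that are never written are \<open>0\<close>, so a sparse output vector can be produced in sublinear time.\<close>

definition init_state :: "nat \<Rightarrow> nat \<Rightarrow> nat \<Rightarrow> real \<Rightarrow> state" where
  "init_state D d s \<epsilon> =
     \<lparr>pc = 0, wmem = (\<lambda>_. 0)(0 := D, 1 := d, 2 := s), rmem = (\<lambda>_. 0)(0 := \<epsilon>), outp = (\<lambda>_. 0)\<rparr>"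

text \<open>Words have \<open>O(log (D + d))\<close> bits, i.e. they are bounded by a fixed power of the input size.
  The exponent \<open>\<kappa>\<close> belongs to the algorithm.\<close>

definition run ::
  "program \<Rightarrow> nat \<Rightarrow> nat \<Rightarrow> real \<Rightarrow> complex mat \<Rightarrow> real vec \<Rightarrow> nat \<Rightarrow> state" where
  "run P \<kappa> s \<epsilon> M y n =
     (step P ((dim_row M + dim_col M + 2) ^ \<kappa>) M y ^^ n)
       (init_state (dim_row M) (dim_col M) s \<epsilon>)"

definition terminates ::
  "program \<Rightarrow> nat \<Rightarrow> nat \<Rightarrow> real \<Rightarrow> complex mat \<Rightarrow> real vec \<Rightarrow> bool" where
  "terminates P \<kappa> s \<epsilon> M y \<longleftrightarrow> (\<exists>n. halted P (run P \<kappa> s \<epsilon> M y n))"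

definition run_time ::
  "program \<Rightarrow> nat \<Rightarrow> nat \<Rightarrow> real \<Rightarrow> complex mat \<Rightarrow> real vec \<Rightarrow> nat" where
  "run_time P \<kappa> s \<epsilon> M y = (LEAST n. halted P (run P \<kappa> s \<epsilon> M y n))"

text \<open>The recovery map from \<open>\<real>\<^sup>D\<close> to \<open>\<complex>\<^sup>d\<close> associated with the \<open>D \<times> d\<close> matrix \<open>M\<close>.\<close>

definition recover ::
  "program \<Rightarrow> nat \<Rightarrow> nat \<Rightarrow> real \<Rightarrow> complex mat \<Rightarrow> real vec \<Rightarrow> complex vec" where
  "recover P \<kappa> s \<epsilon> M y = vec (dim_col M) (outp (run P \<kappa> s \<epsilon> M y (run_time P \<kappa> s \<epsilon> M y)))"

end

theory Submission
  imports Defs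
begin

text \<open>
  The magnitudes are exact, so phases cost only a constant factor: with a reference measurement \<open>b\<close>
  that does not vanish, the squared magnitudes of \<open>a\<close>, \<open>b\<close>, \<open>b + a\<close> and \<open>b + \<i> * a\<close> determine the linear
  measurement \<open>a\<close> up to the global phase of \<open>b\<close> (\<open>norm_sq_sum_split\<close>). The reference row consists of the
  powers of a random integer; its value at a nonzero vector is the value of a nonzero polynomial and
  rarely vanishes (\<open>few_roots\<close>). What remains is a sublinear-time sparse recovery scheme for linear
  measurements.
  
  Let \<open>K\<close> be about \<open>s / \<epsilon>\<close> and let \<open>\<eta>\<close> be the \<open>K\<close>-th part of the \<open>\<ell>\<^sub>1\<close>-norm of the tail of \<open>x\<close>. In each of
  \<open>R = 3 * m\<close> repetitions, all indices are hashed at random to \<open>128 * K\<close> buckets. With probability at least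
  \<open>63/64\<close>, the other entries in the bucket of an index have total magnitude at most \<open>\<eta>\<close> (\<open>noise_prob\<close>). In
  that case the bucket sum approximates the entry up to \<open>\<eta>\<close>, and if the entry is heavy, that is, larger
  than \<open>\<eta>\<close>, its index is read off by comparing, for each binary digit, the magnitudes of the two halves
  of the bucket (\<open>decodes_if_heavy\<close>). Every bucket votes for the index that it decodes to, provided that this
  index really belongs to the bucket. Indices with more than \<open>2 * m\<close> votes are estimated by the median of
  the bucket sums that voted for them. If each heavy index has fewer than \<open>m\<close> noisy repetitions, and
  each index fewer than \<open>m\<close> noisy votes, then all estimates, including the implicit estimate 0 of all
  other indices, are correct up to \<open>2 * \<eta>\<close> (\<open>z_val_close\<close>). The first condition is a union bound over
  the at most \<open>2 * K\<close> heavy entries; for the second one the union bound is weighted by the probability of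
  being decoded at all (\<open>bad_decoded_prob\<close>), so that \<open>m\<close> of order \<open>ln (K + ln d)\<close> suffices.
  Keeping the \<open>s\<close> largest estimates costs \<open>6 * \<eta> * sqrt s\<close> on top of the best \<open>s\<close>-term error
  (\<open>L2_set_selected_error\<close>).
  
  The decoder spends \<open>O(ln d)\<close> steps per bucket for the digits, \<open>O(R)\<close> for the insertion into sorted lists
  from which the medians are read, and \<open>O(ln d)\<close> for updating a tournament tree over all indices,
  from which the \<open>s\<close> largest estimates are extracted at the end. Memory is initially zero, so tables
  indexed by all indices cost nothing. The program is written as a structured command,
  compiled to the machine, and verified by symbolic execution together with its running time
  (\<open>total_decoder\<close>).
\<close>

section \<open>Structured programs for the real RAM\<close>

text \<open>
  Programs of the machine are flat lists with absolute jump targets. They are obtained here from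
  structured commands, for which correctness can be argued compositionally. The guards are those that
  the two jump instructions test: \<open>UnlessR a b c\<close> runs \<open>c\<close> if the real register \<open>a\<close> exceeds \<open>b\<close>,
  and \<open>WhileW a b c\<close> runs \<open>c\<close> while the word register \<open>a\<close> is below \<open>b\<close>.
\<close>

datatype com =
    Basic "instr list"
  | Seq com com
  | UnlessR nat nat com
  | WhileW nat nat com

fun size_com :: "com \<Rightarrow> nat" where
  "size_com (Basic is) = length is"
| "size_com (Seq c1 c2) = size_com c1 + size_com c2"
| "size_com (UnlessR a b c) = Suc (size_com c)"
| "size_com (WhileW a b c) = Suc (Suc (size_com c))"

fun assemble :: "nat \<Rightarrow> com \<Rightarrow> program" where
  "assemble l (Basic is) = is"
| "assemble l (Seq c1 c2) = assemble l c1 @ assemble (l + size_com c1) c2"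
| "assemble l (UnlessR a b c) = JumpR a b (Suc l + size_com c) # assemble (Suc l) c"
| "assemble l (WhileW a b c) =
     JumpW b a (Suc (Suc l) + size_com c) # assemble (Suc l) c @ [JumpW 0 0 l]"

lemma length_assemble [simp]: "length (assemble l c) = size_com c"
  by (induction c arbitrary: l) auto

text \<open>
  Word arithmetic is modulo \<open>W\<close>. The weakest precondition of a straight-line block therefore demands
  that every word result is below \<open>W\<close>; the remainder then disappears from all reasoning about programs.
  It is a statement about the three memories only, since the program counter is determined by the
  layout of the code.
\<close>

primrec wp1 :: "nat \<Rightarrow> complex mat \<Rightarrow> real vec \<Rightarrow> instr \<Rightarrow>
    ((nat \<Rightarrow> nat) \<Rightarrow> (nat \<Rightarrow> real) \<Rightarrow> (nat \<Rightarrow> complex) \<Rightarrow> bool) \<Rightarrow>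
    (nat \<Rightarrow> nat) \<Rightarrow> (nat \<Rightarrow> real) \<Rightarrow> (nat \<Rightarrow> complex) \<Rightarrow> bool" where
  "wp1 W M y (WConst a n) Q w r z = (n < W \<and> Q (w(a := n)) r z)"
| "wp1 W M y (WAdd a b c) Q w r z = (w b + w c < W \<and> Q (w(a := w b + w c)) r z)"
| "wp1 W M y (WSub a b c) Q w r z = (w b - w c < W \<and> Q (w(a := w b - w c)) r z)"
| "wp1 W M y (WMul a b c) Q w r z = (w b * w c < W \<and> Q (w(a := w b * w c)) r z)"
| "wp1 W M y (WDiv a b c) Q w r z = (w b div w c < W \<and> Q (w(a := w b div w c)) r z)"
| "wp1 W M y (WMod a b c) Q w r z = (w b mod w c < W \<and> Q (w(a := w b mod w c)) r z)"
| "wp1 W M y (WLoad a b) Q w r z = (w (w b) < W \<and> Q (w(a := w (w b))) r z)"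
| "wp1 W M y (WStore a b) Q w r z = (w b < W \<and> Q (w(w a := w b)) r z)"
| "wp1 W M y (RAdd a b c) Q w r z = Q w (r(a := r b + r c)) z"
| "wp1 W M y (RSub a b c) Q w r z = Q w (r(a := r b - r c)) z"
| "wp1 W M y (RMul a b c) Q w r z = Q w (r(a := r b * r c)) z"
| "wp1 W M y (RDiv a b c) Q w r z = Q w (r(a := r b / r c)) z"
| "wp1 W M y (RSqrt a b) Q w r z = Q w (r(a := sqrt (r b))) z"
| "wp1 W M y (ROfW a b) Q w r z = Q w (r(a := real (w b))) z"
| "wp1 W M y (RLoad a b) Q w r z = Q w (r(a := r (w b))) z"
| "wp1 W M y (RStore a b) Q w r z = Q w (r(w a := r b)) z"
| "wp1 W M y (ReadY a b) Q w r z = Q w (r(a := vec_entry y (w b))) z"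
| "wp1 W M y (ReadRe a b c) Q w r z = Q w (r(a := Re (mat_entry M (w b) (w c)))) z"
| "wp1 W M y (ReadIm a b c) Q w r z = Q w (r(a := Im (mat_entry M (w b) (w c)))) z"
| "wp1 W M y (Write a b c) Q w r z = Q w r (z(w a := Complex (r b) (r c)))"
| "wp1 W M y (JumpW a b l) Q w r z = False"
| "wp1 W M y (JumpR a b l) Q w r z = False"

primrec wp :: "nat \<Rightarrow> complex mat \<Rightarrow> real vec \<Rightarrow> instr list \<Rightarrow>
    ((nat \<Rightarrow> nat) \<Rightarrow> (nat \<Rightarrow> real) \<Rightarrow> (nat \<Rightarrow> complex) \<Rightarrow> bool) \<Rightarrow>
    (nat \<Rightarrow> nat) \<Rightarrow> (nat \<Rightarrow> real) \<Rightarrow> (nat \<Rightarrow> complex) \<Rightarrow> bool" where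
  "wp W M y [] Q = Q"
| "wp W M y (i # is) Q = wp1 W M y i (wp W M y is Q)"

definition code_at :: "program \<Rightarrow> nat \<Rightarrow> program \<Rightarrow> bool" where
  "code_at P l c \<longleftrightarrow> (\<exists>us vs. P = us @ c @ vs \<and> length us = l)"

text \<open>
  Total correctness with a step bound: started at the code of \<open>c\<close>, wherever this code lies in the program,
  the machine reaches its end within \<open>t\<close> steps, in memories that satisfy \<open>Q\<close>. Keeping the initial
  memories as explicit arguments turns the rules below into symbolic execution.
\<close>

definition total_correct :: "nat \<Rightarrow> complex mat \<Rightarrow> real vec \<Rightarrow> com \<Rightarrow> nat \<Rightarrow>
    ((nat \<Rightarrow> nat) \<Rightarrow> (nat \<Rightarrow> real) \<Rightarrow> (nat \<Rightarrow> complex) \<Rightarrow> bool) \<Rightarrow>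
    (nat \<Rightarrow> nat) \<Rightarrow> (nat \<Rightarrow> real) \<Rightarrow> (nat \<Rightarrow> complex) \<Rightarrow> bool" where
  "total_correct W M y c t Q w r z \<longleftrightarrow>
     (\<forall>P l. code_at P l (assemble l c) \<longrightarrow>
        (\<exists>n\<le>t. \<exists>w' r' z'.
           (step P W M y ^^ n) \<lparr>pc = l, wmem = w, rmem = r, outp = z\<rparr> =
             \<lparr>pc = l + size_com c, wmem = w', rmem = r', outp = z'\<rparr> \<and> Q w' r' z'))"

lemma code_at_append:
  "code_at P l (c1 @ c2) \<longleftrightarrow> code_at P l c1 \<and> code_at P (l + length c1) c2"
proof
  assume "code_at P l (c1 @ c2)"
  then obtain us vs where "P = us @ (c1 @ c2) @ vs" "length us = l"
    unfolding code_at_def by blast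
  then have "P = us @ c1 @ (c2 @ vs)" "length us = l"
    "P = (us @ c1) @ c2 @ vs" "length (us @ c1) = l + length c1"
    by auto
  then show "code_at P l c1 \<and> code_at P (l + length c1) c2"
    unfolding code_at_def by blast
next
  assume *: "code_at P l c1 \<and> code_at P (l + length c1) c2"
  then obtain us vs us' vs' where eq: "P = us @ c1 @ vs" "length us = l"
    "P = us' @ c2 @ vs'" "length us' = l + length c1"
    unfolding code_at_def by blast
  from eq have "us' = us @ c1" "c2 @ vs' = vs"
    by (metis append.assoc append_eq_append_conv length_append)+
  then have "P = us @ (c1 @ c2) @ vs'"
    using eq by simp
  then show "code_at P l (c1 @ c2)"
    using eq(2) unfolding code_at_def by blast
qed

lemma code_at_Cons:
  "code_at P l (i # c) \<longleftrightarrow> l < length P \<and> P ! l = i \<and> code_at P (Suc l) c"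
proof -
  have "code_at P l [i] \<longleftrightarrow> l < length P \<and> P ! l = i"
  proof
    assume "l < length P \<and> P ! l = i"
    then show "code_at P l [i]"
      unfolding code_at_def using id_take_nth_drop[of l P]
      by (intro exI[of _ "take l P"] exI[of _ "drop (Suc l) P"]) auto
  qed (auto simp: code_at_def)
  then show ?thesis
    using code_at_append[of P l "[i]" c] by simp
qed

lemma step_at:
  assumes "l < length P"
  shows "step P W M y \<lparr>pc = l, wmem = w, rmem = r, outp = z\<rparr> =
    exec W M y (P ! l) \<lparr>pc = l, wmem = w, rmem = r, outp = z\<rparr>"
  using assms by (simp add: step_def halted_def)

lemma total_mono:
  assumes "total_correct W M y c t Q w r z" "t \<le> t'" "\<And>w r z. Q w r z \<Longrightarrow> Q' w r z"
  shows "total_correct W M y c t' Q' w r z"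
  using assms unfolding total_correct_def by (meson le_trans)

lemma wp_run:
  assumes "wp W M y is Q w r z" "code_at P l is"
  shows "\<exists>w' r' z'. (step P W M y ^^ length is) \<lparr>pc = l, wmem = w, rmem = r, outp = z\<rparr> =
      \<lparr>pc = l + length is, wmem = w', rmem = r', outp = z'\<rparr> \<and> Q w' r' z'"
  using assms
proof (induction "is" arbitrary: w r z l)
  case Nil
  then show ?case by simp
next
  case (Cons i "is")
  obtain w1 r1 z1 where
    "exec W M y i \<lparr>pc = l, wmem = w, rmem = r, outp = z\<rparr> =
       \<lparr>pc = Suc l, wmem = w1, rmem = r1, outp = z1\<rparr>" "wp W M y is Q w1 r1 z1"
    using Cons.prems(1) by (cases i) (auto simp: set_w_def set_r_def set_out_def)
  then show ?case
    using Cons.IH[of w1 r1 z1 "Suc l"] Cons.prems(2)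
    by (auto simp: code_at_Cons step_at funpow_swap1 simp del: funpow.simps(2) simp add: funpow_Suc_right)
qed

lemma total_Basic:
  assumes "wp W M y is Q w r z" "length is \<le> t"
  shows "total_correct W M y (Basic is) t Q w r z"
  using wp_run[OF assms(1)] assms(2) unfolding total_correct_def by fastforce

lemma funpow_add_app: "(f ^^ n) s = s' \<Longrightarrow> (f ^^ m) s' = s'' \<Longrightarrow> (f ^^ (n + m)) s = s''"
  by (metis add.commute comp_apply funpow_add)

lemma total_Seq:
  assumes "total_correct W M y c1 t1 (\<lambda>w r z. total_correct W M y c2 t2 Q w r z) w r z" "t1 + t2 \<le> t"
  shows "total_correct W M y (Seq c1 c2) t Q w r z"
  unfolding total_correct_def
proof (intro allI impI)
  fix P l assume code: "code_at P l (assemble l (Seq c1 c2))"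
  then have code': "code_at P l (assemble l c1)" "code_at P (l + size_com c1) (assemble (l + size_com c1) c2)"
    by (auto simp: code_at_append)
  obtain n w1 r1 z1 where 1: "n \<le> t1"
    "(step P W M y ^^ n) \<lparr>pc = l, wmem = w, rmem = r, outp = z\<rparr> =
       \<lparr>pc = l + size_com c1, wmem = w1, rmem = r1, outp = z1\<rparr>"
    "total_correct W M y c2 t2 Q w1 r1 z1"
    using assms(1) code'(1) unfolding total_correct_def[of _ _ _ c1] by blast
  obtain m w2 r2 z2 where 2: "m \<le> t2"
    "(step P W M y ^^ m) \<lparr>pc = l + size_com c1, wmem = w1, rmem = r1, outp = z1\<rparr> =
       \<lparr>pc = l + size_com c1 + size_com c2, wmem = w2, rmem = r2, outp = z2\<rparr>" "Q w2 r2 z2"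
    using 1(3) code'(2) unfolding total_correct_def by blast
  have "(step P W M y ^^ (n + m)) \<lparr>pc = l, wmem = w, rmem = r, outp = z\<rparr> =
       \<lparr>pc = l + size_com (Seq c1 c2), wmem = w2, rmem = r2, outp = z2\<rparr>"
    using funpow_add_app[OF 1(2) 2(2)] by (simp add: add.assoc)
  moreover have "n + m \<le> t"
    using 1 2 assms(2) by linarith
  ultimately show "\<exists>n\<le>t. \<exists>w' r' z'.
           (step P W M y ^^ n) \<lparr>pc = l, wmem = w, rmem = r, outp = z\<rparr> =
             \<lparr>pc = l + size_com (Seq c1 c2), wmem = w', rmem = r', outp = z'\<rparr> \<and> Q w' r' z'"
    using 2(3) by blast
qed

lemma total_UnlessR:
  assumes "r a \<le> r b \<Longrightarrow> Q w r z" "\<not> r a \<le> r b \<Longrightarrow> total_correct W M y c t Q w r z" "t < t'"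
  shows "total_correct W M y (UnlessR a b c) t' Q w r z"
  unfolding total_correct_def
proof (intro allI impI)
  fix P l assume code: "code_at P l (assemble l (UnlessR a b c))"
  let ?s = "\<lambda>l. \<lparr>pc = l, wmem = w, rmem = r, outp = z\<rparr>"
  have code': "l < length P" "P ! l = JumpR a b (Suc l + size_com c)" "code_at P (Suc l) (assemble (Suc l) c)"
    using code by (auto simp: code_at_Cons)
  show "\<exists>n\<le>t'. \<exists>w' r' z'. (step P W M y ^^ n) (?s l) =
      \<lparr>pc = l + size_com (UnlessR a b c), wmem = w', rmem = r', outp = z'\<rparr> \<and> Q w' r' z'"
  proof (cases "r a \<le> r b")
    case True
    then have "(step P W M y ^^ 1) (?s l) = ?s (l + size_com (UnlessR a b c))"
      using code' by (simp add: step_at)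
    then show ?thesis
      using True assms(1,3) by (metis One_nat_def Suc_leI gr0I not_less_zero zero_less_iff_neq_zero)
  next
    case False
    have 1: "(step P W M y ^^ 1) (?s l) = ?s (Suc l)"
      using code' False by (simp add: step_at)
    obtain n w' r' z' where 2: "n \<le> t" "(step P W M y ^^ n) (?s (Suc l)) =
      \<lparr>pc = Suc l + size_com c, wmem = w', rmem = r', outp = z'\<rparr>" "Q w' r' z'"
      using assms(2)[OF False] code'(3) unfolding total_correct_def by blast
    have "(step P W M y ^^ (1 + n)) (?s l) =
      \<lparr>pc = l + size_com (UnlessR a b c), wmem = w', rmem = r', outp = z'\<rparr>"
      using funpow_add_app[OF 1 2(2)] by simp
    moreover have "1 + n \<le> t'"
      using 2 assms(3) by linarith
    ultimately show ?thesis
      using 2(3) by blast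
  qed
qed

text \<open>
  All loops of the decoder have a number of rounds that is known in advance, so that one rule with an
  invariant indexed by the round gives termination and running time together.
\<close>

lemma total_For:
  assumes I0: "I 0 w r z"
    and body: "\<And>k w r z. k < n \<Longrightarrow> I k w r z \<Longrightarrow> w a < w b \<and> total_correct W M y c t (I (Suc k)) w r z"
    and exit: "\<And>w r z. I n w r z \<Longrightarrow> w b \<le> w a \<and> Q w r z"
    and time: "n * (t + 2) + 1 \<le> t'"
  shows "total_correct W M y (WhileW a b c) t' Q w r z"
  unfolding total_correct_def
proof (intro allI impI)
  fix P l assume code: "code_at P l (assemble l (WhileW a b c))"
  have code': "l < length P" "P ! l = JumpW b a (Suc (Suc l) + size_com c)"
    "code_at P (Suc l) (assemble (Suc l) c)" "Suc l + size_com c < length P" "P ! (Suc l + size_com c) = JumpW 0 0 l"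
    using code by (auto simp: code_at_Cons code_at_append)
  have main: "\<exists>n'\<le>k * (t + 2) + 1. \<exists>w' r' z'. (step P W M y ^^ n') \<lparr>pc = l, wmem = w, rmem = r, outp = z\<rparr> =
      \<lparr>pc = l + size_com (WhileW a b c), wmem = w', rmem = r', outp = z'\<rparr> \<and> Q w' r' z'"
    if "I (n - k) w r z" "k \<le> n" for k w r z
    using that
  proof (induction k arbitrary: w r z)
    case 0
    then have "w b \<le> w a" "Q w r z"
      using exit by auto
    then have "(step P W M y ^^ 1) \<lparr>pc = l, wmem = w, rmem = r, outp = z\<rparr> =
      \<lparr>pc = l + size_com (WhileW a b c), wmem = w, rmem = r, outp = z\<rparr>"
      using code' by (simp add: step_at)
    then show ?case
      using \<open>Q w r z\<close> by (metis add_0 le_refl mult_0)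
  next
    case (Suc k)
    have b: "w a < w b" "total_correct W M y c t (I (n - k)) w r z"
      using body[of "n - Suc k" w r z] Suc.prems by (auto simp: Suc_diff_Suc)
    have 1: "(step P W M y ^^ 1) \<lparr>pc = l, wmem = w, rmem = r, outp = z\<rparr> =
      \<lparr>pc = Suc l, wmem = w, rmem = r, outp = z\<rparr>"
      using code' b by (simp add: step_at)
    obtain n1 w1 r1 z1 where 2: "n1 \<le> t" "(step P W M y ^^ n1) \<lparr>pc = Suc l, wmem = w, rmem = r, outp = z\<rparr> =
      \<lparr>pc = Suc l + size_com c, wmem = w1, rmem = r1, outp = z1\<rparr>" "I (n - k) w1 r1 z1"
      using b(2) code'(3) unfolding total_correct_def by blast
    have 3: "(step P W M y ^^ 1) \<lparr>pc = Suc l + size_com c, wmem = w1, rmem = r1, outp = z1\<rparr> =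
      \<lparr>pc = l, wmem = w1, rmem = r1, outp = z1\<rparr>"
      using step_at[OF code'(4)] code'(5) by simp
    obtain n2 w2 r2 z2 where 4: "n2 \<le> k * (t + 2) + 1"
      "(step P W M y ^^ n2) \<lparr>pc = l, wmem = w1, rmem = r1, outp = z1\<rparr> =
      \<lparr>pc = l + size_com (WhileW a b c), wmem = w2, rmem = r2, outp = z2\<rparr>" "Q w2 r2 z2"
      using Suc.IH[OF 2(3)] Suc.prems by auto
    have "(step P W M y ^^ (1 + n1 + 1 + n2)) \<lparr>pc = l, wmem = w, rmem = r, outp = z\<rparr> =
      \<lparr>pc = l + size_com (WhileW a b c), wmem = w2, rmem = r2, outp = z2\<rparr>"
      by (rule funpow_add_app[OF funpow_add_app[OF funpow_add_app[OF 1 2(2)] 3] 4(2)])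
    moreover have "1 + n1 + 1 + n2 \<le> Suc k * (t + 2) + 1"
      using 2(1) 4(1) by simp
    ultimately show ?case
      using 4(3) by blast
  qed
  show "\<exists>n\<le>t'. \<exists>w' r' z'. (step P W M y ^^ n) \<lparr>pc = l, wmem = w, rmem = r, outp = z\<rparr> =
      \<lparr>pc = l + size_com (WhileW a b c), wmem = w', rmem = r', outp = z'\<rparr> \<and> Q w' r' z'"
    using main[of n w r z] I0 order_trans[OF _ time] unfolding diff_self_eq_0 by blast
qed

text \<open>
  A halted machine does not change, so the state at the least halting time is the state that the
  symbolic execution ends in.
\<close>

lemma total_run:
  assumes "total_correct ((dim_row M + dim_col M + 2) ^ \<kappa>) M y c t Q
     ((\<lambda>_. 0)(0 := dim_row M, 1 := dim_col M, 2 := s)) ((\<lambda>_. 0)(0 := \<epsilon>)) (\<lambda>_. 0)"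
  shows "terminates (assemble 0 c) \<kappa> s \<epsilon> M y" "run_time (assemble 0 c) \<kappa> s \<epsilon> M y \<le> t"
    "\<exists>w r z. Q w r z \<and> recover (assemble 0 c) \<kappa> s \<epsilon> M y = vec (dim_col M) z"
proof -
  let ?P = "assemble 0 c" and ?W = "(dim_row M + dim_col M + 2) ^ \<kappa>"
  have "code_at ?P 0 (assemble 0 c)"
    unfolding code_at_def by auto
  then obtain n w r z where n: "n \<le> t" "run ?P \<kappa> s \<epsilon> M y n = \<lparr>pc = 0 + size_com c, wmem = w, rmem = r, outp = z\<rparr>"
    "Q w r z"
    using assms unfolding total_correct_def run_def init_state_def by blast
  then have h: "halted ?P (run ?P \<kappa> s \<epsilon> M y n)"
    by (simp add: halted_def)
  then show "terminates ?P \<kappa> s \<epsilon> M y"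
    unfolding terminates_def by blast
  have le: "run_time ?P \<kappa> s \<epsilon> M y \<le> n"
    unfolding run_time_def by (rule Least_le) (rule h)
  then show "run_time ?P \<kappa> s \<epsilon> M y \<le> t"
    using n by simp
  have h': "halted ?P (run ?P \<kappa> s \<epsilon> M y (run_time ?P \<kappa> s \<epsilon> M y))"
    unfolding run_time_def by (rule LeastI) (rule h)
  have "run ?P \<kappa> s \<epsilon> M y (k + run_time ?P \<kappa> s \<epsilon> M y) = run ?P \<kappa> s \<epsilon> M y (run_time ?P \<kappa> s \<epsilon> M y)" for k
    using h' by (induction k) (auto simp: run_def step_def)
  from this[of "n - run_time ?P \<kappa> s \<epsilon> M y"] le
  have "run ?P \<kappa> s \<epsilon> M y (run_time ?P \<kappa> s \<epsilon> M y) = run ?P \<kappa> s \<epsilon> M y n"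
    by simp
  then show "\<exists>w r z. Q w r z \<and> recover ?P \<kappa> s \<epsilon> M y = vec (dim_col M) z"
    using n by (auto simp: recover_def)
qed

section \<open>Bit decoding, sorted insertion and tournament trees\<close>

lemma total_Basic': "wp W M y is Q w r z \<Longrightarrow> total_correct W M y (Basic is) (length is) Q w r z"
  by (rule total_Basic) auto

lemma total_Seq':
  "total_correct W M y c1 t1 (\<lambda>w r z. total_correct W M y c2 t2 Q w r z) w r z \<Longrightarrow>
     total_correct W M y (Seq c1 c2) (t1 + t2) Q w r z"
  by (rule total_Seq) auto

lemma total_UnlessR':
  assumes "r a \<le> r b \<Longrightarrow> Q w r z" "\<not> r a \<le> r b \<Longrightarrow> total_correct W M y c t Q w r z"
  shows "total_correct W M y (UnlessR a b c) (Suc t) Q w r z"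
  by (rule total_UnlessR[where t = t]) (use assms in auto)

lemma total_time: "total_correct W M y c t Q w r z \<Longrightarrow> t \<le> t' \<Longrightarrow> total_correct W M y c t' Q w r z"
  by (rule total_mono) auto

lemma total_conseq:
  "total_correct W M y c t Q w r z \<Longrightarrow> (\<And>w r z. Q w r z \<Longrightarrow> Q' w r z) \<Longrightarrow> total_correct W M y c t Q' w r z"
  by (rule total_mono[OF _ order_refl])

text \<open>
  Keeps the simplifier out of code, time bounds and postconditions while it normalises memories.
\<close>

lemma total_weak_cong [cong]:
  "w = w' \<Longrightarrow> r = r' \<Longrightarrow> z = z' \<Longrightarrow> total_correct W M y c t Q w r z = total_correct W M y c t Q w' r' z'"
  by simp

text \<open>
  The word registers are 0 to 2: \<open>D\<close>, \<open>d\<close>, \<open>s\<close>; 3, 4, 5: the constants 1, 2, 0; 6, 7: \<open>2 ^ L\<close> and \<open>L\<close>;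
  8: the number \<open>2 * L + 3\<close> of rows per bucket; 9, 10: the number of buckets and the current one;
  11, 12: the current row and the end of the bit rows; 13: the decoded index; 14, 15, 17: base, end
  and cursor of a list; 16: its length; 17 is also the current tree node; 20: the number of selected
  indices; 18, 19, 21, 22 are auxiliary. Word address \<open>32 + j\<close> holds the length of the list of \<open>j\<close>.
  
  The real registers are 1: zero; 2: the vote threshold; 3: the squared reference measurement; 4, 5:
  auxiliary; 6, 7: the value that is being processed; 9, 10: the normalisation of the output and \<open>-1\<close>.
  All real arrays are interleaved with period 8, which makes them disjoint by residue: residues 0 and
  1 hold the two sorted lists of every index, residue 2 the tree (node \<open>i\<close> at \<open>8 * i + 18\<close>), and residues
  3 and 4 the current estimates.
\<close>

definition bits_code :: com where
  "bits_code = WhileW 11 12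
     (Seq (Basic [WAdd 13 13 13, ReadY 4 11, WAdd 11 11 3, ReadY 5 11, WAdd 11 11 3])
          (UnlessR 4 5 (Basic [WAdd 13 13 3])))"

definition insert_code :: com where
  "insert_code = WhileW 17 15
     (Seq (Basic [RLoad 4 17])
     (Seq (UnlessR 4 6 (Basic [RStore 17 6, RAdd 6 4 1]))
     (Seq (Basic [WAdd 19 17 3, RLoad 5 19])
     (Seq (UnlessR 5 7 (Basic [RStore 19 7, RAdd 7 5 1]))
          (Basic [WAdd 17 17 18])))))"

definition fixup_code :: com where
  "fixup_code = WhileW 5 17
     (Seq (Basic [WConst 22 16, WMul 19 17 22, WConst 22 18, WAdd 19 19 22, RLoad 4 19,
            WConst 22 8, WAdd 19 19 22, RLoad 5 19])
     (Seq (UnlessR 5 4 (Basic [RAdd 4 5 1]))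
          (Basic [WMul 19 17 22, WConst 22 18, WAdd 19 19 22, RStore 19 4, WDiv 17 17 4])))"

definition descend_code :: com where
  "descend_code = WhileW 17 6
     (Seq (Basic [WAdd 17 17 17, WConst 22 8, WMul 19 17 22, WConst 22 18, WAdd 19 19 22,
            RLoad 4 19, WConst 22 8, WAdd 19 19 22, RLoad 5 19])
          (UnlessR 5 4 (Basic [WAdd 17 17 3])))"

fun bits_prefix :: "(nat \<Rightarrow> real) \<Rightarrow> nat \<Rightarrow> nat \<Rightarrow> nat" where
  "bits_prefix Y p 0 = 0"
| "bits_prefix Y p (Suc k) =
     2 * bits_prefix Y p k + (if Y (p + 2 * k) \<le> Y (Suc (p + 2 * k)) then 0 else 1)"

lemma bits_prefix_less: "bits_prefix Y p k < 2 ^ k"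
  by (induction k) auto

lemma total_bits_code:
  assumes w: "w 3 = 1" "w 11 = p" "w 12 = p + 2 * L" "w 13 = 0"
    and W: "p + 2 * L < W" "2 ^ L < W"
    and Q: "\<And>w' r'. \<lbrakk>\<And>a. a \<notin> {11, 13} \<Longrightarrow> w' a = w a; \<And>a. a \<notin> {4, 5} \<Longrightarrow> r' a = r a;
        w' 11 = p + 2 * L; w' 13 = bits_prefix (vec_entry y) p L\<rbrakk> \<Longrightarrow> Q w' r' z"
  shows "total_correct W M y bits_code (L * 9 + 1) Q w r z"
  unfolding bits_code_def
proof -
  define I where "I = (\<lambda>k (w' :: nat \<Rightarrow> nat) (r' :: nat \<Rightarrow> real) z'. z' = z \<and> (\<forall>a. a \<notin> {11, 13} \<longrightarrow> w' a = w a) \<and>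
        (\<forall>a. a \<notin> {4, 5} \<longrightarrow> r' a = r a) \<and>
        w' 11 = p + 2 * k \<and> w' 13 = bits_prefix (vec_entry y) p k)"
  let ?c = "Seq (Basic [WAdd 13 13 13, ReadY 4 11, WAdd 11 11 3, ReadY 5 11, WAdd 11 11 3])
       (UnlessR 4 5 (Basic [WAdd 13 13 3]))"
  show "total_correct W M y (WhileW 11 12 ?c) (L * 9 + 1) Q w r z"
  proof (rule total_For[where n = L and t = 7 and I = I])
    show "I 0 w r z"
      unfolding I_def using w by simp
  next
    fix k w' r' z' assume k: "k < L" and I: "I k w' r' z'"
    have b: "2 * bits_prefix (vec_entry y) p k + 1 < W"
    proof -
      have "bits_prefix (vec_entry y) p k + 1 \<le> 2 ^ k"
        using bits_prefix_less[of "vec_entry y" p k] by simp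
      moreover have "(2::nat) ^ Suc k \<le> 2 ^ L"
        using k by (intro power_increasing) auto
      ultimately show ?thesis
        using W by simp
    qed
    have c: "p + 2 * k + 2 < W"
      using k W by linarith
    have F: "w' 3 = 1" "w' 12 = p + 2 * L" "w' 11 = p + 2 * k" "w' 13 = bits_prefix (vec_entry y) p k" "z' = z"
      and F': "\<And>a. a \<notin> {11, 13} \<Longrightarrow> w' a = w a" "\<And>a. a \<notin> {4, 5} \<Longrightarrow> r' a = r a"
      using I w by (auto simp: I_def)
    have "total_correct W M y ?c 7 (I (Suc k)) w' r' z'"
      apply (rule total_time)
       apply (rule total_Seq' total_Basic')+
       apply (insert b c, simp add: F)
       apply (rule total_UnlessR')
      subgoal by (simp add: I_def F F')
       apply (rule total_Basic')
      subgoal by (simp add: I_def F F')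
      subgoal by simp
      done
    then show "w' 11 < w' 12 \<and> total_correct W M y ?c 7 (I (Suc k)) w' r' z'"
      using F k by simp
  next
    show "w' 12 \<le> w' 11 \<and> Q w' r' z'" if "I L w' r' z'" for w' r' z'
      using that w Q[of w' r'] by (simp add: I_def)
  qed simp
qed


text \<open>
  Insertion into a sorted array is done by a single sweep that carries a value along: every cell keeps
  the minimum of its content and the carried value, and the maximum moves on. On sorted lists this
  is the usual insertion.
\<close>

lemma sorted_insort_Cons: "sorted (x # xs) \<Longrightarrow> insort (u::real) (x # xs) = min u x # insort (max u x) xs"
  by (cases xs) (auto simp: min_def max_def)

lemma nth_insort_real:
  assumes "sorted xs" "i \<le> length xs"
  shows "insort (u::real) xs ! i =
    (if i < length xs then min (fold max (take i xs) u) (xs ! i) else fold max xs u)"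
  using assms
proof (induction xs arbitrary: u i)
  case (Cons x xs)
  have "insort u (x # xs) = min u x # insort (max u x) xs"
    by (rule sorted_insort_Cons) (rule Cons.prems(1))
  then show ?case
    using Cons by (cases i) (auto simp: max.commute)
qed auto

definition carry :: "real list \<Rightarrow> real \<Rightarrow> nat \<Rightarrow> real" where
  "carry xs u k = fold max (take k xs) u"

lemma carry_simps [simp]: "carry xs u 0 = u"
  "k < length xs \<Longrightarrow> carry xs u (Suc k) = max (carry xs u k) (xs ! k)"
  by (auto simp: carry_def take_Suc_conv_app_nth max.commute)

lemma nth_insort_carry:
  assumes "sorted xs" "i \<le> length xs"
  shows "insort u xs ! i = (if i < length xs then min (carry xs u i) (xs ! i) else carry xs u i)"
  using nth_insort_real[OF assms, of u] assms(2) by (auto simp: carry_def)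

lemma total_insert_code:
  assumes w: "w 3 = 1" "w 17 = a0" "w 15 = a0 + 8 * n" "w 18 = 8" and r: "r 1 = 0"
    and n: "length xs = n" "length ys = n" and W: "a0 + 8 * n + 1 < W" "16 \<le> a0"
    and seg: "\<And>i. i < n \<Longrightarrow> r (a0 + 8 * i) = xs ! i" "\<And>i. i < n \<Longrightarrow> r (Suc (a0 + 8 * i)) = ys ! i"
    and Q: "\<And>w' r'. \<lbrakk>\<And>a. a \<notin> {17, 19} \<Longrightarrow> w' a = w a; w' 17 = a0 + 8 * n;
        \<And>a. \<lbrakk>a \<notin> {4, 5, 6, 7}; \<And>i. i < n \<Longrightarrow> a \<noteq> a0 + 8 * i \<and> a \<noteq> Suc (a0 + 8 * i)\<rbrakk> \<Longrightarrow> r' a = r a;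
        \<And>i. i < n \<Longrightarrow> r' (a0 + 8 * i) = min (carry xs (r 6) i) (xs ! i);
        \<And>i. i < n \<Longrightarrow> r' (Suc (a0 + 8 * i)) = min (carry ys (r 7) i) (ys ! i);
        r' 6 = carry xs (r 6) n; r' 7 = carry ys (r 7) n\<rbrakk> \<Longrightarrow> Q w' r' z"
  shows "total_correct W M y insert_code (n * 12 + 1) Q w r z"
  unfolding insert_code_def
proof -
  let ?c = "Seq (Basic [RLoad 4 17])
     (Seq (UnlessR 4 6 (Basic [RStore 17 6, RAdd 6 4 1]))
     (Seq (Basic [WAdd 19 17 3, RLoad 5 19])
     (Seq (UnlessR 5 7 (Basic [RStore 19 7, RAdd 7 5 1]))
          (Basic [WAdd 17 17 18]))))"
  define I where "I = (\<lambda>k (w' :: nat \<Rightarrow> nat) (r' :: nat \<Rightarrow> real) z'. z' = z \<and>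
        (\<forall>a. a \<notin> {17, 19} \<longrightarrow> w' a = w a) \<and> w' 17 = a0 + 8 * k \<and>
        (\<forall>a. a \<notin> {4, 5, 6, 7} \<longrightarrow> (\<forall>i<n. a \<noteq> a0 + 8 * i \<and> a \<noteq> Suc (a0 + 8 * i)) \<longrightarrow> r' a = r a) \<and>
        (\<forall>i<n. r' (a0 + 8 * i) = (if i < k then min (carry xs (r 6) i) (xs ! i) else xs ! i)) \<and>
        (\<forall>i<n. r' (Suc (a0 + 8 * i)) = (if i < k then min (carry ys (r 7) i) (ys ! i) else ys ! i)) \<and>
        r' 6 = carry xs (r 6) k \<and> r' 7 = carry ys (r 7) k)"
  show "total_correct W M y (WhileW 17 15 ?c) (n * 12 + 1) Q w r z"
  proof (rule total_For[where n = n and t = 10 and I = I])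
    show "I 0 w r z"
      unfolding I_def using w r n seg by simp
  next
    fix k w' r' z' assume k: "k < n" and I: "I k w' r' z'"
    have r1: "r' 1 = 0"
    proof -
      have "\<forall>i<n. 1 \<noteq> a0 + 8 * i \<and> 1 \<noteq> Suc (a0 + 8 * i)"
        using W by auto
      then show ?thesis using I r unfolding I_def by simp
    qed
    have F: "w' 3 = 1" "w' 15 = a0 + 8 * n" "w' 17 = a0 + 8 * k" "w' 18 = 8" "z' = z"
        "r' 6 = carry xs (r 6) k" "r' 7 = carry ys (r 7) k" "r' (Suc 0) = 0"
        "r' (a0 + 8 * k) = xs ! k" "r' (Suc (a0 + 8 * k)) = ys ! k"
      using I w k r1 by (auto simp: I_def)
    have F': "\<And>a. a \<notin> {17, 19} \<Longrightarrow> w' a = w a"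
        "\<And>a. \<lbrakk>a \<notin> {4, 5, 6, 7}; \<forall>i<n. a \<noteq> a0 + 8 * i \<and> a \<noteq> Suc (a0 + 8 * i)\<rbrakk> \<Longrightarrow> r' a = r a"
        "\<And>i. i < n \<Longrightarrow> r' (a0 + 8 * i) = (if i < k then min (carry xs (r 6) i) (xs ! i) else xs ! i)"
        "\<And>i. i < n \<Longrightarrow> r' (Suc (a0 + 8 * i)) = (if i < k then min (carry ys (r 7) i) (ys ! i) else ys ! i)"
      using I by (auto simp: I_def)
    have c: "a0 \<noteq> 0" "a0 + 8 * k + 8 < W" "a0 + 8 * k \<noteq> 6" "a0 + 8 * k \<noteq> 7"  "a0 + 8 * k \<noteq> 4" "a0 + 8 * k \<noteq> 5" "a0 + 8 * k \<noteq> 1"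
      "Suc (a0 + 8 * k) \<noteq> 6" "Suc (a0 + 8 * k) \<noteq> 7"  "Suc (a0 + 8 * k) \<noteq> 4" "Suc (a0 + 8 * k) \<noteq> 5" "Suc (a0 + 8 * k) \<noteq> 1"
      using W k by auto
    have ne: "\<And>i. Suc (a0 + 8 * k) \<noteq> a0 + 8 * i" "\<And>i. a0 + 8 * i \<noteq> Suc (a0 + 8 * k)"
        "\<And>i. Suc (a0 + 8 * i) \<noteq> a0 + 8 * k" "\<And>i. a0 + 8 * k \<noteq> Suc (a0 + 8 * i)"
      by presburger+
    have six: "\<And>i. a0 + 8 * i \<noteq> 6" "\<And>i. a0 + 8 * i \<noteq> 7"  "\<And>i. a0 + 8 * i \<noteq> 4" "\<And>i. a0 + 8 * i \<noteq> 5" "\<And>i. a0 + 8 * i \<noteq> 3"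
       "\<And>i. Suc (a0 + 8 * i) \<noteq> 6" "\<And>i. Suc (a0 + 8 * i) \<noteq> 7"  "\<And>i. Suc (a0 + 8 * i) \<noteq> 4" "\<And>i. Suc (a0 + 8 * i) \<noteq> 5"
      using W by auto
    have "total_correct W M y ?c 10 (I (Suc k)) w' r' z'"
      apply (rule total_time)
       apply (rule total_Seq' total_Basic')+
       apply (simp add: F)
       apply (rule total_Seq' total_UnlessR' total_Basic')+
        apply (insert c, simp add: F)
        apply (rule total_Seq' total_UnlessR' total_Basic')+
         apply (simp add: F)
      subgoal by (auto simp: I_def F F' six ne less_Suc_eq k n)
        apply (rule total_Basic')
       apply (simp add: F)
       apply (rule total_Basic')
      subgoal by (auto simp: I_def F F' six ne less_Suc_eq k n)
       apply (rule total_Basic')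
       apply (simp add: F)
       apply (rule total_Seq' total_UnlessR' total_Basic')+
        apply (simp add: F)
        apply (rule total_Seq' total_UnlessR' total_Basic')+
         apply (simp add: F)
      subgoal by (auto simp: I_def F F' six ne less_Suc_eq k n)
        apply (rule total_Basic')
       apply (simp add: F)
       apply (rule total_Basic')
      subgoal by (auto simp: I_def F F' six ne less_Suc_eq k n)
      subgoal by simp
      done
    then show "w' 17 < w' 15 \<and> total_correct W M y ?c 10 (I (Suc k)) w' r' z'"
      using F k by simp
  next
    show "w' 15 \<le> w' 17 \<and> Q w' r' z'" if "I n w' r' z'" for w' r' z'
      using that w Q[of w' r'] by (simp add: I_def)
  qed simp
qed


text \<open>
  The tree is a tournament: every inner node holds the maximum of its two children. The set \<open>X\<close> collects
  the nodes at which this may currently fail.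
\<close>

definition heap :: "nat \<Rightarrow> (nat \<Rightarrow> real) \<Rightarrow> nat set \<Rightarrow> bool" where
  "heap L r X \<longleftrightarrow> (\<forall>i\<in>{1..<2 ^ L} - X. r (8 * i + 18) = max (r (16 * i + 18)) (r (16 * i + 26)))"

text \<open>
  Recomputing a node repairs it and can only spoil its parent, so the defect climbs from the parent of
  the changed leaf to the root and disappears there.
\<close>

lemma total_fixup_code:
  assumes w: "w 3 = 1" "w 4 = 2" "w 5 = 0" "w 17 = i0" and r: "r 1 = 0"
    and i0: "i0 div 2 ^ L = 0" "0 < L \<Longrightarrow> 0 < i0 div 2 ^ (L - 1)" and W: "16 * 2 ^ L + 26 < W"
    and h: "heap L r {i0}"
    and Q: "\<And>w' r'. \<lbrakk>\<And>a. a \<notin> {17, 19, 22} \<Longrightarrow> w' a = w a;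
        \<And>a. \<lbrakk>a \<notin> {4, 5}; \<And>i. i \<in> {1..<2 ^ L} \<Longrightarrow> a \<noteq> 8 * i + 18\<rbrakk> \<Longrightarrow> r' a = r a;
        heap L r' {}\<rbrakk> \<Longrightarrow> Q w' r' z"
  shows "total_correct W M y fixup_code (L * 17 + 1) Q w r z"
  unfolding fixup_code_def
proof -
  let ?c = "Seq (Basic [WConst 22 16, WMul 19 17 22, WConst 22 18, WAdd 19 19 22, RLoad 4 19,
            WConst 22 8, WAdd 19 19 22, RLoad 5 19])
     (Seq (UnlessR 5 4 (Basic [RAdd 4 5 1]))
          (Basic [WMul 19 17 22, WConst 22 18, WAdd 19 19 22, RStore 19 4, WDiv 17 17 4]))"
  define I where "I = (\<lambda>k (w' :: nat \<Rightarrow> nat) (r' :: nat \<Rightarrow> real) z'. z' = z \<and>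
        (\<forall>a. a \<notin> {17, 19, 22} \<longrightarrow> w' a = w a) \<and> w' 17 = i0 div 2 ^ k \<and>
        (\<forall>a. a \<notin> {4, 5} \<longrightarrow> (\<forall>i\<in>{1..<2 ^ L}. a \<noteq> 8 * i + 18) \<longrightarrow> r' a = r a) \<and>
        heap L r' {i0 div 2 ^ k})"
  show "total_correct W M y (WhileW 5 17 ?c) (L * 17 + 1) Q w r z"
  proof (rule total_For[where n = L and t = 15 and I = I])
    show "I 0 w r z"
      unfolding I_def using w h by simp
  next
    fix k w' r' z' assume k: "k < L" and I: "I k w' r' z'"
    define i where "i = i0 div 2 ^ k"
    have "i \<le> i0"
      unfolding i_def by (rule div_le_dividend)
    have "i0 < 2 ^ L"
      using i0(1) by (simp add: div_eq_0_iff)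
    then have il: "i < 2 ^ L"
      using \<open>i \<le> i0\<close> by simp
    have "i0 div 2 ^ (L - 1) \<le> i"
      unfolding i_def using k by (intro div_le_mono2) (auto intro: power_increasing)
    then have ipos: "0 < i"
      using i0(2) k by linarith
    have "\<forall>j\<in>{1..<2 ^ L}. (1::nat) \<noteq> 8 * j + 18"
      by auto
    then have r1: "r' 1 = 0"
      using I r unfolding I_def by simp
    have F: "w' 3 = 1" "w' 4 = 2" "w' 5 = 0" "w' 17 = i" "z' = z" "r' (Suc 0) = 0"
      using I w r1 by (auto simp: I_def i_def)
    have F': "\<And>a. a \<notin> {17, 19, 22} \<Longrightarrow> w' a = w a"
      "\<And>a. \<lbrakk>a \<notin> {4, 5}; \<forall>i\<in>{1..<2 ^ L}. a \<noteq> 8 * i + 18\<rbrakk> \<Longrightarrow> r' a = r a"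
      and hp: "heap L r' {i}"
      using I by (auto simp: I_def i_def)
    have b: "16 * i + 26 < W" "8 * i + 18 < W" "16 * i + 18 < W" "i * 16 + 26 < W" "i * 8 + 18 < W" "i * 16 + 18 < W"
      "i * 16 < W" "i * 8 < W" "i < W" "26 < W"
      using W il by linarith+
    have step: "heap L r'' {i div 2}" if
       "\<And>a. a \<notin> {4, 5, 8 * i + 18} \<Longrightarrow> r'' a = r' a" "r'' (8 * i + 18) = max (r' (16 * i + 18)) (r' (16 * i + 26))" for r''
      unfolding heap_def
    proof
      fix j assume j: "j \<in> {1..<2 ^ L} - {i div 2}"
      have ne: "16 * j + 18 \<noteq> 8 * i + 18" "16 * j + 26 \<noteq> 8 * i + 18"
      proof -
        have "i \<noteq> 2 * j" "i \<noteq> 2 * j + 1"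
          using j by auto
        then show "16 * j + 18 \<noteq> 8 * i + 18" "16 * j + 26 \<noteq> 8 * i + 18"
          by presburger+
      qed
      show "r'' (8 * j + 18) = max (r'' (16 * j + 18)) (r'' (16 * j + 26))"
      proof (cases "j = i")
        case True
        then show ?thesis
          using ne that by simp
      next
        case False
        then show ?thesis
          using j hp ne that(1) unfolding heap_def by simp
      qed
    qed
    have div: "i0 div (2 * 2 ^ k) = i div 2"
      unfolding i_def by (metis div_mult2_eq mult.commute)
    have fr: "\<forall>j\<in>{1..<2 ^ L}. a \<noteq> 8 * j + 18 \<Longrightarrow> a \<noteq> 8 * i + 18" for a
      using il ipos by auto
    have "total_correct W M y ?c 15 (I (Suc k)) w' r' z'"
      apply (rule total_time)
       apply (rule total_Seq' total_Basic')+
       apply (insert b, simp add: F)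
       apply (rule total_Seq' total_UnlessR' total_Basic')+
        apply (simp add: F)
      subgoal premises p
      proof -
        from p have "heap L (r'(4 := r' (16 * i + 18), 5 := r' (16 * i + 26), 8 * i + 18 := max (r' (16 * i + 18)) (r' (16 * i + 26)))) {i div 2}"
          by (intro step) auto
        then show ?thesis
          unfolding I_def using p fr
          by (auto simp: F F' div mult.commute[of i] add.commute[of 26] max_def)
      qed
       apply (rule total_Basic')
       apply (simp add: F)
       apply (rule total_Basic')
       apply (simp add: F)
      subgoal premises p
      proof -
        from p have "heap L (r'(5 := r' (16 * i + 26), 4 := r' (16 * i + 26), 8 * i + 18 := max (r' (16 * i + 18)) (r' (16 * i + 26)))) {i div 2}"
          by (intro step) auto
        then show ?thesis
          unfolding I_def using p fr
          by (auto simp: F F' div mult.commute[of i] add.commute[of 26] max_def)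
      qed
      subgoal by simp
      done
    then show "w' 5 < w' 17 \<and> total_correct W M y ?c 15 (I (Suc k)) w' r' z'"
      using F ipos by simp
  next
    show "w' 17 \<le> w' 5 \<and> Q w' r' z'" if "I L w' r' z'" for w' r' z'
    proof -
      have "heap L r' {0}" "w' 17 = 0" "w' 5 = 0"
        using that i0 w by (auto simp: I_def)
      then have "heap L r' {}"
        unfolding heap_def by auto
      then show ?thesis
        using that Q[of w' r'] \<open>w' 17 = 0\<close> \<open>w' 5 = 0\<close> by (simp add: I_def)
    qed
  qed simp
qed

lemma heap_leaf_le:
  assumes "heap L r {}" "2 ^ L \<le> l" "l < 2 * 2 ^ L" "k \<le> L"
  shows "r (8 * l + 18) \<le> r (8 * (l div 2 ^ k) + 18)"
  using assms(4)
proof (induction k)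
  case (Suc k)
  define i where "i = l div 2 ^ k"
  have d: "l div 2 ^ Suc k = i div 2"
    unfolding i_def by (metis div_mult2_eq mult.commute power_Suc)
  have "(2::nat) ^ L = 2 ^ Suc k * 2 ^ (L - Suc k)"
    using Suc.prems by (metis le_add_diff_inverse power_add)
  then have "2 ^ (L - Suc k) \<le> l div 2 ^ Suc k"
    using assms(2) by (metis div_le_mono nonzero_mult_div_cancel_left power_not_zero zero_neq_numeral)
  then have pos: "1 \<le> i div 2"
    unfolding d using le_trans[OF one_le_power[of "2::nat" "L - Suc k"]] by auto
  have "l div 2 < 2 ^ L"
    using assms(3) by auto
  moreover have "l div 2 ^ Suc k \<le> l div 2 ^ Suc 0"
    by (intro div_le_mono2) (auto intro: power_increasing)
  ultimately have lt: "i div 2 < 2 ^ L"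
    unfolding d by simp
  have "r (8 * (i div 2) + 18) = max (r (16 * (i div 2) + 18)) (r (16 * (i div 2) + 26))"
    using assms(1) pos lt unfolding heap_def by auto
  moreover have "8 * i + 18 = 16 * (i div 2) + 18 \<or> 8 * i + 18 = 16 * (i div 2) + 26"
    by presburger
  ultimately have "r (8 * i + 18) \<le> r (8 * (i div 2) + 18)"
    by (metis max.cobounded1 max.cobounded2)
  then show ?case
    using Suc.IH Suc.prems unfolding d i_def by simp
qed simp

text \<open>
  Following the larger child keeps the value of the root and therefore ends at a maximal leaf.
\<close>

lemma total_descend_code:
  assumes w: "w 3 = 1" "w 6 = 2 ^ L" "w 17 = 1"
    and W: "16 * 2 ^ L + 26 < W"
    and h: "heap L r {}"
    and Q: "\<And>w' r'. \<lbrakk>\<And>a. a \<notin> {17, 19, 22} \<Longrightarrow> w' a = w a;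
        \<And>a. a \<notin> {4, 5} \<Longrightarrow> r' a = r a;
        2 ^ L \<le> w' 17; w' 17 < 2 * 2 ^ L; r (8 * w' 17 + 18) = r 26\<rbrakk> \<Longrightarrow> Q w' r' z"
  shows "total_correct W M y descend_code (L * 13 + 1) Q w r z"
  unfolding descend_code_def
proof -
  let ?c = "Seq (Basic [WAdd 17 17 17, WConst 22 8, WMul 19 17 22, WConst 22 18, WAdd 19 19 22,
            RLoad 4 19, WConst 22 8, WAdd 19 19 22, RLoad 5 19])
          (UnlessR 5 4 (Basic [WAdd 17 17 3]))"
  define I where "I = (\<lambda>k (w' :: nat \<Rightarrow> nat) (r' :: nat \<Rightarrow> real) z'. z' = z \<and>
        (\<forall>a. a \<notin> {17, 19, 22} \<longrightarrow> w' a = w a) \<and> (\<forall>a. a \<notin> {4, 5} \<longrightarrow> r' a = r a) \<and>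
        2 ^ k \<le> w' 17 \<and> w' 17 < 2 * 2 ^ k \<and> r (8 * w' 17 + 18) = r 26)"
  show "total_correct W M y (WhileW 17 6 ?c) (L * 13 + 1) Q w r z"
  proof (rule total_For[where n = L and t = 11 and I = I])
    show "I 0 w r z"
      unfolding I_def using w h by simp
  next
    fix k w' r' z' assume k: "k < L" and I: "I k w' r' z'"
    define i where "i = w' 17"
    have i: "2 ^ k \<le> i" "i < 2 * 2 ^ k" "r (8 * i + 18) = r 26"
      using I unfolding I_def i_def by auto
    have "2 * (2::nat) ^ k \<le> 2 ^ L"
      using k power_increasing[of "Suc k" L "2::nat"] by simp
    then have il: "i < 2 ^ L"
      using i by linarith
    have ipos: "0 < i"
      using i(1) by (metis gr0I le_zero_eq power_not_zero zero_neq_numeral)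
    have F: "w' 3 = 1" "w' 6 = 2 ^ L" "w' 17 = i" "z' = z"
      using I w by (auto simp: I_def i_def)
    have F': "\<And>a. a \<notin> {17, 19, 22} \<Longrightarrow> w' a = w a" "\<And>a. a \<notin> {4, 5} \<Longrightarrow> r' a = r a"
      using I by (auto simp: I_def i_def)
    have b: "i * 16 + 26 < W"  "i * 16 + 18 < W"
      "i * 16 < W" "i + i < W" "Suc (i + i) < W" "26 < W"
      using W il by linarith+
    have m: "r (8 * i + 18) = max (r (16 * i + 18)) (r (16 * i + 26))"
      using h il ipos unfolding heap_def by auto
    have e: "(i + i) * 8 = 16 * i" "8 * (i + i) = 16 * i" "8 * Suc (i + i) + 18 = 16 * i + 26"
      by simp_all
    have "total_correct W M y ?c 11 (I (Suc k)) w' r' z'"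
      apply (rule total_time)
       apply (rule total_Seq' total_Basic')+
       apply (insert b, simp add: F)
       apply (rule total_Seq' total_UnlessR' total_Basic')+
        apply (simp add: F)
      subgoal premises p
        unfolding I_def using p i m
        by (auto simp: F F' max_def algebra_simps split: if_splits)
       apply (rule total_Basic')
       apply (simp add: F)
      subgoal premises p
        unfolding I_def using p i m
        by (auto simp: F F' max_def algebra_simps split: if_splits)
      subgoal by simp
      done
    then show "w' 17 < w' 6 \<and> total_correct W M y ?c 11 (I (Suc k)) w' r' z'"
      using F il by simp
  next
    show "w' 6 \<le> w' 17 \<and> Q w' r' z'" if "I L w' r' z'" for w' r' z'
      using that w Q[of w' r'] by (simp add: I_def)
  qed simp
qed

section \<open>The decoding program\<close>

text \<open>
  After a list of \<open>j\<close> has grown beyond the threshold, its median becomes the estimate of \<open>j\<close>, and the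
  squared magnitude of the estimate becomes the key of leaf \<open>j\<close> of the tournament tree.
\<close>

definition update_code :: com where
  "update_code = Seq (Basic [WDiv 19 16 4, WMul 19 19 18, WAdd 19 19 14, RLoad 6 19, WAdd 19 19 3, RLoad 7 19,
      WMul 19 13 18, WConst 22 19, WAdd 19 19 22, RStore 19 6, WAdd 19 19 3, RStore 19 7,
      RMul 6 6 6, RMul 7 7 7, RAdd 6 6 7,
      WAdd 17 6 13, WMul 19 17 18, WConst 22 18, WAdd 19 19 22, RStore 19 6, WDiv 17 17 4]) fixup_code"

text \<open>
  The sweep leaves the largest value in the carrying registers; it is appended to the list.
\<close>

definition store_code :: com where
  "store_code = Seq (Basic [RStore 17 6, WAdd 19 17 3, RStore 19 7, WAdd 16 16 3, WStore 21 16, ROfW 4 16])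
     (UnlessR 4 2 update_code)"

text \<open>
  With reference \<open>b\<close> and bucket sum \<open>a\<close>, the registers 6 and 7 receive the real and imaginary part of
  \<open>2 * a * cnj b\<close>, computed from the four squared magnitudes of \<open>a\<close>, \<open>b\<close>, \<open>b + a\<close>, \<open>b + \<i> * a\<close>.
\<close>

definition accept_code :: com where
  "accept_code = Seq (Basic [ReadY 4 11, WAdd 11 11 3, ReadY 6 11, WAdd 11 11 3, ReadY 7 11,
      RAdd 4 4 3, RSub 6 6 4, RSub 7 4 7,
      WMul 14 13 9, WConst 18 8, WMul 14 14 18, WConst 19 16, WAdd 14 14 19,
      WConst 21 32, WAdd 21 21 13, WLoad 16 21, WMul 15 16 18, WAdd 15 15 14, WAdd 17 14 5])
     (Seq insert_code store_code)"

text \<open>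
  A decoded index is only trusted if the matrix confirms that it belongs to the bucket that it was
  decoded from. An index that is out of range reads as entry 0 and is rejected by the same test.
\<close>

definition bucket_code :: com where
  "bucket_code = Seq (Basic [WMul 11 10 8, WAdd 11 11 4, WAdd 12 7 7, WAdd 12 11 12, WConst 13 0])
     (Seq bits_code (Seq (Seq (Basic [ReadRe 4 11 13]) (UnlessR 4 1 accept_code)) (Basic [WAdd 10 10 3])))"

text \<open>
  Bucket count and word length are recomputed from \<open>D\<close> and \<open>d\<close>. The vote threshold cannot be; it
  is passed in the second row of the matrix.
\<close>

definition setup_code :: com where
  "setup_code = Seq (Basic [WConst 3 1, WConst 4 2, WConst 6 1])
     (Seq (WhileW 6 1 (Basic [WAdd 6 6 6, WAdd 7 7 3]))
          (Basic [WMul 8 7 4, WConst 18 3, WAdd 8 8 18, WSub 9 0 4, WDiv 9 9 8, ReadRe 2 3 5, ReadY 3 5]))"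

text \<open>
  Selected leaves get the key \<open>-1\<close>, which is below all other keys, so that no leaf is chosen twice.
\<close>

definition select_code :: com where
  "select_code = Seq (Basic [RSqrt 9 3, RAdd 9 9 9, ROfW 10 3, RSub 10 1 10, WConst 20 0])
     (WhileW 20 2 (Seq (Basic [WConst 17 1]) (Seq descend_code
        (Seq (Basic [WSub 13 17 6, WConst 18 8, WMul 19 13 18, WConst 22 19, WAdd 19 19 22, RLoad 6 19,
            WAdd 19 19 3, RLoad 7 19, RDiv 6 6 9, RDiv 7 7 9, Write 13 6 7,
            WMul 19 17 18, WConst 22 18, WAdd 19 19 22, RStore 19 10, WDiv 17 17 4])
        (Seq fixup_code (Basic [WAdd 20 20 3]))))))"

definition decoder_code :: com where
  "decoder_code = Seq setup_code (Seq (WhileW 10 9 bucket_code) select_code)"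

lemma heap_update_leaf:
  assumes "heap L r {}" "2 ^ L \<le> l"
    "\<And>a. a mod 8 = 2 \<Longrightarrow> 26 \<le> a \<Longrightarrow> a \<noteq> 8 * l + 18 \<Longrightarrow> r' a = r a"
  shows "heap L r' {l div 2}"
  unfolding heap_def
proof
  fix i assume i: "i \<in> {1..<2 ^ L} - {l div 2}"
  have ne: "8 * i + 18 \<noteq> 8 * l + 18" "16 * i + 18 \<noteq> 8 * l + 18" "16 * i + 26 \<noteq> 8 * l + 18"
    using i assms(2) by auto
  have m: "(8 * i + 18) mod 8 = 2" "(16 * i + 18) mod 8 = 2" "(16 * i + 26) mod 8 = 2"
    by presburger+
  have "r (8 * i + 18) = max (r (16 * i + 18)) (r (16 * i + 26))"
    using assms(1) i unfolding heap_def by simp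
  then show "r' (8 * i + 18) = max (r' (16 * i + 18)) (r' (16 * i + 26))"
    using i assms(3)[OF m(1) _ ne(1)] assms(3)[OF m(2) _ ne(2)] assms(3)[OF m(3) _ ne(3)] by auto
qed

lemma leaf_parent:
  assumes "(2::nat) ^ L \<le> l" "l < 2 * 2 ^ L"
  shows "l div 2 div 2 ^ L = 0" "0 < L \<Longrightarrow> 0 < l div 2 div 2 ^ (L - 1)"
proof -
  show "l div 2 div 2 ^ L = 0"
    using assms(2) by (simp add: div_eq_0_iff less_mult_imp_div_less mult.commute)
  assume "0 < L"
  then have "2 ^ (L - 1) = (2::nat) ^ L div 2"
    by (cases L) auto
  then have "2 ^ (L - 1) \<le> l div 2"
    using assms(1) div_le_mono by metis
  then show "0 < l div 2 div 2 ^ (L - 1)"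
    by (simp add: div_greater_zero_iff)
qed

text \<open>
  The analysis of the program for an arbitrary matrix and an arbitrary measurement vector, with \<open>Q\<close>
  buckets altogether. The bound on \<open>W\<close> excludes every overflow.
\<close>

locale decoder =
  fixes W :: nat and M :: "complex mat" and y :: "real vec" and L s Q :: nat and T :: real
  assumes W: "64 + 16 * (2 ^ L * (Q + 1)) + Q * (2 * L + 3) + s < W"
    and T: "0 \<le> T"
begin

definition row :: "nat \<Rightarrow> nat" where
  "row q = q * (2 * L + 3) + 2"

definition dec :: "nat \<Rightarrow> nat" where
  "dec q = bits_prefix (vec_entry y) (row q) L"

definition acc :: "nat \<Rightarrow> bool" where
  "acc q \<longleftrightarrow> 0 < Re (mat_entry M (row q + 2 * L) (dec q))"

definition re_val :: "nat \<Rightarrow> real" where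
  "re_val q = vec_entry y (row q + 2 * L + 1) - (vec_entry y (row q + 2 * L) + vec_entry y 0)"

definition im_val :: "nat \<Rightarrow> real" where
  "im_val q = (vec_entry y (row q + 2 * L) + vec_entry y 0) - vec_entry y (row q + 2 * L + 2)"

definition hits :: "nat \<Rightarrow> nat \<Rightarrow> nat list" where
  "hits q j = filter (\<lambda>i. acc i \<and> dec i = j) [0..<q]"

definition med :: "(nat \<Rightarrow> real) \<Rightarrow> nat \<Rightarrow> nat \<Rightarrow> real" where
  "med f q j = (if real (length (hits q j)) \<le> T then 0
     else sort (map f (hits q j)) ! (length (hits q j) div 2))"

definition regs :: "(nat \<Rightarrow> nat) \<Rightarrow> (nat \<Rightarrow> real) \<Rightarrow> bool" where
  "regs w r \<longleftrightarrow> w 2 = s \<and> w 3 = 1 \<and> w 4 = 2 \<and> w 5 = 0 \<and> w 6 = 2 ^ L \<and> w 7 = L \<and> w 8 = 2 * L + 3 \<and> w 9 = Q \<and>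
     r 1 = 0 \<and> r 2 = T \<and> r 3 = vec_entry y 0"

lemma regsD:
  assumes "regs w r"
  shows "w 2 = s" "w 3 = 1" "w 4 = 2" "w 5 = 0" "w 6 = 2 ^ L" "w 7 = L" "w 8 = 2 * L + 3" "w 9 = Q"
    "r 1 = 0" "r 2 = T" "r 3 = vec_entry y 0"
  using assms unfolding regs_def by auto

definition counts :: "nat \<Rightarrow> (nat \<Rightarrow> nat) \<Rightarrow> bool" where
  "counts q w \<longleftrightarrow> (\<forall>j<2 ^ L. w (32 + j) = length (hits q j))"

text \<open>
  Every list gets \<open>Q\<close> cells, as many as there are buckets, so that lists of different indices cannot
  meet.
\<close>

definition cell :: "nat \<Rightarrow> nat \<Rightarrow> nat" where
  "cell j c = j * Q * 8 + 16 + 8 * c"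

definition lists :: "nat \<Rightarrow> (nat \<Rightarrow> real) \<Rightarrow> bool" where
  "lists q r \<longleftrightarrow> (\<forall>j<2 ^ L. \<forall>c<length (hits q j).
     r (cell j c) = sort (map re_val (hits q j)) ! c \<and>
     r (Suc (cell j c)) = sort (map im_val (hits q j)) ! c)"

definition ests :: "(nat \<Rightarrow> real) \<Rightarrow> (nat \<Rightarrow> real) \<Rightarrow> (nat \<Rightarrow> real) \<Rightarrow> bool" where
  "ests E F r \<longleftrightarrow> (\<forall>j<2 ^ L. r (8 * j + 19) = E j \<and> r (8 * j + 20) = F j \<and>
     r (8 * (2 ^ L + j) + 18) = (E j)\<^sup>2 + (F j)\<^sup>2) \<and> heap L r {}"

lemma W_simple: "16 * 2 ^ L + 64 < W" "Q * (2 * L + 3) + 2 < W" "s < W" "8 * (2 ^ L * Q) + 64 < W"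
proof -
  have "16 * (2 ^ L * (Q + 1)) = 16 * (2 ^ L * Q) + 16 * 2 ^ L"
    by (simp add: algebra_simps)
  then show "16 * 2 ^ L + 64 < W" "Q * (2 * L + 3) + 2 < W" "s < W" "8 * (2 ^ L * Q) + 64 < W"
    using W by linarith+
qed

lemma W_bounds:
  assumes "j < 2 ^ L" "c \<le> Q"
  shows "cell j c + 1 < W" "j * Q + Q \<le> 2 ^ L * Q"
proof -
  have "(j + 1) * Q \<le> 2 ^ L * Q"
    using assms(1) by (intro mult_right_mono) auto
  then show "j * Q + Q \<le> 2 ^ L * Q"
    by simp
  then show "cell j c + 1 < W"
  proof -
    have *: "a * 8 + 16 + 8 * c + 1 < W" if "a + Q \<le> b" "8 * b + 64 < W" for a b
      using that assms(2) by linarith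
    show ?thesis
      unfolding cell_def by (rule *[OF \<open>j * Q + Q \<le> 2 ^ L * Q\<close> W_simple(4)])
  qed
qed

lemma address_mod:
  "(8 * i + 18) mod 8 = (2::nat)" "(16 * i + 18) mod 8 = (2::nat)" "(16 * i + 26) mod 8 = (2::nat)"
  "(8 * i + 19) mod 8 = (3::nat)" "(8 * i + 20) mod 8 = (4::nat)"
  by presburger+

lemma neq_if_mod: "m mod 8 < 2 \<Longrightarrow> 2 \<le> a mod 8 \<Longrightarrow> a \<noteq> (m :: nat)"
  by auto

lemma ests_frame:
  assumes "ests E F r" "\<And>a. 16 \<le> a \<Longrightarrow> 2 \<le> a mod 8 \<Longrightarrow> r' a = r a"
  shows "ests E F r'"
proof -
  have "r' (8 * j + 19) = r (8 * j + 19)" "r' (8 * j + 20) = r (8 * j + 20)"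
    "r' (8 * j + 18) = r (8 * j + 18)" "r' (16 * j + 18) = r (16 * j + 18)" "r' (16 * j + 26) = r (16 * j + 26)" for j
    by (rule assms(2); simp only: address_mod; simp)+
  note * = this
  show ?thesis
    using assms(1) *(3)[of "2 ^ L + j" for j] * unfolding ests_def heap_def by simp
qed

lemma total_update:
  assumes regs: "regs w r" and w: "w 13 = j" "w 14 = a0" "w 16 = n" "w 18 = 8"
    and j: "j < 2 ^ L" and a0: "a0 + 8 * n + 1 < W" "16 \<le> a0"
    and r: "r (a0 + 8 * (n div 2)) = e" "r (Suc (a0 + 8 * (n div 2))) = f"
    and ests: "ests E F r"
    and K: "\<And>w' r'. \<lbrakk>\<And>a. a \<notin> {17, 19, 22} \<Longrightarrow> w' a = w a;
        \<And>a. a < 4 \<or> 16 \<le> a \<and> a mod 8 < 2 \<Longrightarrow> r' a = r a;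
        ests (E(j := e)) (F(j := f)) r'\<rbrakk> \<Longrightarrow> K w' r' z"
  shows "total_correct W M y update_code (L * 17 + 30) K w r z"
proof -
  note R = regsD[OF regs]
  have rr: "r (n div 2 * 8 + a0) = e" "r (Suc (n div 2 * 8 + a0)) = f"
    using r by (simp_all add: algebra_simps)
  have b: "n div 2 < W" "n div 2 * 8 < W" "n div 2 * 8 + a0 < W" "Suc (n div 2 * 8 + a0) < W"
    "j * 8 < W" "j * 8 + 19 < W" "Suc (j * 8 + 19) < W" "2 ^ L + j < W" "(2 ^ L + j) * 8 < W" "19 < W" "18 < W"
    "(2 ^ L + j) * 8 + 18 < W" "20 + j * 8 < W" "2 ^ L * 8 + j * 8 < W" "2 ^ L * 8 + j * 8 + 18 < W"
    "n div 2 * 8 + a0 \<noteq> 5"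
    "(2 ^ L + j) div 2 < W"
    using a0 W_simple j by auto
  define l where "l = 2 ^ L + j"
  have l: "2 ^ L \<le> l" "l < 2 * 2 ^ L"
    unfolding l_def using j by auto
  define r2 where "r2 = r(6 := e\<^sup>2 + f\<^sup>2, 7 := f\<^sup>2, 8 * j + 19 := e, 8 * j + 20 := f, 8 * l + 18 := e\<^sup>2 + f\<^sup>2)"
  have r2: "r2 (8 * j' + 19) = (E(j := e)) j'" "r2 (8 * j' + 20) = (F(j := f)) j'"
    "r2 (8 * (2 ^ L + j') + 18) = ((E(j := e)) j')\<^sup>2 + ((F(j := f)) j')\<^sup>2" if "j' < 2 ^ L" for j'
  proof -
    have n1: "8 * j' + 19 \<noteq> 8 * j + 20" "8 * j' + 19 \<noteq> 8 * l + 18" "8 * j' + 20 \<noteq> 8 * j + 19" "8 * j' + 20 \<noteq> 8 * l + 18"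
      "8 * (2 ^ L + j') + 18 \<noteq> 8 * j + 20" "8 * (2 ^ L + j') + 18 \<noteq> 8 * j + 19"
      by presburger+
    have e: "r (8 * j' + 19) = E j'" "r (8 * j' + 20) = F j'" "r (8 * (2 ^ L + j') + 18) = (E j')\<^sup>2 + (F j')\<^sup>2"
      using ests that unfolding ests_def by auto
    show "r2 (8 * j' + 19) = (E(j := e)) j'" "r2 (8 * j' + 20) = (F(j := f)) j'"
      using n1 e unfolding r2_def by auto
    show "r2 (8 * (2 ^ L + j') + 18) = ((E(j := e)) j')\<^sup>2 + ((F(j := f)) j')\<^sup>2"
      using n1 e(3) unfolding r2_def l_def by (auto simp: algebra_simps)
  qed
  have heap2: "heap L r2 {l div 2}"
  proof (rule heap_update_leaf[of L r])
    show "heap L r {}"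
      using ests unfolding ests_def by simp
    show "2 ^ L \<le> l"
      by fact
    show "r2 a = r a" if "a mod 8 = 2" "26 \<le> a" "a \<noteq> 8 * l + 18" for a
    proof -
      have "a \<noteq> 8 * j + 19" "a \<noteq> 8 * j + 20" "a \<noteq> 6" "a \<noteq> 7"
        using that by auto
      then show ?thesis
        using that unfolding r2_def by simp
    qed
  qed
  have low: "r2 a = r a" if "a < 4 \<or> 16 \<le> a \<and> a mod 8 < 2" for a
  proof -
    have "a \<noteq> 8 * j + 19" "a \<noteq> 8 * j + 20" "a \<noteq> 6" "a \<noteq> 7" "a \<noteq> 8 * l + 18"
      using that by auto
    then show ?thesis
      unfolding r2_def by simp
  qed
  define w2 where "w2 = w(22 := 18, 19 := l * 8 + 18, 17 := l div 2)"
  have main: "total_correct W M y fixup_code (L * 17 + 1) K w2 r2 z"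
  proof (rule total_fixup_code[where ?i0.0 = "l div 2"])
    show "w2 3 = 1" "w2 4 = 2" "w2 5 = 0" "w2 17 = l div 2"
      using R by (auto simp: w2_def)
    show "r2 1 = 0"
      using low[of 1] R by simp
    show "l div 2 div 2 ^ L = 0" "0 < L \<Longrightarrow> 0 < l div 2 div 2 ^ (L - 1)"
      using leaf_parent[OF l] by auto
    show "16 * 2 ^ L + 26 < W" "heap L r2 {l div 2}"
      using W_simple heap2 by auto
  next
    fix w' r' assume *: "\<And>a. a \<notin> {17, 19, 22} \<Longrightarrow> w' a = w2 a"
      "\<And>a. \<lbrakk>a \<notin> {4, 5}; \<And>i. i \<in> {1..<2 ^ L} \<Longrightarrow> a \<noteq> 8 * i + 18\<rbrakk> \<Longrightarrow> r' a = r2 a" "heap L r' {}"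
    show "K w' r' z"
    proof (rule K)
      show "w' a = w a" if "a \<notin> {17, 19, 22}" for a
        using that * unfolding w2_def by simp
      show "r' a = r a" if a: "a < 4 \<or> 16 \<le> a \<and> a mod 8 < 2" for a
      proof -
        have "a \<notin> {4, 5}" "\<And>i. a \<noteq> 8 * i + 18"
          using a by auto
        then show ?thesis
          using *(2) low[OF a] by simp
      qed
      have "r' (8 * j' + 19) = (E(j := e)) j' \<and> r' (8 * j' + 20) = (F(j := f)) j' \<and>
        r' (8 * (2 ^ L + j') + 18) = ((E(j := e)) j')\<^sup>2 + ((F(j := f)) j')\<^sup>2" if j': "j' < 2 ^ L" for j'
      proof -
        have "r' (8 * j' + 19) = r2 (8 * j' + 19)" "r' (8 * j' + 20) = r2 (8 * j' + 20)"
          by (rule *(2); simp; presburger)+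
        moreover have "r' (8 * (2 ^ L + j') + 18) = r2 (8 * (2 ^ L + j') + 18)"
          by (rule *(2)) auto
        ultimately show ?thesis
          using r2[OF j'] by simp
      qed
      then show "ests (E(j := e)) (F(j := f)) r'"
        unfolding ests_def using *(3) by blast
    qed
  qed
  have st: "r(j * 8 + 19 := e, 20 + j * 8 := f, 7 := f * f, 6 := e * e + f * f,
      2 ^ L * 8 + j * 8 + 18 := e * e + f * f) = r2"
    unfolding r2_def l_def by (auto simp: fun_eq_iff power2_eq_square algebra_simps)
  show ?thesis
    unfolding update_code_def
    apply (rule total_time)
     apply (rule total_Seq'[where ?t2.0 = "L * 17 + 1"])
     apply (rule total_Basic')
     apply (simp add: R w b rr)
    using main unfolding st[symmetric] w2_def l_def
     apply (simp add: algebra_simps)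
    apply simp
    done
qed


lemma total_store:
  assumes regs: "regs w r" and w: "w 13 = j" "w 14 = a0" "w 16 = n" "w 17 = a0 + 8 * n" "w 18 = 8" "w 21 = 32 + j"
    and j: "j < 2 ^ L" and a0: "a0 + 8 * n + 9 < W" "16 \<le> a0" "a0 mod 8 = 0"
    and r: "\<And>i. i < n \<Longrightarrow> r (a0 + 8 * i) = xs ! i" "r 6 = xs ! n"
      "\<And>i. i < n \<Longrightarrow> r (Suc (a0 + 8 * i)) = ys ! i" "r 7 = ys ! n"
    and ests: "ests E F r"
    and K: "\<And>w' r'. \<lbrakk>\<And>a. a \<notin> {16, 17, 19, 22, 32 + j} \<Longrightarrow> w' a = w a; w' (32 + j) = Suc n;
        \<And>a. a < 4 \<or> 16 \<le> a \<and> a mod 8 < 2 \<and> a \<noteq> a0 + 8 * n \<and> a \<noteq> Suc (a0 + 8 * n) \<Longrightarrow> r' a = r a;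
        r' (a0 + 8 * n) = xs ! n; r' (Suc (a0 + 8 * n)) = ys ! n;
        ests (if real (Suc n) \<le> T then E else E(j := xs ! (Suc n div 2)))
             (if real (Suc n) \<le> T then F else F(j := ys ! (Suc n div 2))) r'\<rbrakk> \<Longrightarrow> K w' r' z"
  shows "total_correct W M y store_code (L * 17 + 40) K w r z"
proof -
  note R = regsD[OF regs]
  have b: "Suc (a0 + 8 * n) < W" "Suc n < W" "0 < a0"
    "a0 + 8 * n \<noteq> 7" "a0 + 8 * n \<noteq> 6"
    using a0 by auto
  define w2 where "w2 = w(19 := Suc (a0 + 8 * n), 16 := Suc n, 32 + j := Suc n)"
  define r2 where "r2 = r(a0 + 8 * n := xs ! n, Suc (a0 + 8 * n) := ys ! n, 4 := real (Suc n))"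
  have low: "r2 a = r a" if "a < 4 \<or> 16 \<le> a \<and> a \<noteq> a0 + 8 * n \<and> a \<noteq> Suc (a0 + 8 * n)" for a
    using that a0 unfolding r2_def by auto
  have modn: "(a0 + 8 * n) mod 8 = 0" "Suc (a0 + 8 * n) mod 8 = 1"
    using a0(3) by presburger+
  have mod: "r2 a = r a" if "16 \<le> a" "2 \<le> a mod 8" for a
  proof -
    have "a \<noteq> a0 + 8 * n" "a \<noteq> Suc (a0 + 8 * n)"
      by (rule neq_if_mod[OF _ that(2)]; simp only: modn; simp)+
    then show ?thesis
      using low that by blast
  qed
  have ests2: "ests E F r2"
    by (rule ests_frame[OF ests mod])
  have regs2: "regs w2 r2"
    using R low unfolding regs_def w2_def by auto
  have seg2: "r2 (a0 + 8 * i) = xs ! i" "r2 (Suc (a0 + 8 * i)) = ys ! i" if "i \<le> n" for i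
  proof -
    have "(a0 + 8 * i) mod 8 = 0" "Suc (a0 + 8 * i) mod 8 = 1"
      using a0(3) by presburger+
    then have "a0 + 8 * i \<noteq> Suc (a0 + 8 * n)" "Suc (a0 + 8 * i) \<noteq> a0 + 8 * n"
      using modn by (metis zero_neq_one)+
    then show "r2 (a0 + 8 * i) = xs ! i" "r2 (Suc (a0 + 8 * i)) = ys ! i"
      using that a0 r by (auto simp: r2_def le_less)
  qed
  have main: "total_correct W M y (UnlessR 4 2 update_code) (L * 17 + 31) K w2 r2 z"
  proof (rule total_UnlessR)
    assume "r2 4 \<le> r2 2"
    then have le: "real (Suc n) \<le> T"
      using R low[of 2] by (simp add: r2_def)
    show "K w2 r2 z"
    proof (rule K)
      show "w2 a = w a" if "a \<notin> {16, 17, 19, 22, 32 + j}" for a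
        using that by (simp add: w2_def)
      show "w2 (32 + j) = Suc n"
        by (simp add: w2_def)
      show "r2 a = r a" if "a < 4 \<or> 16 \<le> a \<and> a mod 8 < 2 \<and> a \<noteq> a0 + 8 * n \<and> a \<noteq> Suc (a0 + 8 * n)" for a
        using that low by auto
      show "r2 (a0 + 8 * n) = xs ! n" "r2 (Suc (a0 + 8 * n)) = ys ! n"
        using seg2 by auto
      show "ests (if real (Suc n) \<le> T then E else E(j := xs ! (Suc n div 2)))
             (if real (Suc n) \<le> T then F else F(j := ys ! (Suc n div 2))) r2"
        using le ests2 by simp
    qed
  next
    assume "\<not> r2 4 \<le> r2 2"
    then have le: "\<not> real (Suc n) \<le> T"
      using R low[of 2] by (simp add: r2_def)
    have half: "Suc n div 2 \<le> n"
      by auto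
    show "total_correct W M y update_code (L * 17 + 30) K w2 r2 z"
    proof (rule total_update[OF regs2 _ _ _ _ j])
      show "w2 13 = j" "w2 14 = a0" "w2 16 = Suc n" "w2 18 = 8"
        using w by (auto simp: w2_def)
      show "a0 + 8 * Suc n + 1 < W" "16 \<le> a0"
        using a0 by auto
      show "r2 (a0 + 8 * (Suc n div 2)) = xs ! (Suc n div 2)" "r2 (Suc (a0 + 8 * (Suc n div 2))) = ys ! (Suc n div 2)"
        using seg2[OF half] by auto
      show "ests E F r2"
        by fact
    next
      fix w' r' assume *: "\<And>a. a \<notin> {17, 19, 22} \<Longrightarrow> w' a = w2 a"
        "\<And>a. a < 4 \<or> 16 \<le> a \<and> a mod 8 < 2 \<Longrightarrow> r' a = r2 a"
        "ests (E(j := xs ! (Suc n div 2))) (F(j := ys ! (Suc n div 2))) r'"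
      show "K w' r' z"
      proof (rule K)
        show "w' a = w a" if "a \<notin> {16, 17, 19, 22, 32 + j}" for a
          using that * by (simp add: w2_def)
        show "w' (32 + j) = Suc n"
          using *(1)[of "32 + j"] by (simp add: w2_def)
        show "r' a = r a" if "a < 4 \<or> 16 \<le> a \<and> a mod 8 < 2 \<and> a \<noteq> a0 + 8 * n \<and> a \<noteq> Suc (a0 + 8 * n)" for a
          using that low[of a] *(2)[of a] by auto
        show "r' (a0 + 8 * n) = xs ! n" "r' (Suc (a0 + 8 * n)) = ys ! n"
          using seg2[of n] *(2)[of "a0 + 8 * n"] *(2)[of "Suc (a0 + 8 * n)"] modn a0 by auto
        show "ests (if real (Suc n) \<le> T then E else E(j := xs ! (Suc n div 2)))
               (if real (Suc n) \<le> T then F else F(j := ys ! (Suc n div 2))) r'"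
          using le * by simp
      qed
    qed
  qed simp
  show ?thesis
    unfolding store_code_def
    apply (rule total_time)
     apply (rule total_Seq'[where ?t2.0 = "L * 17 + 31"])
     apply (rule total_Basic')
     apply (simp add: R w b r)
    using main unfolding r2_def w2_def
     apply (simp add: fun_upd_twist)
    apply simp
    done
qed

lemma hits_Suc: "hits (Suc q) j = hits q j @ (if acc q \<and> dec q = j then [q] else [])"
  by (simp add: hits_def)

lemma length_hits_le: "length (hits q j) \<le> q"
  unfolding hits_def using length_filter_le[of _ "[0..<q]"] by simp

lemma cell_inj:
  assumes "cell j c = cell j' c'" "c < Q" "c' < Q"
  shows "j = j' \<and> c = c'"
proof -
  have "j * Q + c = j' * Q + c'"
    using assms(1) unfolding cell_def by linarith
  moreover have "(j * Q + c) div Q = j" "(j' * Q + c') div Q = j'"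
    using assms(2,3) by auto
  ultimately show ?thesis
    by (metis add_left_cancel)
qed

lemma cell_mod: "cell j c mod 8 = 0" "Suc (cell j c) mod 8 = 1" "16 \<le> cell j c"
proof -
  have "cell j c = 8 * (j * Q + 2 + c)"
    unfolding cell_def by simp
  then show "cell j c mod 8 = 0" "Suc (cell j c) mod 8 = 1" "16 \<le> cell j c"
    by presburger+
qed

lemma sort_snoc: "sort (xs @ [x]) = insort (x :: real) (sort xs)"
  by (rule properties_for_sort) (auto simp: sorted_insort)

text \<open>
  The invariant of the main loop: all tables reflect the votes of the first \<open>q\<close> buckets.
\<close>

definition invar :: "nat \<Rightarrow> (nat \<Rightarrow> nat) \<Rightarrow> (nat \<Rightarrow> real) \<Rightarrow> bool" where
  "invar q w r \<longleftrightarrow> regs w r \<and> counts q w \<and> lists q r \<and> ests (med re_val q) (med im_val q) r"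

lemma row_bound: "q < Q \<Longrightarrow> row q + 2 * L + 2 < W"
proof -
  assume "q < Q"
  then have "(q + 1) * (2 * L + 3) \<le> Q * (2 * L + 3)"
    by (intro mult_right_mono) auto
  then show ?thesis
    using W_simple unfolding row_def by (simp add: algebra_simps)
qed

text \<open>
  Only the lists of the decoded index change; the estimates are untouched by the insertion because
  lists and estimates live at different residues modulo 8.
\<close>

lemma total_accept:
  assumes invar: "invar q w r" and q: "q < Q" "acc q" and w: "w 11 = row q + 2 * L" "w 13 = dec q"
    and K: "\<And>w' r'. \<lbrakk>w' 10 = w 10; invar (Suc q) w' r'\<rbrakk> \<Longrightarrow> K w' r' z"
  shows "total_correct W M y accept_code (19 + (length (hits q (dec q)) * 12 + 1) + (L * 17 + 40)) K w r z"
proof -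
  define j where "j = dec q"
  define n where "n = length (hits q j)"
  define xs where "xs = sort (map re_val (hits q j))"
  define ys where "ys = sort (map im_val (hits q j))"
  define a0 where "a0 = cell j 0"
  have regs: "regs w r" and counts: "counts q w" and lists: "lists q r"
    and ests: "ests (med re_val q) (med im_val q) r"
    using invar unfolding invar_def by auto
  note R = regsD[OF regs]
  have j: "j < 2 ^ L"
    unfolding j_def dec_def by (rule bits_prefix_less)
  have n: "n \<le> q" "n < Q" "length xs = n" "length ys = n"
    using length_hits_le[of q j] q unfolding n_def xs_def ys_def by auto
  have cell: "cell j c = a0 + 8 * c" for c
    unfolding a0_def cell_def by simp
  have cnt: "w (32 + j) = n"
    using counts j unfolding counts_def n_def by simp
  have a0: "a0 + 8 * n + 9 < W" "16 \<le> a0" "a0 mod 8 = 0" "j * Q * 8 + 16 = a0"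
    using W_bounds(1)[OF j, of "Suc n"] n cell_mod[of j 0] unfolding cell unfolding a0_def by (auto simp: cell_def)
  have rowb: "row q + 2 * L + 2 < W"
    by (rule row_bound[OF q(1)])
  have b: "Suc (row q + 2 * L) < W" "Suc (Suc (row q + 2 * L)) < W" "j * Q < W" "8 < W" "16 < W" "j * Q * 8 < W"
    "32 + j < W" "32 < W" "n < W" "n * 8 < W" "n * 8 + a0 < W" "a0 < W" "j + 32 < W"
    using rowb a0 W_simple j by auto
  define r1 where "r1 = r(4 := vec_entry y (row q + 2 * L) + vec_entry y 0, 6 := re_val q, 7 := im_val q)"
  define w1 where "w1 = w(11 := Suc (Suc (row q + 2 * L)), 14 := a0, 18 := 8, 19 := 16, 21 := 32 + j, 16 := n,
      15 := n * 8 + a0, 17 := a0)"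
  define K2 where "K2 = total_correct W M y store_code (L * 17 + 40) K"
  have ins: "total_correct W M y insert_code (n * 12 + 1) K2 w1 r1 z"
  proof (rule total_insert_code[where ?a0.0 = a0 and xs = xs and ys = ys])
    show "w1 3 = 1" "w1 17 = a0" "w1 15 = a0 + 8 * n" "w1 18 = 8" "r1 1 = 0"
      using R by (auto simp: w1_def r1_def)
    show "length xs = n" "length ys = n"
      using n by auto
    show "a0 + 8 * n + 1 < W" "16 \<le> a0"
      using a0 by auto
    show "r1 (a0 + 8 * i) = xs ! i" "r1 (Suc (a0 + 8 * i)) = ys ! i" if "i < n" for i
    proof -
      have "r (cell j i) = xs ! i" "r (Suc (cell j i)) = ys ! i"
        using lists j that unfolding lists_def n_def xs_def ys_def by auto
      then show "r1 (a0 + 8 * i) = xs ! i" "r1 (Suc (a0 + 8 * i)) = ys ! i"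
        using a0(2) unfolding cell r1_def by auto
    qed
  next
    fix w2 r2 assume *: "\<And>a. a \<notin> {17, 19} \<Longrightarrow> w2 a = w1 a" "w2 17 = a0 + 8 * n"
      and fr: "\<And>a. \<lbrakk>a \<notin> {4, 5, 6, 7}; \<And>i. i < n \<Longrightarrow> a \<noteq> a0 + 8 * i \<and> a \<noteq> Suc (a0 + 8 * i)\<rbrakk> \<Longrightarrow> r2 a = r1 a"
      and seg: "\<And>i. i < n \<Longrightarrow> r2 (a0 + 8 * i) = min (carry xs (r1 6) i) (xs ! i)"
        "\<And>i. i < n \<Longrightarrow> r2 (Suc (a0 + 8 * i)) = min (carry ys (r1 7) i) (ys ! i)"
        "r2 6 = carry xs (r1 6) n" "r2 7 = carry ys (r1 7) n"
    have r167: "r1 6 = re_val q" "r1 7 = im_val q"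
      unfolding r1_def by auto
    define xs' where "xs' = insort (re_val q) xs"
    define ys' where "ys' = insort (im_val q) ys"
    have xs': "xs' ! i = (if i < n then min (carry xs (re_val q) i) (xs ! i) else carry xs (re_val q) i)" if "i \<le> n" for i
      unfolding xs'_def using nth_insort_carry[of xs i "re_val q"] that n unfolding xs_def by simp
    have ys': "ys' ! i = (if i < n then min (carry ys (im_val q) i) (ys ! i) else carry ys (im_val q) i)" if "i \<le> n" for i
      unfolding ys'_def using nth_insort_carry[of ys i "im_val q"] that n unfolding ys_def by simp
    have xs'_eq: "xs' = sort (map re_val (hits (Suc q) j))" "ys' = sort (map im_val (hits (Suc q) j))"
      unfolding xs'_def ys'_def xs_def ys_def hits_Suc using q(2) j_def by (simp_all add: sort_snoc)
    have len: "length (hits (Suc q) j) = Suc n"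
      using q(2) unfolding hits_Suc n_def j_def by simp
    have other: "hits (Suc q) j' = hits q j'" if "j' \<noteq> j" for j'
      using that unfolding hits_Suc j_def by simp
    have modn: "(a0 + 8 * i) mod 8 = 0" "Suc (a0 + 8 * i) mod 8 = 1" for i
      using cell_mod[of j i] unfolding cell by auto
    have low: "r2 a = r a" if "a < 4 \<or> 16 \<le> a \<and> (\<forall>i<n. a \<noteq> a0 + 8 * i \<and> a \<noteq> Suc (a0 + 8 * i))" for a
    proof -
      have "r2 a = r1 a"
        by (rule fr) (use that a0 in auto)
      also have "\<dots> = r a"
        unfolding r1_def using that by auto
      finally show ?thesis .
    qed
    have mod: "r2 a = r a" if "16 \<le> a" "2 \<le> a mod 8" for a
    proof -
      have "a \<noteq> a0 + 8 * i" "a \<noteq> Suc (a0 + 8 * i)" for i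
        by (rule neq_if_mod[OF _ that(2)]; simp only: modn; simp)+
      then show ?thesis
        using low that by blast
    qed
    show "K2 w2 r2 z"
      unfolding K2_def
    proof (rule total_store[where j = j and n = n and ?a0.0 = a0 and xs = xs' and ys = ys' and
          E = "med re_val q" and F = "med im_val q"])
      show "regs w2 r2"
        using R low * unfolding regs_def w1_def by auto
      show "w2 13 = j" "w2 14 = a0" "w2 16 = n" "w2 17 = a0 + 8 * n" "w2 18 = 8" "w2 21 = 32 + j"
        using * w by (auto simp: w1_def j_def)
      show "j < 2 ^ L" "a0 + 8 * n + 9 < W" "16 \<le> a0" "a0 mod 8 = 0"
        using j a0 by auto
      show "r2 (a0 + 8 * i) = xs' ! i" "r2 (Suc (a0 + 8 * i)) = ys' ! i" if "i < n" for i
        using that seg xs' ys' r167 by auto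
      show "r2 6 = xs' ! n" "r2 7 = ys' ! n"
        using seg xs' ys' r167 by auto
      show "ests (med re_val q) (med im_val q) r2"
        by (rule ests_frame[OF ests mod])
    next
      fix w3 r3 assume **: "\<And>a. a \<notin> {16, 17, 19, 22, 32 + j} \<Longrightarrow> w3 a = w2 a" "w3 (32 + j) = Suc n"
        and r3: "\<And>a. a < 4 \<or> 16 \<le> a \<and> a mod 8 < 2 \<and> a \<noteq> a0 + 8 * n \<and> a \<noteq> Suc (a0 + 8 * n) \<Longrightarrow> r3 a = r2 a"
        "r3 (a0 + 8 * n) = xs' ! n" "r3 (Suc (a0 + 8 * n)) = ys' ! n"
        and ests3: "ests (if real (Suc n) \<le> T then med re_val q else (med re_val q)(j := xs' ! (Suc n div 2)))
             (if real (Suc n) \<le> T then med im_val q else (med im_val q)(j := ys' ! (Suc n div 2))) r3"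
      have w3: "w3 a = w a" if "a \<notin> {11, 14, 15, 16, 17, 18, 19, 21, 22, 32 + j}" for a
        using that * ** by (simp add: w1_def)
      show "K w3 r3 z"
      proof (rule K)
        show "w3 10 = w 10"
          using w3 by simp
        have "regs w3 r3"
          unfolding regs_def using R w3 r3(1) low by auto
        moreover have "counts (Suc q) w3"
          unfolding counts_def
        proof (intro allI impI)
          fix j' assume "j' < (2::nat) ^ L"
          then show "w3 (32 + j') = length (hits (Suc q) j')"
            using counts w3[of "32 + j'"] **(2) len other[of j'] unfolding counts_def by (cases "j' = j") auto
        qed
        moreover have "lists (Suc q) r3"
          unfolding lists_def
        proof (intro allI impI)
          fix j' c assume j': "j' < 2 ^ L" and c: "c < length (hits (Suc q) j')"
          have cQ: "c < Q"
            using c length_hits_le[of "Suc q" j'] q by linarith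
          show "r3 (cell j' c) = sort (map re_val (hits (Suc q) j')) ! c \<and>
              r3 (Suc (cell j' c)) = sort (map im_val (hits (Suc q) j')) ! c"
          proof (cases "j' = j")
            case True
            have cn: "c \<le> n"
              using c len True by simp
            have ne: "a0 + 8 * c \<noteq> Suc (a0 + 8 * n)" "Suc (a0 + 8 * c) \<noteq> a0 + 8 * n"
              using modn[of c] modn[of n] by (metis zero_neq_one)+
            have "r3 (a0 + 8 * c) = xs' ! c" "r3 (Suc (a0 + 8 * c)) = ys' ! c"
              using r3 seg xs' ys' r167 cn ne modn[of c] a0(2) by (cases "c = n"; simp)+
            then show ?thesis
              unfolding True cell xs'_eq by simp
          next
            case False
            have ne: "cell j' c \<noteq> cell j i" "Suc (cell j' c) \<noteq> Suc (cell j i)" if "i \<le> n" for i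
              using cell_inj[of j' c j i] False cQ n that by auto
            have ne': "cell j' c \<noteq> Suc (cell j i)" "Suc (cell j' c) \<noteq> cell j i" for i
              using cell_mod[of j' c] cell_mod[of j i] by (metis zero_neq_one)+
            have "r3 (cell j' c) = r2 (cell j' c)" "r3 (Suc (cell j' c)) = r2 (Suc (cell j' c))"
              using r3(1) ne[of n] ne'[of n] cell_mod[of j' c] unfolding cell by auto
            moreover have "r2 (cell j' c) = r (cell j' c)" "r2 (Suc (cell j' c)) = r (Suc (cell j' c))"
              by (rule low; use ne ne' cell_mod[of j' c] in \<open>auto simp: cell[symmetric]\<close>)+
            ultimately show ?thesis
              using lists j' c unfolding lists_def other[OF False] by simp
          qed
        qed
        moreover have "ests (med re_val (Suc q)) (med im_val (Suc q)) r3"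
        proof -
          have "med f (Suc q) = (if real (Suc n) \<le> T then med f q else (med f q)(j := sort (map f (hits (Suc q) j)) ! (Suc n div 2)))" for f
          proof
            fix j'
            show "med f (Suc q) j' = (if real (Suc n) \<le> T then med f q else (med f q)(j := sort (map f (hits (Suc q) j)) ! (Suc n div 2))) j'"
              using len n_def by (cases "j' = j") (auto simp: med_def other)
          qed
          then show ?thesis
            using ests3 unfolding xs'_eq by simp
        qed
        ultimately show "invar (Suc q) w3 r3"
          unfolding invar_def by simp
      qed
    qed
  qed
  have rv: "vec_entry y (Suc (row q + 2 * L)) - (vec_entry y (row q + 2 * L) + vec_entry y 0) = re_val q"
     "vec_entry y (row q + 2 * L) + vec_entry y 0 - vec_entry y (Suc (Suc (row q + 2 * L))) = im_val q"
    unfolding re_val_def im_val_def by simp_all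
  show ?thesis
    unfolding accept_code_def
    apply (rule total_time)
     apply (rule total_Seq'[where ?t2.0 = "n * 12 + 1 + (L * 17 + 40)"])
     apply (rule total_Basic')
     apply (simp add: R w b cnt j_def[symmetric] a0(4) rv)
     apply (rule total_Seq')
    using ins unfolding K2_def w1_def r1_def
     apply (simp add: fun_upd_twist)
    apply (simp add: n_def j_def)
    done
qed

lemma invar_frame:
  assumes "invar q w r" "\<And>a. a \<in> {2..9} \<or> 32 \<le> a \<Longrightarrow> w' a = w a" "\<And>a. a < 4 \<or> 16 \<le> a \<Longrightarrow> r' a = r a"
  shows "invar q w' r'"
proof -
  have "regs w' r'"
    using assms unfolding invar_def regs_def by simp
  moreover have "counts q w'"
    using assms(1,2) unfolding invar_def counts_def by simp
  moreover have "r' (cell j c) = r (cell j c)" "r' (Suc (cell j c)) = r (Suc (cell j c))" for j c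
    using cell_mod(3)[of j c] by (auto intro!: assms(3))
  then have "lists q r'"
    using assms(1) unfolding invar_def lists_def by simp
  moreover have "ests (med re_val q) (med im_val q) r'"
    using assms(1,3) ests_frame unfolding invar_def by blast
  ultimately show ?thesis
    unfolding invar_def by simp
qed

lemma total_bucket:
  assumes inv: "invar q w r" and q: "q < Q" and w: "w 10 = q"
    and H: "length (hits q (dec q)) \<le> H"
    and K: "\<And>w' r'. \<lbrakk>w' 10 = Suc q; invar (Suc q) w' r'\<rbrakk> \<Longrightarrow> K w' r' z"
  shows "total_correct W M y bucket_code (26 * L + 12 * H + 90) K w r z"
proof -
  have regs: "regs w r"
    using inv unfolding invar_def by simp
  note R = regsD[OF regs]
  have b: "row q < W" "L + L < W" "row q + (L + L) < W" "q * (2 * L + 3) < W" "row q + 2 * L < W" "0 < W"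
    "row q + 2 * L + 2 < W" "Suc q < W"
  proof -
    have "q \<le> q * (2 * L + 3)"
      by simp
    then show "Suc q < W"
      using row_bound[OF q] unfolding row_def by linarith
  qed (use row_bound[OF q] in \<open>auto simp: row_def\<close>)
  have roweq: "Suc (Suc (q * (2 * L + 3))) = row q" "q * (2 * L + 3) + 2 = row q"
    by (auto simp: row_def)
  define K4 where "K4 = total_correct W M y (Basic [WAdd 10 10 3]) 1 K"
  define K3 where "K3 = total_correct W M y (Seq (Basic [ReadRe 4 11 13]) (UnlessR 4 1 accept_code))
     (1 + Suc (19 + (H * 12 + 1) + (L * 17 + 40))) K4"
  define w1 where "w1 = w(11 := row q, 12 := row q + (L + L), 13 := 0)"
  have "total_correct W M y bits_code (L * 9 + 1) K3 w1 r z"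
  proof (rule total_bits_code[where p = "row q"])
    show "w1 3 = 1" "w1 11 = row q" "w1 12 = row q + 2 * L" "w1 13 = 0"
      using R by (auto simp: w1_def)
    show "row q + 2 * L < W" "2 ^ L < W"
      using b W_simple by auto
  next
    fix w2 r2 assume 2: "\<And>a. a \<notin> {11, 13} \<Longrightarrow> w2 a = w1 a" "\<And>a. a \<notin> {4, 5} \<Longrightarrow> r2 a = r a"
        "w2 11 = row q + 2 * L" "w2 13 = bits_prefix (vec_entry y) (row q) L"
    define r3 where "r3 = r2(4 := Re (mat_entry M (row q + 2 * L) (dec q)))"
    have inv3: "invar q w2 r3"
      by (rule invar_frame[OF inv]) (auto simp: 2 w1_def r3_def)
    have dec: "w2 13 = dec q"
      using 2 unfolding dec_def by simp
    have w23: "w2 3 = 1" "w2 10 = q"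
      using 2(1)[of 3] 2(1)[of 10] R w by (auto simp: w1_def)
    have K4: "K4 w' r' z" if "w' 10 = q" "invar (Suc q) w' r'" for w' r'
      unfolding K4_def
    proof (rule total_Basic)
      have "w' 3 = 1"
        using that unfolding invar_def regs_def by simp
      moreover have "invar (Suc q) (w'(10 := Suc q)) r'"
        by (rule invar_frame[OF that(2)]) auto
      ultimately show "wp W M y [WAdd 10 10 3] K w' r' z"
        using that K b by (simp add: row_def)
    qed simp
    have nacc: "invar (Suc q) w2 r3" if "\<not> acc q"
    proof -
      have h: "hits (Suc q) j = hits q j" for j
        unfolding hits_Suc using that by auto
      then have "med f (Suc q) = med f q" for f
        by (intro ext) (simp add: med_def)
      with h show ?thesis
        using inv3 unfolding invar_def counts_def lists_def by simp
    qed
    have "total_correct W M y (UnlessR 4 1 accept_code) (Suc (19 + (H * 12 + 1) + (L * 17 + 40))) K4 w2 r3 z"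
    proof (rule total_UnlessR')
      have r31: "r3 1 = 0" "r3 4 = Re (mat_entry M (row q + 2 * L) (dec q))"
        using 2 R by (auto simp: r3_def)
      show "K4 w2 r3 z" if "r3 4 \<le> r3 1"
        using that r31 nacc w23 by (intro K4) (auto simp: acc_def)
      show "total_correct W M y accept_code (19 + (H * 12 + 1) + (L * 17 + 40)) K4 w2 r3 z" if "\<not> r3 4 \<le> r3 1"
      proof (rule total_time)
        show "total_correct W M y accept_code (19 + (length (hits q (dec q)) * 12 + 1) + (L * 17 + 40)) K4 w2 r3 z"
          using that r31 w23 2 dec by (intro total_accept[OF inv3 q] K4) (auto simp: acc_def)
      qed (use H in auto)
    qed
    then show "K3 w2 r2 z"
      unfolding K3_def
      by (intro total_Seq') (rule total_Basic, simp_all add: 2 dec[symmetric] r3_def dec_def)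
  qed
  note bits = this
  show ?thesis
    unfolding bucket_code_def
    apply (rule total_time)
     apply (rule total_Seq'[where ?t2.0 = "L * 9 + 1 + ((1 + Suc (19 + (H * 12 + 1) + (L * 17 + 40))) + 1)"])
     apply (rule total_Basic')
     apply (simp add: R w b roweq)
     apply (rule total_Seq')
     apply (rule total_conseq[where Q = K3])
    using bits unfolding w1_def
      apply (simp)
    subgoal premises p for w r z
      by (rule total_Seq', rule p[unfolded K3_def K4_def])
    apply simp
    done
qed


definition key :: "nat \<Rightarrow> real" where
  "key j = (med re_val Q j)\<^sup>2 + (med im_val Q j)\<^sup>2"

text \<open>
  Indices up to \<open>2 ^ L\<close> may be selected, beyond the dimension; their estimates are 0 and they are cut off
  by the recovery map.
\<close>

definition outputs :: "nat set \<Rightarrow> (nat \<Rightarrow> complex) \<Rightarrow> bool" where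
  "outputs S z \<longleftrightarrow> S \<subseteq> {..<2 ^ L} \<and> (\<forall>i\<in>S. \<forall>j\<in>{..<2 ^ L} - S. key j \<le> key i) \<and>
     z = (\<lambda>j. if j \<in> S then Complex (med re_val Q j / (2 * sqrt (vec_entry y 0)))
       (med im_val Q j / (2 * sqrt (vec_entry y 0))) else 0)"

definition sel_inv :: "nat \<Rightarrow> nat set \<Rightarrow> (nat \<Rightarrow> nat) \<Rightarrow> (nat \<Rightarrow> real) \<Rightarrow> (nat \<Rightarrow> complex) \<Rightarrow> bool" where
  "sel_inv k S w r z \<longleftrightarrow> outputs S z \<and> card S = k \<and>
     w 2 = s \<and> w 3 = 1 \<and> w 4 = 2 \<and> w 5 = 0 \<and> w 6 = 2 ^ L \<and> w 20 = k \<and>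
     r 1 = 0 \<and> r 9 = 2 * sqrt (vec_entry y 0) \<and> r 10 = -1 \<and>
     (\<forall>j<2 ^ L. r (8 * j + 19) = med re_val Q j \<and> r (8 * j + 20) = med im_val Q j \<and>
        r (8 * (2 ^ L + j) + 18) = (if j \<in> S then -1 else key j)) \<and> heap L r {}"

lemma key_nonneg: "0 \<le> key j"
  by (simp add: key_def)

text \<open>
  As long as fewer than \<open>s \<le> 2 ^ L\<close> leaves are selected, some leaf has a nonnegative key, so the maximal
  leaf found by the descent is a new one and has the largest key among those that are left.
\<close>

lemma total_select:
  assumes inv: "invar Q w r" and s: "s \<le> 2 ^ L"
    and K: "\<And>w' r' z' S. outputs S z' \<Longrightarrow> card S = s \<Longrightarrow> K w' r' z'"
  shows "total_correct W M y select_code (s * (30 * L + 40) + 10) K w r (\<lambda>_. 0)"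
proof -
  have regs: "regs w r" and ests: "ests (med re_val Q) (med im_val Q) r"
    using inv unfolding invar_def by auto
  note R = regsD[OF regs]
  let ?B = "Basic [WSub 13 17 6, WConst 18 8, WMul 19 13 18, WConst 22 19, WAdd 19 19 22, RLoad 6 19,
            WAdd 19 19 3, RLoad 7 19, RDiv 6 6 9, RDiv 7 7 9, Write 13 6 7,
            WMul 19 17 18, WConst 22 18, WAdd 19 19 22, RStore 19 10, WDiv 17 17 4]"
  let ?c = "Seq (Basic [WConst 17 1]) (Seq descend_code (Seq ?B (Seq fixup_code (Basic [WAdd 20 20 3]))))"
  define I where "I = (\<lambda>k w r z. \<exists>S. sel_inv k S w r z)"
  have loop: "total_correct W M y (WhileW 20 2 ?c) (s * (30 * L + 40) + 1) K w' r' (\<lambda>_. 0)"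
    if I0: "I 0 w' r' (\<lambda>_. 0)" for w' r'
  proof (rule total_For[where n = s and t = "30 * L + 38" and I = I])
    show "I 0 w' r' (\<lambda>_. 0)"
      by fact
  next
    fix k w r z assume k: "k < s" and I: "I k w r z"
    then obtain S where S: "sel_inv k S w r z"
      unfolding I_def by auto
    have F: "w 2 = s" "w 3 = 1" "w 4 = 2" "w 5 = 0" "w 6 = 2 ^ L" "w 20 = k" "r 1 = 0"
        "r 9 = 2 * sqrt (vec_entry y 0)" "r 10 = -1" "heap L r {}"
      and out: "outputs S z" and card: "card S = k"
      and cells: "\<And>j. j < 2 ^ L \<Longrightarrow> r (8 * j + 19) = med re_val Q j"
        "\<And>j. j < 2 ^ L \<Longrightarrow> r (8 * j + 20) = med im_val Q j"
        "\<And>j. j < 2 ^ L \<Longrightarrow> r (8 * (2 ^ L + j) + 18) = (if j \<in> S then -1 else key j)"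
      using S unfolding sel_inv_def by auto
    define K2 where "K2 = total_correct W M y (Seq ?B (Seq fixup_code (Basic [WAdd 20 20 3]))) (16 + ((L * 17 + 1) + 1)) (I (Suc k))"
    have desc: "total_correct W M y descend_code (L * 13 + 1) K2 (w(17 := 1)) r z"
    proof (rule total_descend_code)
      show "(w(17 := 1)) 3 = 1" "(w(17 := 1)) 6 = 2 ^ L" "(w(17 := 1)) 17 = 1" "16 * 2 ^ L + 26 < W" "heap L r {}"
        using F W_simple by auto
    next
      fix w2 r2 assume 2: "\<And>a. a \<notin> {17, 19, 22} \<Longrightarrow> w2 a = (w(17 := 1)) a" "\<And>a. a \<notin> {4, 5} \<Longrightarrow> r2 a = r a"
        and l: "2 ^ L \<le> w2 17" "w2 17 < 2 * 2 ^ L" "r (8 * w2 17 + 18) = r 26"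
      define l where "l = w2 17"
      define j where "j = l - 2 ^ L"
      have lj: "l = 2 ^ L + j" "j < 2 ^ L"
        using l unfolding l_def j_def by auto
      have top: "r (8 * (2 ^ L + i) + 18) \<le> r (8 * (2 ^ L + j) + 18)" if "i < 2 ^ L" for i
      proof -
        have "r (8 * (2 ^ L + i) + 18) \<le> r (8 * ((2 ^ L + i) div 2 ^ L) + 18)"
          using that F by (intro heap_leaf_le) auto
        also have "(2 ^ L + i) div 2 ^ L = 1"
          using that by (simp add: div_add1_eq)
        finally show ?thesis
          using l(3) lj unfolding l_def by simp
      qed
      have SN: "S \<subseteq> {..<2 ^ L}" "finite S"
        using out finite_subset unfolding outputs_def by auto
      have jS: "j \<notin> S"
      proof
        assume "j \<in> S"
        have "card S < card {..<(2::nat) ^ L}"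
          using card k s by simp
        then have "S \<noteq> {..<2 ^ L}"
          by blast
        then obtain i where i: "i < 2 ^ L" "i \<notin> S"
          using SN by auto
        then have "key i \<le> -1"
          using top[of i] cells(3)[of i] cells(3)[of j] lj \<open>j \<in> S\<close> by simp
        then show False
          using key_nonneg[of i] by simp
      qed
      have jmax: "key i \<le> key j" if "i < 2 ^ L" "i \<notin> S" for i
        using top[of i] cells(3)[of i] cells(3)[of j] that jS lj by simp
      define S' where "S' = insert j S"
      define z' where "z' = z(j := Complex (med re_val Q j / (2 * sqrt (vec_entry y 0))) (med im_val Q j / (2 * sqrt (vec_entry y 0))))"
      have out': "outputs S' z'"
        using out jmax lj(2) unfolding outputs_def S'_def z'_def by (auto simp: fun_eq_iff)
      have card': "card S' = Suc k"
        unfolding S'_def using jS SN card by simp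
      have b: "j < W" "8 < W" "j * 8 < W" "19 < W" "j * 8 + 19 < W" "Suc (j * 8 + 19) < W" "l * 8 < W" "18 < W" "l * 8 + 18 < W"
        "l div 2 < W" "20 + j * 8 < W" "Suc k < W"
        using lj W_simple k by auto
      have n9: "j * 8 + 19 \<noteq> 6" "20 + j * 8 \<noteq> 6" "20 + j * 8 = 8 * j + 20"
        by auto
      define w3 where "w3 = w2(13 := j, 18 := 8, 22 := 18, 19 := l * 8 + 18, 17 := l div 2)"
      define r3 where "r3 = r2(6 := med re_val Q j / (2 * sqrt (vec_entry y 0)), 7 := med im_val Q j / (2 * sqrt (vec_entry y 0)),
          l * 8 + 18 := - 1)"
      have r3: "r3 a = r a" if "16 \<le> a" "a \<noteq> 8 * l + 18" for a
        using that 2(2)[of a] unfolding r3_def by auto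
      define K3 where "K3 = total_correct W M y (Basic [WAdd 20 20 3]) 1 (I (Suc k))"
      have fixup: "total_correct W M y fixup_code (L * 17 + 1) K3 w3 r3 z'"
      proof (rule total_fixup_code[where ?i0.0 = "l div 2"])
        show "w3 3 = 1" "w3 4 = 2" "w3 5 = 0" "w3 17 = l div 2"
          using 2 F by (auto simp: w3_def)
        show "r3 1 = 0"
          using 2(2)[of 1] F by (simp add: r3_def)
        show "l div 2 div 2 ^ L = 0" "0 < L \<Longrightarrow> 0 < l div 2 div 2 ^ (L - 1)"
          using leaf_parent[of L l] lj by auto
        show "16 * 2 ^ L + 26 < W"
          using W_simple by auto
        show "heap L r3 {l div 2}"
          by (rule heap_update_leaf[OF F(10)]) (use lj r3 in auto)
      next
        fix w4 r4 assume 4: "\<And>a. a \<notin> {17, 19, 22} \<Longrightarrow> w4 a = w3 a"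
          "\<And>a. \<lbrakk>a \<notin> {4, 5}; \<And>i. i \<in> {1..<2 ^ L} \<Longrightarrow> a \<noteq> 8 * i + 18\<rbrakk> \<Longrightarrow> r4 a = r3 a" "heap L r4 {}"
        have w4: "w4 a = w a" if "a \<notin> {13, 17, 18, 19, 22}" for a
          using that 4 2 by (simp add: w3_def)
        have r4low: "r4 a = r a" if "a < 4 \<or> a = 9 \<or> a = 10" for a
          using that 4(2)[of a] 2(2)[of a] by (auto simp: r3_def)
        have r4: "r4 (8 * i + 19) = r (8 * i + 19)" "r4 (8 * i + 20) = r (8 * i + 20)" for i
        proof -
          have "r4 (8 * i + 19) = r3 (8 * i + 19)" "r4 (8 * i + 20) = r3 (8 * i + 20)"
            by (rule 4(2); simp; presburger)+
          moreover have "r3 (8 * i + 19) = r (8 * i + 19)" "r3 (8 * i + 20) = r (8 * i + 20)"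
            by (rule r3; simp; presburger)+
          ultimately show "r4 (8 * i + 19) = r (8 * i + 19)" "r4 (8 * i + 20) = r (8 * i + 20)"
            by auto
        qed
        have r4leaf: "r4 (8 * (2 ^ L + i) + 18) = (if i \<in> S' then -1 else key i)" if i: "i < 2 ^ L" for i
        proof -
          have "r4 (8 * (2 ^ L + i) + 18) = r3 (8 * (2 ^ L + i) + 18)"
            by (rule 4(2)) auto
          also have "\<dots> = (if i \<in> S' then -1 else key i)"
          proof (cases "i = j")
            case True
            then show ?thesis
              unfolding r3_def lj(1) S'_def by (simp add: algebra_simps)
          next
            case False
            then have "r3 (8 * (2 ^ L + i) + 18) = r (8 * (2 ^ L + i) + 18)"
              by (intro r3) (auto simp: lj)
            then show ?thesis
              using cells(3)[OF i] False by (simp add: S'_def)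
          qed
          finally show ?thesis .
        qed
        have "sel_inv (Suc k) S' (w4(20 := Suc k)) r4 z'"
          unfolding sel_inv_def using out' card' w4 F r4low r4 r4leaf cells 4(3) by simp
        then have "I (Suc k) (w4(20 := Suc k)) r4 z'"
          unfolding I_def by blast
        then show "K3 w4 r4 z'"
          unfolding K3_def using w4 F b by (intro total_Basic) simp_all
      qed
      have cl: "r2 (j * 8 + 19) = med re_val Q j" "r2 (20 + j * 8) = med im_val Q j" "r2 9 = 2 * sqrt (vec_entry y 0)" "r2 10 = -1"
        "w2 3 = 1" "w2 4 = 2" "w2 6 = 2 ^ L" "w2 17 = l" "l - 2 ^ L = j" "r2 (Suc (j * 8 + 19)) = med im_val Q j"
        using 2 F cells(1,2)[OF lj(2)] by (auto simp: l_def j_def mult.commute add.commute)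
      show "K2 w2 r2 z"
        unfolding K2_def
        apply (rule total_Seq')
        apply (rule total_Basic)
         apply (simp add: cl b)
         apply (rule total_Seq')
        using fixup unfolding K3_def w3_def r3_def z'_def
         apply (simp add: fun_upd_twist)
        apply simp
        done
    qed
    have "total_correct W M y ?c (30 * L + 38) (I (Suc k)) w r z"
      apply (rule total_time)
       apply (rule total_Seq' total_Basic')+
       apply (simp add: W_simple)
       apply (rule conjI)
      subgoal using W_simple by linarith
       apply (rule total_Seq')
      using desc unfolding K2_def
       apply simp
      apply simp
      done
    then show "w 20 < w 2 \<and> total_correct W M y ?c (30 * L + 38) (I (Suc k)) w r z"
      using F k by simp
  next
    fix w r z assume "I s w r z"
    then obtain S where "sel_inv s S w r z"
      unfolding I_def by auto
    then show "w 2 \<le> w 20 \<and> K w r z"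
      using K unfolding sel_inv_def by auto
  qed (simp add: algebra_simps)
  define r0 where "r0 = r(9 := 2 * sqrt (vec_entry y 0), 10 := -1)"
  have r0: "r0 a = r a" if "a < 4 \<or> 16 \<le> a" for a
    using that unfolding r0_def by auto
  have ests0: "ests (med re_val Q) (med im_val Q) r0"
    by (rule ests_frame[OF ests]) (auto simp: r0)
  have "I 0 (w(20 := 0)) r0 (\<lambda>_. 0)"
    unfolding I_def sel_inv_def
    using R ests0 r0 by (intro exI[of _ "{}"]) (auto simp: ests_def outputs_def r0_def key_def)
  from loop[OF this] have main: "total_correct W M y (WhileW 20 2 ?c) (s * (30 * L + 40) + 1) K (w(20 := 0)) r0 (\<lambda>_. 0)" .
  have W0: "0 < W"
    using W_simple by linarith
  show ?thesis
    unfolding select_code_def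
    apply (rule total_time)
     apply (rule total_Seq'[where ?t2.0 = "s * (30 * L + 40) + 1"])
     apply (rule total_Basic')
     apply (simp add: R W0)
    subgoal using main[unfolded r0_def] by (simp add: R(9)[unfolded One_nat_def])
    apply simp
    done
qed


lemma total_setup:
  assumes D: "D = 2 + Q * (2 * L + 3)" "D < W" and L: "d \<le> 2 ^ L" "\<And>k. k < L \<Longrightarrow> 2 ^ k < d"
    and T_eq: "T = Re (mat_entry M 1 0)"
    and K: "\<And>w r. \<lbrakk>w 10 = 0; invar 0 w r\<rbrakk> \<Longrightarrow> K w r z"
  shows "total_correct W M y setup_code (4 * L + 11) K ((\<lambda>_. 0)(0 := D, 1 := d, 2 := s)) ((\<lambda>_. 0)(0 := \<epsilon>)) z"
proof -
  define r0 where "r0 = (\<lambda>_::nat. 0)(0 := \<epsilon>)"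
  define wk where "wk = (\<lambda>k. (\<lambda>_::nat. 0)(0 := D, 1 := d, 2 := s, 3 := 1, 4 := 2, 6 := 2 ^ k, 7 := k :: nat))"
  define I where "I = (\<lambda>k w r z'. w = wk k \<and> r = r0 \<and> z' = z)"
  define K2 where "K2 = total_correct W M y (Basic [WMul 8 7 4, WConst 18 3, WAdd 8 8 18, WSub 9 0 4, WDiv 9 9 8, ReadRe 2 3 5, ReadY 3 5]) 7 K"
  have W2: "2 < W" "1 < W" "3 < W"
    using W_simple by auto
  have dW: "2 * L + 3 < W"
  proof -
    have "L < 2 ^ L"
      by simp
    then show ?thesis
      using W_simple by linarith
  qed
  have loop: "total_correct W M y (WhileW 6 1 (Basic [WAdd 6 6 6, WAdd 7 7 3])) (L * 4 + 1) K2 (wk 0) r0 z"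
  proof (rule total_For[where n = L and t = 2 and I = I])
    show "I 0 (wk 0) r0 z"
      by (simp add: I_def)
  next
    fix k w r z' assume k: "k < L" and I: "I k w r z'"
    have "2 ^ Suc k \<le> (2::nat) ^ L"
      using k by (intro power_increasing) auto
    then have b: "2 ^ k + 2 ^ k < W" "Suc k < W"
      using W_simple(1) dW k by auto
    have "total_correct W M y (Basic [WAdd 6 6 6, WAdd 7 7 3]) 2 (I (Suc k)) w r z'"
      using I b by (intro total_Basic) (auto simp: I_def wk_def fun_eq_iff)
    moreover have "w 6 < w 1"
      using I L(2)[OF k] by (simp add: I_def wk_def)
    ultimately show "w 6 < w 1 \<and> total_correct W M y (Basic [WAdd 6 6 6, WAdd 7 7 3]) 2 (I (Suc k)) w r z'"
      by simp
  next
    fix w r z' assume I: "I L w r z'"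
    have e: "w = wk L" "r = r0" "z' = z"
      using I by (auto simp: I_def)
    have q: "Q * (2 * L + 3) div (2 * L + 3) = Q"
      by (rule nonzero_mult_div_cancel_right) simp
    have h0: "hits 0 j = []" for j
      by (simp add: hits_def)
    have "K2 w r z'"
      unfolding K2_def
    proof (rule total_Basic)
      define w' where "w' = (wk L)(8 := 2 * L + 3, 18 := 3, 9 := Q)"
      define r' where "r' = r0(2 := T, 3 := vec_entry y 0)"
      have w'35: "w' 5 = 0" "w' 3 = Suc 0"
        by (simp_all add: w'_def wk_def)
      have "invar 0 w' r'"
        unfolding invar_def regs_def counts_def lists_def ests_def heap_def
        using h0 T by (simp add: w'_def r'_def wk_def r0_def med_def)
      then have "K w' r' z"
        by (intro K) (simp_all add: w'_def wk_def)
      moreover have "D - 2 < W" "Q < W" "Q * (2 * L + 3) < W" "L * 2 < W" "L * 2 + 3 < W" "3 < W"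
      proof -
        have "Q \<le> Q * (2 * L + 3)"
          by simp
        then show "Q < W" "Q * (2 * L + 3) < W"
          using W_simple by linarith+
      qed (use D dW W2 in auto)
      moreover have "(wk L)(8 := L * 2 + 3, 18 := 3, 9 := Q) = w'"
        unfolding w'_def by (simp add: mult.commute)
      ultimately show "wp W M y [WMul 8 7 4, WConst 18 3, WAdd 8 8 18, WSub 9 0 4, WDiv 9 9 8, ReadRe 2 3 5, ReadY 3 5] K w r z'"
        using q D T_eq w'35 unfolding e r'_def by (simp add: wk_def mult.commute[of L] fun_upd_twist)
    qed simp
    moreover have "w 1 \<le> w 6"
      using L(1) e by (simp add: wk_def)
    ultimately show "w 1 \<le> w 6 \<and> K2 w r z'"
      by simp
  qed simp
  have wk0: "wk 0 = (\<lambda>_. 0)(0 := D, 1 := d, 2 := s, 3 := 1, 4 := 2, 6 := 1)"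
    by (auto simp: wk_def fun_eq_iff)
  show ?thesis
    unfolding setup_code_def
    apply (rule total_time)
     apply (rule total_Seq'[where ?t2.0 = "L * 4 + 1 + 7"])
     apply (rule total_Basic')
     apply (simp add: W2)
     apply (rule conjI)
    subgoal using W2 by simp
     apply (rule total_Seq')
    subgoal using loop unfolding K2_def wk0 r0_def by simp
    apply simp
    done
qed

lemma total_decoder:
  assumes D: "D = 2 + Q * (2 * L + 3)" "D < W" and L: "d \<le> 2 ^ L" "\<And>k. k < L \<Longrightarrow> 2 ^ k < d"
    and T_eq: "T = Re (mat_entry M 1 0)" and s: "s \<le> d"
    and H: "\<And>q. q < Q \<Longrightarrow> length (hits q (dec q)) \<le> H"
  shows "total_correct W M y decoder_code (Q * (26 * L + 12 * H + 92) + s * (30 * L + 40) + 4 * L + 22)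
     (\<lambda>w r z. \<exists>S. outputs S z \<and> card S = s)
     ((\<lambda>_. 0)(0 := D, 1 := d, 2 := s)) ((\<lambda>_. 0)(0 := \<epsilon>)) (\<lambda>_. 0)"
proof -
  define K where "K = (\<lambda>(w :: nat \<Rightarrow> nat) (r :: nat \<Rightarrow> real) z. \<exists>S. outputs S z \<and> card S = s)"
  define K1 where "K1 = total_correct W M y select_code (s * (30 * L + 40) + 10) K"
  define K0 where "K0 = total_correct W M y (Seq (WhileW 10 9 bucket_code) select_code)
     (Q * (26 * L + 12 * H + 92) + 1 + (s * (30 * L + 40) + 10)) K"
  have sL: "s \<le> 2 ^ L"
    using s L by linarith
  define I where "I = (\<lambda>q w r z. w 10 = q \<and> invar q w r \<and> z = (\<lambda>_::nat. 0 :: complex))"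
  have main: "total_correct W M y (WhileW 10 9 bucket_code) (Q * (26 * L + 12 * H + 92) + 1) K1 w r (\<lambda>_. 0)"
    if "w 10 = 0" "invar 0 w r" for w r
  proof (rule total_For[where n = Q and t = "26 * L + 12 * H + 90" and I = I])
    show "I 0 w r (\<lambda>_. 0)"
      using that by (simp add: I_def)
  next
    fix q w r z assume q: "q < Q" and I: "I q w r z"
    have "total_correct W M y bucket_code (26 * L + 12 * H + 90) (I (Suc q)) w r z"
      using I q H by (intro total_bucket[where q = q]) (auto simp: I_def)
    moreover have "w 10 < w 9"
      using I q by (simp add: I_def invar_def regs_def)
    ultimately show "w 10 < w 9 \<and> total_correct W M y bucket_code (26 * L + 12 * H + 90) (I (Suc q)) w r z"
      by simp
  next
    fix w r z assume I: "I Q w r z"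
    then have "w 9 \<le> w 10"
      by (simp add: I_def invar_def regs_def)
    moreover have "K1 w r z"
      using I unfolding K1_def I_def by (auto intro!: total_select sL) (auto simp: K_def)
    ultimately show "w 9 \<le> w 10 \<and> K1 w r z"
      by simp
  qed simp
  have "total_correct W M y setup_code (4 * L + 11) K0 ((\<lambda>_. 0)(0 := D, 1 := d, 2 := s)) ((\<lambda>_. 0)(0 := \<epsilon>)) (\<lambda>_. 0)"
    unfolding K0_def by (rule total_setup[OF D L T_eq]; (rule total_Seq')?; (rule main[unfolded K1_def])?)
  then show ?thesis
    unfolding decoder_code_def K0_def K_def by (rule total_Seq) simp
qed

end

section \<open>Counting bad hash functions\<close>

text \<open>
  The union bound over the \<open>m\<close>-element sets of bad repetitions, of which there are at most \<open>2 ^ R\<close>: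
  fixing such a set, the repetitions are independent.
\<close>

lemma card_many_bad:
  fixes H bad :: "'a set"
  assumes "finite H" "bad \<subseteq> H" "m \<le> R"
  shows "card {f \<in> {..<R} \<rightarrow>\<^sub>E H. m \<le> card {r \<in> {..<R}. f r \<in> bad}} \<le> 2 ^ R * (card bad ^ m * card H ^ (R - m))"
proof -
  let ?A = "{A. A \<subseteq> {..<R} \<and> card A = m}"
  let ?F = "\<lambda>A. PiE {..<R} (\<lambda>r. if r \<in> A then bad else H)"
  have fin: "finite bad"
    using assms finite_subset by blast
  have finA: "finite ?A"
    by (rule finite_subset[of _ "Pow {..<R}"]) auto
  have cardF: "card (?F A) = card bad ^ m * card H ^ (R - m)" if "A \<in> ?A" for A
  proof -
    have A: "A \<subseteq> {..<R}" "card A = m" "finite A"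
      using that finite_subset by auto
    have "card (?F A) = (\<Prod>r\<in>{..<R}. card (if r \<in> A then bad else H))"
      by (rule card_PiE) simp
    also have "\<dots> = (\<Prod>r\<in>A. card bad) * (\<Prod>r\<in>{..<R} - A. card H)"
      using A by (subst prod.subset_diff[of A]) (auto simp: mult.commute)
    also have "\<dots> = card bad ^ m * card H ^ (R - m)"
      using A by (simp add: card_Diff_subset)
    finally show ?thesis .
  qed
  have "{f \<in> {..<R} \<rightarrow>\<^sub>E H. m \<le> card {r \<in> {..<R}. f r \<in> bad}} \<subseteq> (\<Union>A\<in>?A. ?F A)"
  proof
    fix f assume f: "f \<in> {f \<in> {..<R} \<rightarrow>\<^sub>E H. m \<le> card {r \<in> {..<R}. f r \<in> bad}}"
    then have "m \<le> card {r \<in> {..<R}. f r \<in> bad}"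
      by simp
    then obtain A where A: "A \<subseteq> {r \<in> {..<R}. f r \<in> bad}" "card A = m"
      by (rule obtain_subset_with_card_n)
    have "f \<in> ?F A"
    proof (rule PiE_I)
      show "f r \<in> (if r \<in> A then bad else H)" if "r \<in> {..<R}" for r
        using A(1) f that by (cases "r \<in> A") auto
      show "f r = undefined" if "r \<notin> {..<R}" for r
        using f that by (auto simp: PiE_iff extensional_def)
    qed
    then show "f \<in> (\<Union>A\<in>?A. ?F A)"
      using A by blast
  qed
  then have "card {f \<in> {..<R} \<rightarrow>\<^sub>E H. m \<le> card {r \<in> {..<R}. f r \<in> bad}} \<le> card (\<Union>A\<in>?A. ?F A)"
    using finA fin assms(1) by (intro card_mono finite_UN_I finite_PiE) auto
  also have "\<dots> \<le> (\<Sum>A\<in>?A. card (?F A))"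
    by (rule card_UN_le[OF finA])
  also have "\<dots> = card ?A * (card bad ^ m * card H ^ (R - m))"
    using cardF by simp
  also have "\<dots> \<le> 2 ^ R * (card bad ^ m * card H ^ (R - m))"
  proof (rule mult_right_mono)
    have "card ?A \<le> card (Pow {..<R})"
      by (intro card_mono) auto
    then show "card ?A \<le> 2 ^ R"
      by (simp add: card_Pow)
  qed simp
  finally show ?thesis .
qed

lemma card_many_bad_real:
  fixes H bad :: "'a set"
  assumes "finite H" "H \<noteq> {}" "bad \<subseteq> H" "m \<le> R"
  shows "real (card {f \<in> {..<R} \<rightarrow>\<^sub>E H. m \<le> card {r \<in> {..<R}. f r \<in> bad}})
    \<le> 2 ^ R * (real (card bad) / real (card H)) ^ m * real (card ({..<R} \<rightarrow>\<^sub>E H))"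
proof -
  have H: "real (card H) > 0"
    using assms by (simp add: card_gt_0_iff)
  have "real (card {f \<in> {..<R} \<rightarrow>\<^sub>E H. m \<le> card {r \<in> {..<R}. f r \<in> bad}})
    \<le> real (2 ^ R * (card bad ^ m * card H ^ (R - m)))"
    using card_many_bad[OF assms(1,3,4)] by (rule of_nat_mono)
  also have "\<dots> = 2 ^ R * (real (card bad) / real (card H)) ^ m * real (card H) ^ R"
  proof -
    have "real (card H) ^ R = real (card H) ^ m * real (card H) ^ (R - m)"
      using assms(4) by (simp flip: power_add)
    then show ?thesis
      using H by (simp add: power_divide)
  qed
  also have "real (card H) ^ R = real (card ({..<R} \<rightarrow>\<^sub>E H))"
    by (simp add: card_PiE)
  finally show ?thesis .
qed

text \<open>
  Redrawing the value at \<open>i\<close> is a bijection from pairs of a colliding function and a value to all functions.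
\<close>

lemma card_collisions:
  assumes "i < d" "j < d" "i \<noteq> j"
  shows "card {h \<in> {..<d} \<rightarrow>\<^sub>E {..<B}. h i = h j} * B = card ({..<d} \<rightarrow>\<^sub>E {..<B::nat})"
proof -
  have "bij_betw (\<lambda>(h, b). h(i := b)) ({h \<in> {..<d} \<rightarrow>\<^sub>E {..<B}. h i = h j} \<times> {..<B}) ({..<d} \<rightarrow>\<^sub>E {..<B})"
    by (rule bij_betw_byWitness[where f' = "\<lambda>h. (h(i := h j), h i)"])
      (use assms in \<open>auto simp: PiE_def extensional_def fun_eq_iff Pi_def\<close>)
  from bij_betw_same_card[OF this] show ?thesis
    by (simp add: card_cartesian_product)
qed

text \<open>
  The vector enters through the magnitudes \<open>a\<close> of its entries. \<open>S\<close> is a set of \<open>K\<close> entries, and \<open>\<eta>\<close> is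
  the \<open>K\<close>-th part of the mass outside \<open>S\<close>. \<open>Dec h j\<close> stands for the event that the bucket of \<open>j\<close>
  under the hash function \<open>h\<close> is decoded to \<open>j\<close>; its defining property is that a bucket is decoded to
  one index only.
\<close>

locale hashing =
  fixes d B K R m :: nat and a :: "nat \<Rightarrow> real" and S :: "nat set" and \<eta> :: real
    and Dec :: "(nat \<Rightarrow> nat) \<Rightarrow> nat \<Rightarrow> bool"
  assumes K: "1 \<le> K" and B: "B = 128 * K" and m: "1 \<le> m" and R: "R = 3 * m"
    and a: "\<And>i. 0 \<le> a i" and S: "S \<subseteq> {..<d}" "card S = K"
    and \<eta>: "\<eta> * K = (\<Sum>i\<in>{..<d} - S. a i)"
    and Dec: "\<And>h i j. \<lbrakk>i < d; j < d; h i = h j; Dec h i; Dec h j\<rbrakk> \<Longrightarrow> i = j"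
begin

abbreviation hashes :: "(nat \<Rightarrow> nat) set" where
  "hashes \<equiv> {..<d} \<rightarrow>\<^sub>E {..<B}"

definition noise :: "(nat \<Rightarrow> nat) \<Rightarrow> nat \<Rightarrow> real" where
  "noise h j = (\<Sum>i | i < d \<and> i \<noteq> j \<and> h i = h j. a i)"

abbreviation noisy :: "nat \<Rightarrow> (nat \<Rightarrow> nat) set" where
  "noisy j \<equiv> {h \<in> hashes. \<eta> < noise h j}"

lemma hashes_finite_nonempty: "finite hashes" "hashes \<noteq> {}" "0 < real (card hashes)"
proof -
  show "finite hashes"
    by (intro finite_PiE) auto
  moreover show "hashes \<noteq> {}"
    using B K by (auto simp: PiE_eq_empty_iff lessThan_empty_iff)
  ultimately show "0 < real (card hashes)"
    by (simp add: card_gt_0_iff)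
qed

lemma \<eta>_nonneg: "0 \<le> \<eta>"
proof -
  have "0 \<le> \<eta> * K"
    unfolding \<eta> by (intro sum_nonneg a)
  then show ?thesis
    using K by (simp add: zero_le_mult_iff)
qed

lemma outside_zero: "\<eta> = 0 \<Longrightarrow> i < d \<Longrightarrow> i \<notin> S \<Longrightarrow> a i = 0"
  using \<eta> a sum_nonneg_eq_0_iff[of "{..<d} - S" a] by auto

lemma collision_prob:
  assumes "i < d" "j < d" "i \<noteq> j"
  shows "real (card {h \<in> hashes. h i = h j}) = real (card hashes) / B"
  using card_collisions[OF assms, of B] B K by (simp add: field_simps flip: of_nat_mult)

lemma card_heavy: "card {j. j < d \<and> \<eta> < a j} \<le> 2 * K"
proof -
  let ?T = "{j. j < d \<and> \<eta> < a j \<and> j \<notin> S}"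
  have "card ?T \<le> K"
  proof (cases "\<eta> = 0")
    case True
    then have "?T = {}"
      using outside_zero by force
    then show ?thesis
      by (metis card.empty le0)
  next
    case False
    have "real (card ?T) * \<eta> = (\<Sum>j\<in>?T. \<eta>)"
      by simp
    also have "\<dots> \<le> (\<Sum>j\<in>?T. a j)"
      by (intro sum_mono) auto
    also have "\<dots> \<le> (\<Sum>i\<in>{..<d} - S. a i)"
      by (intro sum_mono2) (use a in auto)
    also have "\<dots> = K * \<eta>"
      unfolding \<eta>[symmetric] by simp
    finally show ?thesis
      using False \<eta>_nonneg by simp
  qed
  moreover have "card {j. j < d \<and> \<eta> < a j} \<le> card (S \<union> ?T)"
    using S finite_subset[of S "{..<d}"] by (intro card_mono) auto
  moreover have "card (S \<union> ?T) \<le> card S + card ?T"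
    by (rule card_Un_le)
  ultimately show ?thesis
    using S by linarith
qed

text \<open>
  Large noise has two causes, a collision with \<open>S\<close> and a large contribution from outside \<open>S\<close>. As the
  number of buckets is 128 times \<open>K\<close>, each has probability at most 1/128, the first by the union bound
  and the second by Markov's inequality.
\<close>

lemma noise_prob:
  assumes j: "j < d"
  shows "real (card (noisy j)) / real (card hashes) \<le> 1 / 64"
proof -
  define T where "T = {..<d} - S - {j}"
  define tn where "tn h = (\<Sum>i | i \<in> T \<and> h i = h j. a i)" for h :: "nat \<Rightarrow> nat"
  let ?C = "\<Union>i\<in>S - {j}. {h \<in> hashes. h i = h j}"
  let ?N = "{h \<in> hashes. \<eta> < tn h}"
  have finS: "finite S" and finT: "finite T"
    using S finite_subset unfolding T_def by auto
  have "noisy j \<subseteq> ?C \<union> ?N"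
  proof
    fix h assume h: "h \<in> noisy j"
    show "h \<in> ?C \<union> ?N"
    proof (cases "\<exists>i\<in>S - {j}. h i = h j")
      case False
      then have "{i. i < d \<and> i \<noteq> j \<and> h i = h j} = {i. i \<in> T \<and> h i = h j}"
        unfolding T_def by auto
      then show ?thesis
        using h unfolding noise_def tn_def by simp
    qed (use h in auto)
  qed
  then have "card (noisy j) \<le> card (?C \<union> ?N)"
    using hashes_finite_nonempty finS by (intro card_mono) auto
  also have "\<dots> \<le> card ?C + card ?N"
    by (rule card_Un_le)
  finally have 1: "real (card (noisy j)) \<le> real (card ?C) + real (card ?N)"
    by linarith
  have "real (card ?C) \<le> (\<Sum>i\<in>S - {j}. real (card {h \<in> hashes. h i = h j}))"
    using card_UN_le[of "S - {j}" "\<lambda>i. {h \<in> hashes. h i = h j}"] finS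
    by (simp flip: of_nat_sum)
  also have "\<dots> = real (card (S - {j})) * (real (card hashes) / B)"
    using S j by (subst sum.cong[OF refl collision_prob]) auto
  also have "\<dots> \<le> K * (real (card hashes) / B)"
    using S finS card_mono[of S "S - {j}"] by (intro mult_right_mono) auto
  also have "\<dots> = real (card hashes) / 128"
    using B K by simp
  finally have 2: "real (card ?C) \<le> real (card hashes) / 128" .
  have 3: "real (card ?N) \<le> real (card hashes) / 128"
  proof (cases "\<eta> = 0")
    case True
    then have "tn h = 0" for h
      unfolding tn_def using outside_zero by (intro sum.neutral) (auto simp: T_def)
    then have "?N = {}"
      using True by auto
    then show ?thesis
      by (metis card.empty divide_nonneg_nonneg of_nat_0 of_nat_0_le_iff zero_le_numeral)
  next
    case False
    then have pos: "0 < \<eta>"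
      using \<eta>_nonneg by simp
    have tn_eq: "tn h = (\<Sum>i\<in>T. if h i = h j then a i else 0)" for h
      unfolding tn_def using finT by (simp add: sum.If_cases Int_def)
    have "\<eta> * real (card ?N) = (\<Sum>h\<in>?N. \<eta>)"
      by simp
    also have "\<dots> \<le> (\<Sum>h\<in>?N. tn h)"
      by (intro sum_mono) auto
    also have "\<dots> \<le> (\<Sum>h\<in>hashes. tn h)"
      using hashes_finite_nonempty by (intro sum_mono2) (auto simp: tn_def intro!: sum_nonneg a)
    also have "\<dots> = (\<Sum>i\<in>T. \<Sum>h\<in>hashes. if h i = h j then a i else 0)"
      unfolding tn_eq by (rule sum.swap)
    also have "\<dots> = (\<Sum>i\<in>T. a i * (real (card hashes) / B))"
    proof (rule sum.cong[OF refl])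
      fix i assume "i \<in> T"
      then have i: "i < d" "i \<noteq> j"
        unfolding T_def by auto
      have "(\<Sum>h\<in>hashes. if h i = h j then a i else 0) = a i * real (card {h \<in> hashes. h i = h j})"
        using hashes_finite_nonempty(1) by (simp add: sum.If_cases Int_def)
      then show "(\<Sum>h\<in>hashes. if h i = h j then a i else 0) = a i * (real (card hashes) / B)"
        using collision_prob[OF i(1) j i(2)] by simp
    qed
    also have "\<dots> = (\<Sum>i\<in>T. a i) * (real (card hashes) / B)"
      by (rule sum_distrib_right[symmetric])
    also have "\<dots> \<le> (\<Sum>i\<in>{..<d} - S. a i) * (real (card hashes) / B)"
      using a by (intro mult_right_mono sum_mono2) (auto simp: T_def)
    also have "\<dots> = \<eta> * (real (card hashes) / 128)"
      using \<eta> B K by (simp flip: \<eta>)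
    finally show ?thesis
      using pos by simp
  qed
  show ?thesis
    using 1 2 3 hashes_finite_nonempty(3) by (simp add: divide_le_eq)
qed

text \<open>
  Both failures count bad repetitions. Heavy entries must not be missed, whereas for the other entries
  a noisy repetition is harmful only if the entry is decoded in it.
\<close>

definition bad_heavy :: "(nat \<Rightarrow> nat \<Rightarrow> nat) \<Rightarrow> bool" where
  "bad_heavy f \<longleftrightarrow> (\<exists>j<d. \<eta> < a j \<and> m \<le> card {r \<in> {..<R}. \<eta> < noise (f r) j})"

definition bad_decoded :: "(nat \<Rightarrow> nat \<Rightarrow> nat) \<Rightarrow> bool" where
  "bad_decoded f \<longleftrightarrow> (\<exists>j<d. m \<le> card {r \<in> {..<R}. Dec (f r) j \<and> \<eta> < noise (f r) j})"

abbreviation families :: "(nat \<Rightarrow> nat \<Rightarrow> nat) set" where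
  "families \<equiv> {..<R} \<rightarrow>\<^sub>E hashes"

text \<open>
  A union bound over the at most \<open>2 * K\<close> heavy entries.
\<close>

lemma bad_heavy_prob:
  "real (card {f \<in> families. bad_heavy f}) \<le> 2 * K / 8 ^ m * real (card families)"
proof -
  let ?J = "{j. j < d \<and> \<eta> < a j}"
  let ?E = "\<lambda>j. {f \<in> families. m \<le> card {r \<in> {..<R}. f r \<in> noisy j}}"
  have fin: "finite families"
    using hashes_finite_nonempty by (intro finite_PiE) auto
  have "{f \<in> families. bad_heavy f} \<subseteq> (\<Union>j\<in>?J. ?E j)"
  proof
    fix f assume f: "f \<in> {f \<in> families. bad_heavy f}"
    then obtain j where j: "j \<in> ?J" "m \<le> card {r \<in> {..<R}. \<eta> < noise (f r) j}"
      unfolding bad_heavy_def by auto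
    moreover have "{r \<in> {..<R}. \<eta> < noise (f r) j} = {r \<in> {..<R}. f r \<in> noisy j}"
      using f by (auto simp: PiE_iff)
    ultimately show "f \<in> (\<Union>j\<in>?J. ?E j)"
      using f by auto
  qed
  then have "card {f \<in> families. bad_heavy f} \<le> card (\<Union>j\<in>?J. ?E j)"
    using fin by (intro card_mono finite_UN_I) auto
  also have "\<dots> \<le> (\<Sum>j\<in>?J. card (?E j))"
    by (rule card_UN_le) simp
  finally have "real (card {f \<in> families. bad_heavy f}) \<le> (\<Sum>j\<in>?J. real (card (?E j)))"
    by (simp flip: of_nat_sum)
  also have "\<dots> \<le> (\<Sum>j\<in>?J. 2 ^ R * (1 / 64) ^ m * real (card families))"
  proof (rule sum_mono)
    fix j assume "j \<in> ?J"
    then have j: "j < d" by simp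
    have "real (card (?E j)) \<le> 2 ^ R * (real (card (noisy j)) / real (card hashes)) ^ m * real (card families)"
      using hashes_finite_nonempty R by (intro card_many_bad_real) auto
    also have "\<dots> \<le> 2 ^ R * (1 / 64) ^ m * real (card families)"
      using noise_prob[OF j] by (intro mult_right_mono mult_left_mono power_mono) auto
    finally show "real (card (?E j)) \<le> 2 ^ R * (1 / 64) ^ m * real (card families)" .
  qed
  also have "\<dots> = real (card ?J) * (2 ^ R * (1 / 64) ^ m * real (card families))"
    by simp
  also have "\<dots> \<le> (2 * K) * (2 ^ R * (1 / 64) ^ m * real (card families))"
    using card_heavy by (intro mult_right_mono) (auto simp flip: of_nat_mult)
  also have "2 ^ R * (1 / 64 :: real) ^ m = 1 / 8 ^ m"
  proof -
    have "(2::real) ^ R = 8 ^ m" "(64::real) ^ m = 8 ^ m * 8 ^ m"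
      unfolding R by (simp_all add: power_mult flip: power_mult_distrib)
    then show ?thesis
      by (simp add: power_divide)
  qed
  finally show ?thesis
    by (simp add: mult.assoc)
qed

text \<open>
  A union bound over all \<open>d\<close> entries would cost a factor \<open>d\<close> and hence \<open>ln d\<close> repetitions. Instead, let
  \<open>q j\<close> be the probability that \<open>j\<close> is decoded with large noise in one repetition. Every bucket is decoded
  to one entry, so the sum of the \<open>q j\<close> is at most the number \<open>B\<close> of buckets, and since
  \<open>q j \<le> 1/64\<close>, the sum of the \<open>q j ^ m\<close> is at most \<open>(1/64) ^ (m - 1) * B\<close>.
\<close>

lemma bad_decoded_prob:
  "real (card {f \<in> families. bad_decoded f}) \<le> 8192 * K / 8 ^ m * real (card families)"
proof -
  let ?D = "\<lambda>j. {h \<in> hashes. Dec h j \<and> \<eta> < noise h j}"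
  let ?E = "\<lambda>j. {f \<in> families. m \<le> card {r \<in> {..<R}. f r \<in> ?D j}}"
  have fin: "finite families"
    using hashes_finite_nonempty by (intro finite_PiE) auto
  have "{f \<in> families. bad_decoded f} \<subseteq> (\<Union>j\<in>{..<d}. ?E j)"
  proof
    fix f assume f: "f \<in> {f \<in> families. bad_decoded f}"
    then obtain j where j: "j < d" "m \<le> card {r \<in> {..<R}. Dec (f r) j \<and> \<eta> < noise (f r) j}"
      unfolding bad_decoded_def by auto
    moreover have "{r \<in> {..<R}. Dec (f r) j \<and> \<eta> < noise (f r) j} = {r \<in> {..<R}. f r \<in> ?D j}"
      using f by (auto simp: PiE_iff)
    ultimately show "f \<in> (\<Union>j\<in>{..<d}. ?E j)"
      using f by auto
  qed
  then have "card {f \<in> families. bad_decoded f} \<le> card (\<Union>j\<in>{..<d}. ?E j)"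
    using fin by (intro card_mono finite_UN_I) auto
  also have "\<dots> \<le> (\<Sum>j<d. card (?E j))"
    by (rule card_UN_le) simp
  finally have "real (card {f \<in> families. bad_decoded f}) \<le> (\<Sum>j<d. real (card (?E j)))"
    by (simp flip: of_nat_sum)
  also have "\<dots> \<le> (\<Sum>j<d. 2 ^ R * ((1 / 64) ^ (m - 1) * (real (card (?D j)) / real (card hashes))) * real (card families))"
  proof (rule sum_mono)
    fix j assume "j \<in> {..<d}"
    then have j: "j < d" by simp
    let ?q = "real (card (?D j)) / real (card hashes)"
    have "card (?D j) \<le> card (noisy j)"
      using hashes_finite_nonempty by (intro card_mono) auto
    then have "?q \<le> real (card (noisy j)) / real (card hashes)"
      by (intro divide_right_mono) auto
    also have "\<dots> \<le> 1 / 64"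
      by (rule noise_prob[OF j])
    finally have q: "?q \<le> 1 / 64" .
    have "real (card (?E j)) \<le> 2 ^ R * ?q ^ m * real (card families)"
      using hashes_finite_nonempty R by (intro card_many_bad_real) auto
    also have "?q ^ m = ?q ^ (m - 1) * ?q"
      using m by (cases m) (simp_all add: mult.commute)
    also have "2 ^ R * (?q ^ (m - 1) * ?q) * real (card families) \<le> 2 ^ R * ((1 / 64) ^ (m - 1) * ?q) * real (card families)"
      using q by (intro mult_right_mono mult_left_mono power_mono) auto
    finally show "real (card (?E j)) \<le> 2 ^ R * ((1 / 64) ^ (m - 1) * ?q) * real (card families)" .
  qed
  also have "\<dots> = 2 ^ R * (1 / 64) ^ (m - 1) * real (card families) / real (card hashes) * (\<Sum>j<d. real (card (?D j)))"
    unfolding sum_distrib_left by (rule sum.cong) simp_all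
  also have "\<dots> \<le> 2 ^ R * (1 / 64) ^ (m - 1) * real (card families) / real (card hashes) * (real B * real (card hashes))"
  proof (rule mult_left_mono)
    \<comment> \<open>a hash function maps the entries that are decoded injectively to buckets\<close>
    have "(\<Sum>j<d. card (?D j)) = (\<Sum>j<d. \<Sum>h\<in>hashes. if Dec h j \<and> \<eta> < noise h j then 1 else 0)"
      using hashes_finite_nonempty(1) by (simp add: sum.If_cases Int_def)
    also have "\<dots> = (\<Sum>h\<in>hashes. \<Sum>j<d. if Dec h j \<and> \<eta> < noise h j then 1 else 0)"
      by (rule sum.swap)
    also have "\<dots> \<le> (\<Sum>h\<in>hashes. B)"
    proof (rule sum_mono)
      fix h assume h: "h \<in> hashes"
      let ?Z = "{j. j < d \<and> Dec h j \<and> \<eta> < noise h j}"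
      have "card ?Z \<le> card {..<B}"
      proof (rule card_inj_on_le)
        show "inj_on h ?Z"
          using Dec by (auto simp: inj_on_def)
        show "h ` ?Z \<subseteq> {..<B}"
          using h by auto
      qed simp
      then show "(\<Sum>j<d. if Dec h j \<and> \<eta> < noise h j then 1 else 0) \<le> B"
        by (simp add: sum.If_cases Int_def)
    qed
    finally have "(\<Sum>j<d. card (?D j)) \<le> B * card hashes"
      by (simp add: mult.commute)
    then show "(\<Sum>j<d. real (card (?D j))) \<le> real B * real (card hashes)"
      by (simp flip: of_nat_sum of_nat_mult)
  qed simp
  also have "\<dots> = 2 ^ R * (1 / 64) ^ (m - 1) * B * real (card families)"
    using hashes_finite_nonempty(3) by simp
  also have "2 ^ R * (1 / 64 :: real) ^ (m - 1) = 64 / 8 ^ m"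
  proof -
    have 1: "(2::real) ^ R = 8 ^ m" "(64::real) ^ m = 8 ^ m * 8 ^ m"
      unfolding R by (simp_all add: power_mult flip: power_mult_distrib)
    have "(64::real) ^ m = 64 * 64 ^ (m - 1)"
      using m by (cases m) simp_all
    then have 2: "(64::real) ^ (m - 1) = 8 ^ m * 8 ^ m / 64"
      unfolding 1(2) by linarith
    show ?thesis
      unfolding power_divide 1(1) 2 by simp
  qed
  finally show ?thesis
    unfolding B by simp
qed

end

section \<open>Selection by approximate magnitudes and medians\<close>

text \<open>
  Selecting by approximate magnitudes is almost as good as selecting by the true ones. An index \<open>j\<close> of
  \<open>T\<close> that was missed can be charged injectively to a selected index \<open>\<phi> j\<close> outside \<open>T\<close>, whose true
  magnitude is smaller by at most \<open>2 * \<delta>\<close>. The magnitudes of these \<open>\<phi> j\<close> occur in the tail on the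
  right-hand side, and all remaining deviations are at most \<open>2 * \<delta>\<close> on at most \<open>2 * s\<close> indices.
\<close>

lemma L2_set_selected_error:
  fixes x z :: "nat \<Rightarrow> complex"
  assumes close: "\<And>j. j < N \<Longrightarrow> cmod (x j - z j) \<le> \<delta>"
    and S: "S \<subseteq> {..<N}" "card S = s" "\<And>i j. \<lbrakk>i \<in> S; j < N; j \<notin> S\<rbrakk> \<Longrightarrow> cmod (z j) \<le> cmod (z i)"
    and T: "T \<subseteq> {..<N}" "card T \<le> s"
  shows "L2_set (\<lambda>j. cmod (x j - (if j \<in> S then z j else 0))) {..<N}
    \<le> L2_set (\<lambda>j. cmod (x j)) ({..<N} - T) + 3 * \<delta> * sqrt (real s)"
proof (cases "N = 0 \<or> s = 0")
  case True
  then have "S = {}" "T = {}"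
    using S T finite_subset[OF S(1)] finite_subset[OF T(1)] by auto
  then show ?thesis
    using True S by auto
next
  case False
  then have \<delta>: "0 \<le> \<delta>"
    using close[of 0] norm_ge_zero order_trans by blast
  have fin: "finite S" "finite T"
    using finite_subset[OF S(1)] finite_subset[OF T(1)] by simp_all
  have "card (T - S) \<le> card (S - T)"
    using fin S T by (metis card_le_sym_Diff)
  then obtain \<phi> where \<phi>: "inj_on \<phi> (T - S)" "\<phi> ` (T - S) \<subseteq> S - T"
    using fin card_le_inj[of "T - S" "S - T"] by auto
  define u where "u j = (if j \<in> S then 0 else if j \<in> T then cmod (x (\<phi> j)) else cmod (x j))" for j
  define v where "v j = (if j \<in> S then \<delta> else if j \<in> T then 2 * \<delta> else 0)" for j
  have "L2_set (\<lambda>j. cmod (x j - (if j \<in> S then z j else 0))) {..<N} \<le> L2_set (\<lambda>j. u j + v j) {..<N}"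
  proof (rule L2_set_mono)
    fix j assume "j \<in> {..<N}"
    then have j: "j < N" by simp
    show "cmod (x j - (if j \<in> S then z j else 0)) \<le> u j + v j"
    proof (cases "j \<in> S")
      case True
      then show ?thesis
        using close[OF j] by (simp add: u_def v_def)
    next
      case notS: False
      show ?thesis
      proof (cases "j \<in> T")
        case True
        define i where "i = \<phi> j"
        have i: "i \<in> S" "i < N"
          using \<phi> True notS S unfolding i_def by auto
        have "cmod (x j) \<le> cmod (z j) + \<delta>"
          using close[OF j] norm_triangle_ineq2[of "x j" "z j"] by linarith
        also have "cmod (z j) \<le> cmod (z i)"
          by (rule S(3)[OF i(1) j notS])
        also have "cmod (z i) \<le> cmod (x i) + \<delta>"
          using close[OF i(2)] norm_triangle_ineq3[of "x i" "z i"] by linarith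
        finally show ?thesis
          using True notS by (simp add: u_def v_def i_def)
      qed (use notS in \<open>simp add: u_def v_def\<close>)
    qed
  qed simp
  also have "\<dots> \<le> L2_set u {..<N} + L2_set v {..<N}"
    by (rule L2_set_triangle_ineq)
  also have "L2_set u {..<N} \<le> L2_set (\<lambda>j. cmod (x j)) ({..<N} - T)"
  proof -
    have "(\<Sum>j<N. (u j)\<^sup>2) = (\<Sum>j\<in>{..<N} - S. (u j)\<^sup>2)"
      by (rule sum.mono_neutral_right) (use S in \<open>auto simp: u_def\<close>)
    also have "\<dots> = (\<Sum>j\<in>T - S. (u j)\<^sup>2) + (\<Sum>j\<in>{..<N} - S - T. (u j)\<^sup>2)"
    proof -
      have "{..<N} - S = (T - S) \<union> ({..<N} - S - T)"
        using T by auto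
      moreover have "(\<Sum>j\<in>(T - S) \<union> ({..<N} - S - T). (u j)\<^sup>2) =
          (\<Sum>j\<in>T - S. (u j)\<^sup>2) + (\<Sum>j\<in>{..<N} - S - T. (u j)\<^sup>2)"
        using fin by (intro sum.union_disjoint) auto
      ultimately show ?thesis
        by simp
    qed
    also have "(\<Sum>j\<in>T - S. (u j)\<^sup>2) = (\<Sum>j\<in>T - S. (cmod (x (\<phi> j)))\<^sup>2)"
      by (rule sum.cong) (auto simp: u_def)
    also have "\<dots> = (\<Sum>i\<in>\<phi> ` (T - S). (cmod (x i))\<^sup>2)"
      by (simp add: sum.reindex[OF \<phi>(1)])
    also have "\<dots> \<le> (\<Sum>i\<in>S - T. (cmod (x i))\<^sup>2)"
      by (rule sum_mono2) (use fin \<phi> in auto)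
    also have "(\<Sum>j\<in>{..<N} - S - T. (u j)\<^sup>2) = (\<Sum>j\<in>{..<N} - S - T. (cmod (x j))\<^sup>2)"
      by (rule sum.cong) (auto simp: u_def)
    also have "(\<Sum>i\<in>S - T. (cmod (x i))\<^sup>2) + (\<Sum>j\<in>{..<N} - S - T. (cmod (x j))\<^sup>2) = (\<Sum>j\<in>{..<N} - T. (cmod (x j))\<^sup>2)"
    proof -
      have "{..<N} - T = (S - T) \<union> ({..<N} - S - T)"
        using S by auto
      moreover have "(\<Sum>j\<in>(S - T) \<union> ({..<N} - S - T). (cmod (x j))\<^sup>2) =
          (\<Sum>i\<in>S - T. (cmod (x i))\<^sup>2) + (\<Sum>j\<in>{..<N} - S - T. (cmod (x j))\<^sup>2)"
        using fin by (intro sum.union_disjoint) auto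
      ultimately show ?thesis
        by simp
    qed
    finally show ?thesis
      unfolding L2_set_def by (simp add: real_sqrt_le_mono)
  qed
  also have "L2_set v {..<N} \<le> 3 * \<delta> * sqrt (real s)"
  proof -
    have "(\<Sum>j<N. (v j)\<^sup>2) \<le> (\<Sum>j<N. (if j \<in> S then \<delta>\<^sup>2 else 0) + (if j \<in> T then 4 * \<delta>\<^sup>2 else 0))"
      by (rule sum_mono) (auto simp: v_def power2_eq_square)
    also have "\<dots> = (\<Sum>j<N. if j \<in> S then \<delta>\<^sup>2 else 0) + (\<Sum>j<N. if j \<in> T then 4 * \<delta>\<^sup>2 else 0)"
      by (rule sum.distrib)
    also have "\<dots> = card S * \<delta>\<^sup>2 + card T * (4 * \<delta>\<^sup>2)"
      using S T by (simp add: sum.If_cases Int_absorb1)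
    also have "\<dots> \<le> s * \<delta>\<^sup>2 + s * (4 * \<delta>\<^sup>2)"
      using S T by (intro add_mono mult_right_mono) auto
    also have "\<dots> \<le> (3 * \<delta>)\<^sup>2 * s"
      using \<delta> by (simp add: power2_eq_square)
    finally have "sqrt (\<Sum>j<N. (v j)\<^sup>2) \<le> sqrt ((3 * \<delta>)\<^sup>2 * s)"
      by (rule real_sqrt_le_mono)
    then show ?thesis
      unfolding L2_set_def using \<delta> by (simp add: real_sqrt_mult)
  qed
  finally show ?thesis
    by simp
qed

text \<open>
  If the median lay outside the interval, then so would at least half of the values, namely the median and
  all values on its far side.
\<close>

lemma median_between:
  fixes f :: "nat \<Rightarrow> real"
  assumes "2 * length (filter (\<lambda>i. \<not> (lo \<le> f i \<and> f i \<le> hi)) xs) < length xs"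
  shows "lo \<le> sort (map f xs) ! (length xs div 2)" "sort (map f xs) ! (length xs div 2) \<le> hi"
proof -
  define ys where "ys = sort (map f xs)"
  define n where "n = length xs"
  define p where "p = n div 2"
  have n: "length ys = n" "sorted ys"
    by (auto simp: ys_def n_def)
  have p: "p < n"
    using assms unfolding p_def n_def by (cases xs) auto
  have count: "length (filter P ys) = length (filter (\<lambda>i. P (f i)) xs)" for P
  proof -
    have "length (filter P ys) = size (filter_mset P (mset ys))"
      by (metis mset_filter size_mset)
    also have "\<dots> = size (filter_mset P (mset (map f xs)))"
      unfolding ys_def by simp
    also have "\<dots> = length (filter P (map f xs))"
      by (metis mset_filter size_mset)
    finally show ?thesis
      by (simp add: filter_map comp_def)
  qed
  have bad: "2 * card {i. i < n \<and> \<not> (lo \<le> ys ! i \<and> ys ! i \<le> hi)} < n"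
    using assms count[of "\<lambda>v. \<not> (lo \<le> v \<and> v \<le> hi)"] n unfolding length_filter_conv_card n_def by simp
  have "ys ! p \<le> hi"
  proof (rule ccontr)
    assume "\<not> ys ! p \<le> hi"
    then have "{p..<n} \<subseteq> {i. i < n \<and> \<not> (lo \<le> ys ! i \<and> ys ! i \<le> hi)}"
      using sorted_nth_mono[OF n(2), of p] n(1) by force
    from card_mono[OF _ this] have "n - p \<le> card {i. i < n \<and> \<not> (lo \<le> ys ! i \<and> ys ! i \<le> hi)}"
      by simp
    then show False
      using bad unfolding p_def by linarith
  qed
  moreover have "lo \<le> ys ! p"
  proof (rule ccontr)
    assume "\<not> lo \<le> ys ! p"
    then have "{..p} \<subseteq> {i. i < n \<and> \<not> (lo \<le> ys ! i \<and> ys ! i \<le> hi)}"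
      using sorted_nth_mono[OF n(2), of _ p] n(1) p by force
    from card_mono[OF _ this] have "p + 1 \<le> card {i. i < n \<and> \<not> (lo \<le> ys ! i \<and> ys ! i \<le> hi)}"
      by simp
    then show False
      using bad unfolding p_def by linarith
  qed
  ultimately show "lo \<le> sort (map f xs) ! (length xs div 2)" "sort (map f xs) ! (length xs div 2) \<le> hi"
    unfolding ys_def p_def n_def by auto
qed

section \<open>Accuracy of the decoder on the measurement matrix\<close>

abbreviation recovered :: "nat \<Rightarrow> real \<Rightarrow> complex mat \<Rightarrow> real vec \<Rightarrow> complex vec" where
  "recovered s \<epsilon> M y \<equiv> recover (assemble 0 decoder_code) 8 s \<epsilon> M y"

text \<open>
  The rows of a bucket \<open>c\<close> of the hash function \<open>h\<close>. The first \<open>2 * L\<close> rows split the bucket by the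
  binary digits of the index, most significant digit first: the indices with digit 1 go to the even
  row and those with digit 0 to the odd row after it. Then follow the bucket sum and its
  superpositions with the reference row \<open>t ^ j\<close>.
\<close>

definition bucket_coef :: "nat \<Rightarrow> nat \<Rightarrow> (nat \<Rightarrow> nat) \<Rightarrow> nat \<Rightarrow> nat \<Rightarrow> nat \<Rightarrow> complex" where
  "bucket_coef L t h c e j =
     (if e < 2 * L then of_bool (h j = c \<and> (odd (j div 2 ^ (L - 1 - e div 2)) \<longleftrightarrow> even e))
      else if e = 2 * L then of_bool (h j = c)
      else if e = 2 * L + 1 then of_nat t ^ j + of_bool (h j = c)
      else of_nat t ^ j + \<i> * of_bool (h j = c))"

text \<open>
  Row 0 is the reference row and row 1 passes the vote threshold \<open>2 * m\<close> to the program.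
\<close>

definition sketch_mat :: "nat \<Rightarrow> nat \<Rightarrow> nat \<Rightarrow> nat \<Rightarrow> nat \<Rightarrow> nat \<Rightarrow> (nat \<Rightarrow> nat \<Rightarrow> nat) \<Rightarrow> complex mat" where
  "sketch_mat d L B R m t f = mat (2 + R * B * (2 * L + 3)) d (\<lambda>(i, j).
     if i = 0 then of_nat t ^ j
     else if i = 1 then (if j = 0 then of_nat (2 * m) else 0)
     else let q = (i - 2) div (2 * L + 3)
       in bucket_coef L t (f (q div B)) (q mod B) ((i - 2) mod (2 * L + 3)) j)"

lemma dim_sketch_mat [simp]:
  "dim_row (sketch_mat d L B R m t f) = 2 + R * B * (2 * L + 3)"
  "dim_col (sketch_mat d L B R m t f) = d"
  by (simp_all add: sketch_mat_def)

lemma sketch_mat_row: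
  assumes "q < R * B" "e < 2 * L + 3" "j < d"
  shows "q * (2 * L + 3) + 2 + e < 2 + R * B * (2 * L + 3)"
    "sketch_mat d L B R m t f $$ (q * (2 * L + 3) + 2 + e, j) = bucket_coef L t (f (q div B)) (q mod B) e j"
proof -
  have "q * (2 * L + 3) + e < (q + 1) * (2 * L + 3)"
    using assms by simp
  also have "\<dots> \<le> R * B * (2 * L + 3)"
    using assms by (intro mult_right_mono) auto
  finally show *: "q * (2 * L + 3) + 2 + e < 2 + R * B * (2 * L + 3)"
    by simp
  have "(q * (2 * L + 3) + 2 + e - 2) div (2 * L + 3) = q" "(q * (2 * L + 3) + 2 + e - 2) mod (2 * L + 3) = e"
    using assms(2) by auto
  then show "sketch_mat d L B R m t f $$ (q * (2 * L + 3) + 2 + e, j) = bucket_coef L t (f (q div B)) (q mod B) e j"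
    using * assms(3) unfolding sketch_mat_def by (simp add: Let_def)
qed

text \<open>
  The product of the two dimensions bounds all addresses up to a constant factor, so a fixed power of
  their sum suffices as word bound.
\<close>

lemma word_bound:
  assumes "1 \<le> d" "\<And>k. k < L \<Longrightarrow> 2 ^ k < d" "s \<le> d" "D = 2 + Q * (2 * L + 3)"
  shows "64 + 16 * (2 ^ L * (Q + 1)) + Q * (2 * L + 3) + s < (D + d + 2) ^ 8" "D < (D + d + 2) ^ 8"
proof -
  define n where "n = D + d + 2"
  have L: "2 ^ L \<le> 2 * d"
    using assms(1) assms(2)[of "L - 1"] by (cases L) auto
  have "Q + 1 \<le> n" "d \<le> n" "5 \<le> n"
    using assms by (auto simp: n_def algebra_simps)
  then have "2 ^ L * (Q + 1) \<le> 2 * n * n"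
    using L by (intro mult_mono) auto
  moreover have "n \<le> n * n" "64 \<le> 64 * n * n"
    using \<open>5 \<le> n\<close> by auto
  moreover have "Q * (2 * L + 3) + s \<le> n"
    using assms by (simp add: n_def)
  ultimately have "64 + 16 * (2 ^ L * (Q + 1)) + Q * (2 * L + 3) + s \<le> 97 * (n * n)"
    by linarith
  also have "\<dots> < 5 ^ 6 * (n * n)"
    using \<open>5 \<le> n\<close> by simp
  also have "\<dots> \<le> n ^ 6 * (n * n)"
    using \<open>5 \<le> n\<close> by (intro mult_right_mono power_mono) auto
  also have "\<dots> = n ^ 8"
    by (simp add: eval_nat_numeral)
  finally show "64 + 16 * (2 ^ L * (Q + 1)) + Q * (2 * L + 3) + s < (D + d + 2) ^ 8"
    unfolding n_def .
  have "D < n"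
    by (simp add: n_def)
  also have "n \<le> n ^ 8"
    using \<open>5 \<le> n\<close> self_le_power[of n 8] by simp
  finally show "D < (D + d + 2) ^ 8"
    unfolding n_def .
qed

locale sketch =
  fixes d L B R m s t :: nat and f :: "nat \<Rightarrow> nat \<Rightarrow> nat" and y :: "real vec"
  assumes d: "1 \<le> d" and L: "d \<le> 2 ^ L" "\<And>k. k < L \<Longrightarrow> 2 ^ k < d" and s: "s \<le> d"
begin

abbreviation M :: "complex mat" where
  "M \<equiv> sketch_mat d L B R m t f"

sublocale decoder "(dim_row M + dim_col M + 2) ^ 8" M y L s "R * B" "real (2 * m)"
  by unfold_locales (use word_bound(1)[OF d L(2) s refl] in \<open>simp_all only: dim_sketch_mat of_nat_0_le_iff\<close>)

lemma acc_iff: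
  assumes "q < R * B"
  shows "acc q \<longleftrightarrow> dec q < d \<and> f (q div B) (dec q) = q mod B"
proof (cases "dec q < d")
  case True
  have "q * (2 * L + 3) + 2 + 2 * L < 2 + R * B * (2 * L + 3)"
    using sketch_mat_row(1)[OF assms _ True] by simp
  then have "mat_entry M (row q + 2 * L) (dec q) = bucket_coef L t (f (q div B)) (q mod B) (2 * L) (dec q)"
    using sketch_mat_row(2)[OF assms _ True, of "2 * L"] True unfolding mat_entry_def row_def by simp
  then show ?thesis
    using True by (simp add: acc_def bucket_coef_def)
qed (simp add: acc_def mat_entry_def)

lemma length_hits: "q \<le> R * B \<Longrightarrow> length (hits q j) = card {i. i < q \<and> acc i \<and> dec i = j}"
  by (simp add: hits_def length_filter_conv_card conj_ac cong: conj_cong)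

lemma index_eq:
  assumes "i < R * B" "acc i" "dec i = j"
  shows "i = i div B * B + f (i div B) j" "i div B < R"
  using assms acc_iff[OF assms(1)] by (auto simp: less_mult_imp_div_less)

text \<open>
  An index receives at most one vote per repetition, as it belongs to one bucket only. This holds for
  every measurement vector, and so does the resulting bound on the running time.
\<close>

lemma length_hits_le_R:
  assumes "q \<le> R * B"
  shows "length (hits q j) \<le> R"
proof -
  have "card {i. i < q \<and> acc i \<and> dec i = j} \<le> card {..<R}"
  proof (rule card_inj_on_le)
    show "inj_on (\<lambda>i. i div B) {i. i < q \<and> acc i \<and> dec i = j}"
    proof (rule inj_onI)
      fix i i' assume "i \<in> {i. i < q \<and> acc i \<and> dec i = j}" "i' \<in> {i. i < q \<and> acc i \<and> dec i = j}"
        and eq: "i div B = i' div B"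
      then have "i = i div B * B + f (i div B) j" "i' = i' div B * B + f (i' div B) j"
        using index_eq(1)[of i j] index_eq(1)[of i' j] assms by auto
      then show "i = i'"
        using eq by argo
    qed
    show "(\<lambda>i. i div B) ` {i. i < q \<and> acc i \<and> dec i = j} \<subseteq> {..<R}"
      using index_eq(2) assms by auto
  qed simp
  then show ?thesis
    using length_hits[OF assms] by simp
qed

lemma decoder_run:
  "terminates (assemble 0 decoder_code) 8 s \<epsilon> M y"
  "run_time (assemble 0 decoder_code) 8 s \<epsilon> M y \<le> R * B * (26 * L + 12 * R + 92) + s * (30 * L + 40) + 4 * L + 22"
  "\<exists>S z. outputs S z \<and> card S = s \<and> recovered s \<epsilon> M y = vec d z"
proof -
  have T: "real (2 * m) = Re (mat_entry M 1 0)"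
    using d by (simp add: mat_entry_def sketch_mat_def)
  have "total_correct ((dim_row M + dim_col M + 2) ^ 8) M y decoder_code
      (R * B * (26 * L + 12 * R + 92) + s * (30 * L + 40) + 4 * L + 22)
     (\<lambda>w r z. \<exists>S. outputs S z \<and> card S = s)
     ((\<lambda>_. 0)(0 := dim_row M, 1 := dim_col M, 2 := s)) ((\<lambda>_. 0)(0 := \<epsilon>)) (\<lambda>_. 0)"
  proof (rule total_decoder[OF _ _ _ _ T])
    show "dim_row M = 2 + R * B * (2 * L + 3)" "dim_col M \<le> 2 ^ L" "s \<le> dim_col M"
      using L s by auto
    show "dim_row M < (dim_row M + dim_col M + 2) ^ 8"
      using word_bound(2)[OF d L(2) s refl] by (simp only: dim_sketch_mat)
    show "2 ^ k < dim_col M" if "k < L" for k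
      using L(2)[OF that] by simp
    show "length (hits q (dec q)) \<le> R" if "q < R * B" for q
      using that by (intro length_hits_le_R) auto
  qed
  note * = total_run[OF this]
  show "terminates (assemble 0 decoder_code) 8 s \<epsilon> M y"
    "run_time (assemble 0 decoder_code) 8 s \<epsilon> M y \<le> R * B * (26 * L + 12 * R + 92) + s * (30 * L + 40) + 4 * L + 22"
    by (rule *)+
  show "\<exists>S z. outputs S z \<and> card S = s \<and> recovered s \<epsilon> M y = vec d z"
    using *(3) by auto
qed

end

text \<open>
  The measurements of the bit rows, expressed by a single hash function, so that the decoding event is
  an event about one repetition.
\<close>

definition half_mag :: "nat \<Rightarrow> nat \<Rightarrow> complex vec \<Rightarrow> (nat \<Rightarrow> nat) \<Rightarrow> nat \<Rightarrow> nat \<Rightarrow> real" where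
  "half_mag d L x h c e =
     (cmod (\<Sum>j | j < d \<and> h j = c \<and> (odd (j div 2 ^ (L - 1 - e div 2)) \<longleftrightarrow> even e). x $ j))\<^sup>2"

definition decodes :: "nat \<Rightarrow> nat \<Rightarrow> complex vec \<Rightarrow> (nat \<Rightarrow> nat) \<Rightarrow> nat \<Rightarrow> bool" where
  "decodes d L x h j \<longleftrightarrow> bits_prefix (half_mag d L x h (h j)) 0 L = j"

lemma bits_prefix_cong:
  assumes "\<And>e. e < 2 * k \<Longrightarrow> Y (p + e) = Y' (p' + e)"
  shows "bits_prefix Y p k = bits_prefix Y' p' k"
  using assms
proof (induction k)
  case (Suc k)
  have "Y (p + 2 * k) = Y' (p' + 2 * k)" "Y (Suc (p + 2 * k)) = Y' (Suc (p' + 2 * k))"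
    using Suc.prems[of "2 * k"] Suc.prems[of "Suc (2 * k)"] by auto
  then show ?case
    using Suc by simp
qed simp

text \<open>
  If an entry outweighs all other entries of its bucket together, then for every binary digit the half
  that contains it has the larger magnitude.
\<close>

lemma decodes_if_heavy:
  fixes x :: "complex vec"
  assumes j: "j < d" "d \<le> 2 ^ L"
    and heavy: "(\<Sum>i | i < d \<and> i \<noteq> j \<and> h i = h j. cmod (x $ i)) < cmod (x $ j)"
  shows "decodes d L x h j"
proof -
  have "bits_prefix (half_mag d L x h (h j)) 0 k = j div 2 ^ (L - k)" if "k \<le> L" for k
    using that
  proof (induction k)
    case 0
    then show ?case
      using j by simp
  next
    case (Suc k)
    define l where "l = L - 1 - k"
    define P where "P v = {i. i < d \<and> h i = h j \<and> (odd (i div 2 ^ l) \<longleftrightarrow> v)}" for v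
    define b where "b = odd (j div 2 ^ l)"
    have fin: "finite (P v)" for v
      unfolding P_def by simp
    have jb: "j \<in> P b" "j \<notin> P (\<not> b)"
      using j unfolding P_def b_def by auto
    have split: "{i. i < d \<and> i \<noteq> j \<and> h i = h j} = (P b - {j}) \<union> P (\<not> b)" "(P b - {j}) \<inter> P (\<not> b) = {}"
      using jb unfolding P_def by auto
    have "(\<Sum>i | i < d \<and> i \<noteq> j \<and> h i = h j. cmod (x $ i)) = (\<Sum>i\<in>P b - {j}. cmod (x $ i)) + (\<Sum>i\<in>P (\<not> b). cmod (x $ i))"
      unfolding split(1) using fin split(2) by (intro sum.union_disjoint) auto
    then have lt: "(\<Sum>i\<in>P b - {j}. cmod (x $ i)) + (\<Sum>i\<in>P (\<not> b). cmod (x $ i)) < cmod (x $ j)"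
      using heavy by simp
    have "(\<Sum>i\<in>P b. x $ i) = x $ j + (\<Sum>i\<in>P b - {j}. x $ i)"
      using fin jb by (simp add: sum.remove)
    then have "cmod (x $ j) \<le> cmod (\<Sum>i\<in>P b. x $ i) + cmod (\<Sum>i\<in>P b - {j}. x $ i)"
      by (metis add_diff_cancel_right' norm_triangle_ineq4)
    moreover have "cmod (\<Sum>i\<in>P b - {j}. x $ i) \<le> (\<Sum>i\<in>P b - {j}. cmod (x $ i))"
      "cmod (\<Sum>i\<in>P (\<not> b). x $ i) \<le> (\<Sum>i\<in>P (\<not> b). cmod (x $ i))"
      by (rule norm_sum)+
    ultimately have "cmod (\<Sum>i\<in>P (\<not> b). x $ i) < cmod (\<Sum>i\<in>P b. x $ i)"
      using lt by linarith
    then have sq: "(cmod (\<Sum>i\<in>P (\<not> b). x $ i))\<^sup>2 < (cmod (\<Sum>i\<in>P b. x $ i))\<^sup>2"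
      by (intro power_strict_mono) auto
    have h: "half_mag d L x h (h j) (2 * k) = (cmod (\<Sum>i\<in>P True. x $ i))\<^sup>2"
      "half_mag d L x h (h j) (Suc (2 * k)) = (cmod (\<Sum>i\<in>P False. x $ i))\<^sup>2"
      unfolding half_mag_def P_def l_def by simp_all
    have e: "L - k = Suc l" "L - Suc k = l"
      using Suc.prems unfolding l_def by auto
    have "j div 2 ^ l = 2 * (j div 2 ^ Suc l) + (if b then 1 else 0)"
    proof -
      have "j div 2 ^ Suc l = j div 2 ^ l div 2"
        by (metis div_mult2_eq mult.commute power_Suc)
      then show ?thesis
        unfolding b_def by (auto elim!: oddE evenE)
    qed
    moreover have "half_mag d L x h (h j) (2 * k) \<le> half_mag d L x h (h j) (Suc (2 * k)) \<longleftrightarrow> \<not> b"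
      using sq by (cases b) (simp_all only: h simp_thms not_True_eq_False not_False_eq_True not_le less_imp_le)
    ultimately show ?case
      using Suc.IH Suc.prems unfolding e by simp
  qed
  from this[of L] show ?thesis
    unfolding decodes_def by simp
qed

lemma decodes_inj: "h i = h j \<Longrightarrow> decodes d L x h i \<Longrightarrow> decodes d L x h j \<Longrightarrow> i = j"
  unfolding decodes_def by argo


text \<open>
  Polarisation recovers the product of the bucket sum with the conjugate reference from squared magnitudes.
\<close>

lemma norm_sq_sum_split:
  fixes a b :: complex
  shows "(cmod (b + a))\<^sup>2 - ((cmod a)\<^sup>2 + (cmod b)\<^sup>2) = 2 * Re (a * cnj b)"
    "(cmod a)\<^sup>2 + (cmod b)\<^sup>2 - (cmod (b + \<i> * a))\<^sup>2 = 2 * Im (a * cnj b)"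
  unfolding cmod_power2 by (simp_all add: power2_eq_square algebra_simps)

locale sketch_input =
  fixes d L B R m s t K :: nat and f :: "nat \<Rightarrow> nat \<Rightarrow> nat" and x :: "complex vec" and S0 :: "nat set" and \<eta> :: real
  assumes d: "1 \<le> d" and L: "d \<le> 2 ^ L" "\<And>k. k < L \<Longrightarrow> 2 ^ k < d" and s: "s \<le> d"
    and x: "x \<in> carrier_vec d"
    and hashing: "hashing d B K R m (\<lambda>i. cmod (x $ i)) S0 \<eta> (decodes d L x)"
    and f: "f \<in> {..<R} \<rightarrow>\<^sub>E {..<d} \<rightarrow>\<^sub>E {..<B}"
begin

abbreviation y :: "real vec" where
  "y \<equiv> sq_mag (sketch_mat d L B R m t f *\<^sub>v x)"

sublocale sketch d L B R m s t f y
  using d L s by unfold_locales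

sublocale hashing d B K R m "\<lambda>i. cmod (x $ i)" S0 \<eta> "decodes d L x"
  by (rule hashing)

definition ref :: complex where
  "ref = (\<Sum>j<d. of_nat t ^ j * x $ j)"

definition bucket_sum :: "nat \<Rightarrow> complex" where
  "bucket_sum q = (\<Sum>j | j < d \<and> f (q div B) j = q mod B. x $ j)"

lemma vec_entry_y: "i < 2 + R * B * (2 * L + 3) \<Longrightarrow> vec_entry y i = (cmod (\<Sum>j<d. M $$ (i, j) * x $ j))\<^sup>2"
proof -
  assume i: "i < 2 + R * B * (2 * L + 3)"
  have "(M *\<^sub>v x) $ i = (\<Sum>j<d. M $$ (i, j) * x $ j)"
    using i x by (auto simp: scalar_prod_def atLeast0LessThan intro!: sum.cong)
  then show ?thesis
    using i by (simp add: vec_entry_def sq_mag_def)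
qed

lemma y_ref: "vec_entry y 0 = (cmod ref)\<^sup>2"
  by (subst vec_entry_y) (simp_all add: ref_def sketch_mat_def)

lemma y_bucket:
  assumes "q < R * B" "e < 2 * L + 3"
  shows "vec_entry y (row q + e) = (cmod (\<Sum>j<d. bucket_coef L t (f (q div B)) (q mod B) e j * x $ j))\<^sup>2"
proof -
  have "row q + e < 2 + R * B * (2 * L + 3)"
    using sketch_mat_row(1)[OF assms lessI[of 0]] unfolding row_def by simp
  moreover have "M $$ (row q + e, j) = bucket_coef L t (f (q div B)) (q mod B) e j" if "j < d" for j
    using sketch_mat_row(2)[OF assms that] unfolding row_def by simp
  ultimately show ?thesis
    by (simp add: vec_entry_y)
qed

lemma sum_of_bool_mult: "(\<Sum>j<d. of_bool (P j) * (g j :: complex)) = (\<Sum>j | j < d \<and> P j. g j)"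
proof -
  have "of_bool (P j) * g j = (if P j then g j else 0)" for j
    by simp
  then show ?thesis
    by (simp add: sum.If_cases Int_def)
qed

lemma y_sums:
  assumes "q < R * B"
  shows "e < 2 * L \<Longrightarrow> vec_entry y (row q + e) = half_mag d L x (f (q div B)) (q mod B) e"
    "vec_entry y (row q + 2 * L) = (cmod (bucket_sum q))\<^sup>2"
    "vec_entry y (row q + 2 * L + 1) = (cmod (ref + bucket_sum q))\<^sup>2"
    "vec_entry y (row q + 2 * L + 2) = (cmod (ref + \<i> * bucket_sum q))\<^sup>2"
proof -
  show "vec_entry y (row q + e) = half_mag d L x (f (q div B)) (q mod B) e" if "e < 2 * L"
    using that assms by (simp add: y_bucket bucket_coef_def half_mag_def sum_of_bool_mult)
  show "vec_entry y (row q + 2 * L) = (cmod (bucket_sum q))\<^sup>2"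
    using assms by (simp add: y_bucket bucket_coef_def bucket_sum_def sum_of_bool_mult)
  show "vec_entry y (row q + 2 * L + 1) = (cmod (ref + bucket_sum q))\<^sup>2"
    using assms y_bucket[OF assms, of "2 * L + 1"]
    by (simp add: bucket_coef_def bucket_sum_def ref_def distrib_right sum.distrib sum_of_bool_mult)
  show "vec_entry y (row q + 2 * L + 2) = (cmod (ref + \<i> * bucket_sum q))\<^sup>2"
    using assms y_bucket[OF assms, of "2 * L + 2"]
    by (simp add: bucket_coef_def bucket_sum_def ref_def distrib_right sum.distrib mult.assoc sum_of_bool_mult flip: sum_distrib_left)
qed

lemma vals:
  assumes "q < R * B"
  shows "re_val q = 2 * Re (bucket_sum q * cnj ref)" "im_val q = 2 * Im (bucket_sum q * cnj ref)"
  unfolding re_val_def im_val_def y_ref y_sums(2-4)[OF assms] by (rule norm_sq_sum_split)+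

lemma dec_iff_decodes:
  assumes "r < R" "j < d"
  shows "r * B + f r j < R * B" "(r * B + f r j) div B = r" "(r * B + f r j) mod B = f r j"
    "dec (r * B + f r j) = j \<longleftrightarrow> decodes d L x (f r) j"
proof -
  have "f r j < B"
    using f assms by (auto simp: PiE_iff)
  then show *: "(r * B + f r j) div B = r" "(r * B + f r j) mod B = f r j"
    by auto
  have "r * B + f r j < (r + 1) * B"
    using \<open>f r j < B\<close> by simp
  also have "\<dots> \<le> R * B"
    using assms by (intro mult_right_mono) auto
  finally show lt: "r * B + f r j < R * B" .
  have "bits_prefix (vec_entry y) (row (r * B + f r j)) L = bits_prefix (half_mag d L x (f r) (f r j)) 0 L"
    by (rule bits_prefix_cong) (use y_sums(1)[OF lt] * in simp)
  then show "dec (r * B + f r j) = j \<longleftrightarrow> decodes d L x (f r) j"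
    unfolding dec_def decodes_def by simp
qed

lemma bucket_sum_close:
  assumes "r < R" "j < d"
  shows "cmod (bucket_sum (r * B + f r j) - x $ j) \<le> noise (f r) j"
proof -
  have "bucket_sum (r * B + f r j) = (\<Sum>i | i < d \<and> f r i = f r j. x $ i)"
    unfolding bucket_sum_def dec_iff_decodes(2,3)[OF assms] ..
  also have "{i. i < d \<and> f r i = f r j} = insert j {i. i < d \<and> i \<noteq> j \<and> f r i = f r j}"
    using assms by auto
  also have "(\<Sum>i\<in>\<dots>. x $ i) = x $ j + (\<Sum>i | i < d \<and> i \<noteq> j \<and> f r i = f r j. x $ i)"
    by (subst sum.insert) auto
  finally show ?thesis
    unfolding noise_def by (simp add: norm_sum)
qed

text \<open>
  The bucket \<open>r * B + f r j\<close> is the only one of repetition \<open>r\<close> that can vote for \<open>j\<close>.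
\<close>

lemma length_filter_hits:
  assumes "j < d"
  shows "length (filter (\<lambda>i. P (i div B)) (hits (R * B) j)) = card {r \<in> {..<R}. decodes d L x (f r) j \<and> P r}"
proof -
  have "length (filter (\<lambda>i. P (i div B)) (hits (R * B) j)) = card {i. i < R * B \<and> acc i \<and> dec i = j \<and> P (i div B)}"
    unfolding hits_def filter_filter length_filter_conv_card by (rule arg_cong[where f = card]) auto
  also have "\<dots> = card {r \<in> {..<R}. decodes d L x (f r) j \<and> P r}"
  proof (rule bij_betw_same_card[of "\<lambda>i. i div B"], rule bij_betw_byWitness[where f' = "\<lambda>r. r * B + f r j"])
    show "\<forall>i\<in>{i. i < R * B \<and> acc i \<and> dec i = j \<and> P (i div B)}. i div B * B + f (i div B) j = i"
      using index_eq(1) by auto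
    show "\<forall>r\<in>{r \<in> {..<R}. decodes d L x (f r) j \<and> P r}. (r * B + f r j) div B = r"
      using dec_iff_decodes(2) assms by auto
    show "(\<lambda>i. i div B) ` {i. i < R * B \<and> acc i \<and> dec i = j \<and> P (i div B)} \<subseteq> {r \<in> {..<R}. decodes d L x (f r) j \<and> P r}"
    proof (rule image_subsetI)
      fix i assume "i \<in> {i. i < R * B \<and> acc i \<and> dec i = j \<and> P (i div B)}"
      then have i: "i < R * B" "acc i" "dec i = j" "P (i div B)"
        by auto
      note e = index_eq[OF i(1-3)]
      have "decodes d L x (f (i div B)) j"
        using dec_iff_decodes(4)[OF e(2) assms] i(3) unfolding e(1)[symmetric] by simp
      then show "i div B \<in> {r \<in> {..<R}. decodes d L x (f r) j \<and> P r}"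
        using e(2) i(4) by simp
    qed
    show "(\<lambda>r. r * B + f r j) ` {r \<in> {..<R}. decodes d L x (f r) j \<and> P r} \<subseteq> {i. i < R * B \<and> acc i \<and> dec i = j \<and> P (i div B)}"
    proof clarify
      fix r assume r: "r < R" "decodes d L x (f r) j" "P r"
      note * = dec_iff_decodes[OF r(1) assms]
      show "r * B + f r j < R * B \<and> acc (r * B + f r j) \<and> dec (r * B + f r j) = j \<and> P ((r * B + f r j) div B)"
        using * r assms acc_iff[OF *(1)] by simp
    qed
  qed
  finally show ?thesis .
qed

definition z_val :: "nat \<Rightarrow> complex" where
  "z_val j = Complex (med re_val (R * B) j / (2 * cmod ref)) (med im_val (R * B) j / (2 * cmod ref))"

text \<open>
  Fewer than \<open>m\<close> of more than \<open>2 * m\<close> votes are noisy, so the median is controlled by the clean ones.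
\<close>

lemma many_hits_median:
  assumes j: "j < d" and good: "\<not> bad_decoded f" and many: "2 * m < length (hits (R * B) j)"
    and close: "\<And>i. \<lbrakk>i < R * B; i mod B = f (i div B) j; noise (f (i div B)) j \<le> \<eta>\<rbrakk> \<Longrightarrow> lo \<le> g i \<and> g i \<le> hi"
  shows "lo \<le> med g (R * B) j \<and> med g (R * B) j \<le> hi"
proof -
  let ?xs = "hits (R * B) j"
  have "length (filter (\<lambda>i. \<not> (lo \<le> g i \<and> g i \<le> hi)) ?xs) \<le> length (filter (\<lambda>i. \<eta> < noise (f (i div B)) j) ?xs)"
  proof -
    have eq: "filter (\<lambda>i. \<not> (lo \<le> g i \<and> g i \<le> hi)) ?xs = filter (\<lambda>i. \<not> (lo \<le> g i \<and> g i \<le> hi)) (filter (\<lambda>i. \<eta> < noise (f (i div B)) j) ?xs)"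
      unfolding filter_filter
    proof (rule filter_cong[OF refl])
      fix i assume "i \<in> set ?xs"
      then have i: "i < R * B" "acc i" "dec i = j"
        by (auto simp: hits_def)
      then have "i mod B = f (i div B) j"
        using acc_iff by auto
      then show "(\<not> (lo \<le> g i \<and> g i \<le> hi)) = (\<eta> < noise (f (i div B)) j \<and> \<not> (lo \<le> g i \<and> g i \<le> hi))"
        using close[OF i(1)] by (meson not_le)
    qed
    show ?thesis
      by (subst eq) (rule length_filter_le)
  qed
  also have "\<dots> = card {r \<in> {..<R}. decodes d L x (f r) j \<and> \<eta> < noise (f r) j}"
    by (rule length_filter_hits[OF j])
  also have "\<dots> < m"
    using good j unfolding bad_decoded_def by (meson not_le)
  finally have "2 * length (filter (\<lambda>i. \<not> (lo \<le> g i \<and> g i \<le> hi)) ?xs) < length ?xs"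
    using many by linarith
  from median_between[OF this] show ?thesis
    using many unfolding med_def by simp
qed

text \<open>
  With enough votes, the median is accurate in both coordinates. Without them, the estimate is 0, and
  the entry cannot be heavy: a heavy entry is decoded in every repetition with small noise, and there
  are at least \<open>2 * m + 1\<close> of those among the \<open>3 * m\<close> repetitions.
\<close>

lemma z_val_close:
  assumes j: "j < d" and ref: "ref \<noteq> 0" and good: "\<not> bad_decoded f" "\<not> bad_heavy f"
  shows "cmod (cnj ref / cmod ref * x $ j - z_val j) \<le> 2 * \<eta>"
proof -
  define \<omega> where "\<omega> = cnj ref / cmod ref"
  have \<omega>: "cmod \<omega> = 1" "cnj ref = \<omega> * cmod ref"
    using ref by (simp_all add: \<omega>_def norm_divide)
  show ?thesis
  proof (cases "2 * m < length (hits (R * B) j)")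
    case True
    have close: "cmod (bucket_sum i * \<omega> - \<omega> * x $ j) \<le> \<eta>"
      if "i < R * B" "i mod B = f (i div B) j" "noise (f (i div B)) j \<le> \<eta>" for i
    proof -
      have r: "i div B < R"
        using that(1) by (simp add: less_mult_imp_div_less)
      have i: "i = i div B * B + f (i div B) j"
        using that(2) by (metis div_mult_mod_eq)
      have "cmod (bucket_sum i * \<omega> - \<omega> * x $ j) = cmod (bucket_sum i - x $ j)"
        using \<omega> by (metis mult.commute mult.right_neutral norm_mult right_diff_distrib)
      also have "\<dots> \<le> noise (f (i div B)) j"
        using bucket_sum_close[OF r j] i by simp
      finally show ?thesis
        using that(3) by simp
    qed
    define c where "c = 2 * cmod ref"
    have c: "0 < c"
      using ref by (simp add: c_def)
    have v: "re_val i = c * Re (bucket_sum i * \<omega>)" "im_val i = c * Im (bucket_sum i * \<omega>)" if "i < R * B" for i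
      unfolding vals[OF that] \<omega>(2) c_def by (simp_all add: algebra_simps)
    have "c * (Re (\<omega> * x $ j) - \<eta>) \<le> med re_val (R * B) j \<and> med re_val (R * B) j \<le> c * (Re (\<omega> * x $ j) + \<eta>)"
    proof (rule many_hits_median[OF j good(1) True])
      fix i assume i: "i < R * B" "i mod B = f (i div B) j" "noise (f (i div B)) j \<le> \<eta>"
      have "\<bar>Re (bucket_sum i * \<omega> - \<omega> * x $ j)\<bar> \<le> \<eta>"
        using close[OF i] abs_Re_le_cmod order_trans by blast
      then have "Re (\<omega> * x $ j) - \<eta> \<le> Re (bucket_sum i * \<omega>)" "Re (bucket_sum i * \<omega>) \<le> Re (\<omega> * x $ j) + \<eta>"
        unfolding minus_complex.simps by linarith+
      then show "c * (Re (\<omega> * x $ j) - \<eta>) \<le> re_val i \<and> re_val i \<le> c * (Re (\<omega> * x $ j) + \<eta>)"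
        unfolding v[OF i(1)] using c by simp
    qed
    then have re: "\<bar>Re (\<omega> * x $ j - z_val j)\<bar> \<le> \<eta>"
      using c unfolding z_val_def c_def[symmetric] minus_complex.simps complex.sel
      by (simp add: abs_le_iff field_simps)
    have "c * (Im (\<omega> * x $ j) - \<eta>) \<le> med im_val (R * B) j \<and> med im_val (R * B) j \<le> c * (Im (\<omega> * x $ j) + \<eta>)"
    proof (rule many_hits_median[OF j good(1) True])
      fix i assume i: "i < R * B" "i mod B = f (i div B) j" "noise (f (i div B)) j \<le> \<eta>"
      have "\<bar>Im (bucket_sum i * \<omega> - \<omega> * x $ j)\<bar> \<le> \<eta>"
        using close[OF i] abs_Im_le_cmod order_trans by blast
      then have "Im (\<omega> * x $ j) - \<eta> \<le> Im (bucket_sum i * \<omega>)" "Im (bucket_sum i * \<omega>) \<le> Im (\<omega> * x $ j) + \<eta>"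
        unfolding minus_complex.simps by linarith+
      then show "c * (Im (\<omega> * x $ j) - \<eta>) \<le> im_val i \<and> im_val i \<le> c * (Im (\<omega> * x $ j) + \<eta>)"
        unfolding v[OF i(1)] using c by simp
    qed
    then have "\<bar>Im (\<omega> * x $ j - z_val j)\<bar> \<le> \<eta>"
      using c unfolding z_val_def c_def[symmetric] minus_complex.simps complex.sel
      by (simp add: abs_le_iff field_simps)
    with re show ?thesis
      using cmod_le[of "\<omega> * x $ j - z_val j"] unfolding \<omega>_def by linarith
  next
    case False
    let ?N = "{r \<in> {..<R}. \<eta> < noise (f r) j}" and ?D = "{r \<in> {..<R}. decodes d L x (f r) j \<and> True}"
    have "cmod (x $ j) \<le> \<eta>"
    proof (rule ccontr)
      assume "\<not> cmod (x $ j) \<le> \<eta>"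
      then have heavy: "\<eta> < cmod (x $ j)" by simp
      have "card ?N < m"
        using good(2) heavy j unfolding bad_heavy_def by (meson not_le)
      moreover have "{..<R} - ?N \<subseteq> ?D"
        using decodes_if_heavy[OF j L(1), where h = "f r" and x = x for r] heavy unfolding noise_def by fastforce
      then have "card ({..<R} - ?N) \<le> length (hits (R * B) j)"
        using length_filter_hits[OF j, of "\<lambda>_. True"] card_mono[of "?D"] by simp
      moreover have "card ({..<R} - ?N) = R - card ?N"
        by (subst card_Diff_subset) auto
      ultimately show False
        using False R by linarith
    qed
    moreover have "z_val j = 0"
      using False unfolding z_val_def med_def by (simp add: complex_eq_iff)
    ultimately show ?thesis
      using \<omega>(1) \<eta>_nonneg unfolding \<omega>_def[symmetric] by (simp add: norm_mult)
  qed
qed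

lemma z_val_outside: "d \<le> j \<Longrightarrow> z_val j = 0"
proof -
  assume "d \<le> j"
  have "hits (R * B) j = []"
  proof -
    have "\<not> (acc i \<and> dec i = j)" if "i < R * B" for i
      using acc_iff[OF that] \<open>d \<le> j\<close> by auto
    then show ?thesis
      unfolding hits_def by (auto simp: filter_empty_conv)
  qed
  then show ?thesis
    unfolding z_val_def med_def by (simp add: complex_eq_iff)
qed

text \<open>
  The phase of the conjugate reference is the global phase up to which the vector is recovered.
\<close>

lemma recover_error:
  assumes good: "ref \<noteq> 0" "\<not> bad_decoded f" "\<not> bad_heavy f"
    and xs: "opt_sparse_approx x (real s) xs"
  shows "\<exists>\<theta>\<in>{0..2 * pi}. norm2 (exp (\<i> * of_real \<theta>) \<cdot>\<^sub>v x - recovered s \<epsilon> M y)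
    \<le> norm2 (x - xs) + 6 * \<eta> * sqrt (real s)"
proof -
  define \<omega> where "\<omega> = cnj ref / cmod ref"
  have \<omega>1: "cmod \<omega> = 1"
    using good(1) by (simp add: \<omega>_def norm_divide)
  obtain \<theta> where \<theta>: "0 \<le> \<theta>" "\<theta> < 2 * pi" "\<omega> = exp (\<i> * of_real \<theta>)"
  proof -
    have "\<omega> = exp (\<i> * of_real (Arg2pi \<omega>))"
      using Arg2pi_eq[of \<omega>] \<omega>1 by simp
    then show ?thesis
      using that[of "Arg2pi \<omega>"] Arg2pi_ge_0 Arg2pi_lt_2pi by auto
  qed
  obtain S z where S: "outputs S z" "card S = s" and rec: "recovered s \<epsilon> M y = vec d z"
    using decoder_run(3) by blast
  obtain T where T: "T \<subseteq> {..<d}" "card T = s" "xs = vec d (\<lambda>i. if i \<in> T then x $ i else 0)"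
    using xs x s unfolding opt_sparse_approx_def by auto
  have dim: "dim_vec x = d"
    using x by simp
  have z: "z = (\<lambda>j. if j \<in> S then z_val j else 0)" and SN: "S \<subseteq> {..<2 ^ L}"
    using S(1) unfolding outputs_def y_ref z_val_def by auto
  have key: "key j = (2 * cmod ref)\<^sup>2 * (cmod (z_val j))\<^sup>2" for j
    using good(1) unfolding key_def z_val_def cmod_power2 complex.sel by (simp add: field_simps)
  have order: "cmod (z_val j) \<le> cmod (z_val i)" if "i \<in> S" "j < 2 ^ L" "j \<notin> S" for i j
  proof -
    have "key j \<le> key i"
      using S(1) that unfolding outputs_def by auto
    then have "(cmod (z_val j))\<^sup>2 \<le> (cmod (z_val i))\<^sup>2"
      unfolding key using good(1) by simp
    then show ?thesis
      by (rule power2_le_imp_le) simp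
  qed
  define x' where "x' j = (if j < d then \<omega> * x $ j else 0)" for j
  have "norm2 (exp (\<i> * of_real \<theta>) \<cdot>\<^sub>v x - vec d z) = L2_set (\<lambda>j. cmod (x' j - (if j \<in> S then z_val j else 0))) {..<d}"
    unfolding norm2_def \<theta>(3)[symmetric] by (rule L2_set_cong) (simp_all add: dim x'_def z)
  also have "\<dots> \<le> L2_set (\<lambda>j. cmod (x' j - (if j \<in> S then z_val j else 0))) {..<2 ^ L}"
    unfolding L2_set_def by (intro real_sqrt_le_mono sum_mono2) (use L in auto)
  also have "\<dots> \<le> L2_set (\<lambda>j. cmod (x' j)) ({..<2 ^ L} - T) + 3 * (2 * \<eta>) * sqrt (real s)"
  proof (rule L2_set_selected_error)
    show "cmod (x' j - z_val j) \<le> 2 * \<eta>" if "j < 2 ^ L" for j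
      using z_val_close[OF _ good, of j] z_val_outside[of j] \<eta>_nonneg by (simp add: x'_def \<omega>_def)
    show "S \<subseteq> {..<2 ^ L}" "card S = s" "T \<subseteq> {..<2 ^ L}" "card T \<le> s"
      using SN S T L by auto
  qed (use order in auto)
  also have "L2_set (\<lambda>j. cmod (x' j)) ({..<2 ^ L} - T) = norm2 (x - xs)"
  proof -
    have "(\<Sum>j\<in>{..<2 ^ L} - T. (cmod (x' j))\<^sup>2) = (\<Sum>j\<in>{..<d} - T. (cmod (x' j))\<^sup>2)"
      by (rule sum.mono_neutral_right) (use L in \<open>auto simp: x'_def\<close>)
    also have "\<dots> = (\<Sum>j\<in>{..<d} - T. (cmod ((x - xs) $ j))\<^sup>2)"
      by (rule sum.cong) (auto simp: x'_def T(3) norm_mult \<omega>1)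
    also have "\<dots> = (\<Sum>j<d. (cmod ((x - xs) $ j))\<^sup>2)"
      by (rule sum.mono_neutral_left) (auto simp: T(3))
    finally show ?thesis
      unfolding norm2_def L2_set_def by (simp add: T(3))
  qed
  finally have "norm2 (exp (\<i> * of_real \<theta>) \<cdot>\<^sub>v x - vec d z) \<le> norm2 (x - xs) + 6 * \<eta> * sqrt (real s)"
    by simp
  then show ?thesis
    unfolding rec using \<theta> by (intro bexI[of _ \<theta>]) auto
qed

text \<open>
  For the zero vector the reference measurement vanishes for every seed; the output is 0 because division
  by 0 gives 0.
\<close>

lemma recover_error_zero:
  assumes zero: "\<And>j. j < d \<Longrightarrow> x $ j = 0"
  shows "norm2 (exp (\<i> * of_real \<theta>) \<cdot>\<^sub>v x - recovered s \<epsilon> M y) = 0"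
proof -
  have "ref = 0"
    unfolding ref_def using zero by simp
  obtain S z where S: "outputs S z" and rec: "recovered s \<epsilon> M y = vec d z"
    using decoder_run(3) by blast
  have "z = (\<lambda>_. 0)"
    using S \<open>ref = 0\<close> unfolding outputs_def y_ref by (auto simp: complex_eq_iff)
  then show ?thesis
    unfolding rec norm2_def using x zero by (simp add: L2_set_def)
qed

end

section \<open>Parameters, probability and complexity\<close>

definition bit_len :: "nat \<Rightarrow> nat" where
  "bit_len n = (LEAST l. n \<le> 2 ^ l)"

lemma bit_len: "n \<le> 2 ^ bit_len n" "k < bit_len n \<Longrightarrow> 2 ^ k < n"
proof -
  have "n \<le> 2 ^ n"
    by simp
  then show "n \<le> 2 ^ bit_len n"
    unfolding bit_len_def by (rule LeastI)
  show "2 ^ k < n" if "k < bit_len n"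
    using not_less_Least[of k "\<lambda>l. n \<le> 2 ^ l"] that unfolding bit_len_def by auto
qed

lemma bit_len_pos: "2 \<le> n \<Longrightarrow> 1 \<le> bit_len n"
  using bit_len(1)[of n] by (cases "bit_len n") auto

lemma bit_len_le_ln:
  assumes "1 \<le> n"
  shows "real (bit_len n) \<le> 2 * ln (real n) + 1"
proof (cases "bit_len n")
  case (Suc k)
  have "2 ^ k < n"
    using bit_len(2)[of k n] Suc by simp
  then have "real (2 ^ k) \<le> real n"
    by (intro of_nat_mono) simp
  then have "ln (2 ^ k) \<le> ln (real n)"
    by (intro ln_mono) auto
  moreover have "(1 / 2 :: real) \<le> ln 2"
    by (subst ln_ge_iff) (simp_all add: exp_half_le2)
  then have "real k * (1 / 2) \<le> real k * ln 2"
    by (intro mult_left_mono) auto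
  ultimately show ?thesis
    using Suc by (simp add: ln_realpow)
qed (use assms in simp)

lemma ln_le_bit_len:
  assumes "1 \<le> n"
  shows "ln (real n) \<le> real (bit_len n)"
proof -
  have "real n \<le> real (2 ^ bit_len n)"
    using bit_len(1) by (intro of_nat_mono)
  then have "ln (real n) \<le> ln (2 ^ bit_len n)"
    using assms by (intro ln_mono) auto
  also have "\<dots> = real (bit_len n) * ln 2"
    by (simp add: ln_realpow)
  also have "\<dots> \<le> real (bit_len n) * 1"
    using ln_2_less_1 by (intro mult_left_mono) auto
  finally show ?thesis
    by simp
qed

text \<open>
  The number of entries of the best approximation at sparsity level \<open>s / \<epsilon>\<close>.
\<close>

definition kept :: "nat \<Rightarrow> nat \<Rightarrow> real \<Rightarrow> nat" where
  "kept d s \<epsilon> = min d (nat \<lfloor>real s / \<epsilon>\<rfloor>)"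

text \<open>
  The number \<open>m\<close> of bad repetitions that must not be reached. The choice makes \<open>8 ^ m\<close> at least the sixth power of
  \<open>K + bit_len d\<close>. The second summand matters only if \<open>s\<close> is small compared with \<open>ln d\<close>: the failure
  probability has to decrease with \<open>d\<close> even then.
\<close>

definition slack :: "nat \<Rightarrow> nat \<Rightarrow> real \<Rightarrow> nat" where
  "slack d s \<epsilon> = 2 * bit_len (kept d s \<epsilon> + bit_len d)"

definition buckets :: "nat \<Rightarrow> nat \<Rightarrow> real \<Rightarrow> nat" where
  "buckets d s \<epsilon> = 128 * kept d s \<epsilon>"

definition repetitions :: "nat \<Rightarrow> nat \<Rightarrow> real \<Rightarrow> nat" where
  "repetitions d s \<epsilon> = 3 * slack d s \<epsilon>"

definition measurements :: "nat \<Rightarrow> nat \<Rightarrow> real \<Rightarrow> nat" where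
  "measurements d s \<epsilon> = 2 + repetitions d s \<epsilon> * buckets d s \<epsilon> * (2 * bit_len d + 3)"

text \<open>
  The node \<open>t\<close> of the reference row is drawn from a set that is larger than the number of zeros of a
  polynomial of degree below \<open>d\<close> by the factor \<open>bit_len d ^ 5\<close>.
\<close>

definition seeds :: "nat \<Rightarrow> nat \<Rightarrow> real \<Rightarrow> (nat \<times> (nat \<Rightarrow> nat \<Rightarrow> nat)) set" where
  "seeds d s \<epsilon> = {1..d * bit_len d ^ 5} \<times>
     ({..<repetitions d s \<epsilon>} \<rightarrow>\<^sub>E {..<d} \<rightarrow>\<^sub>E {..<buckets d s \<epsilon>})"

definition seed_mat :: "nat \<Rightarrow> nat \<Rightarrow> real \<Rightarrow> nat \<times> (nat \<Rightarrow> nat \<Rightarrow> nat) \<Rightarrow> complex mat" where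
  "seed_mat d s \<epsilon> = (\<lambda>(t, f). sketch_mat d (bit_len d) (buckets d s \<epsilon>) (repetitions d s \<epsilon>) (slack d s \<epsilon>) t f)"

definition sketch_law :: "nat \<Rightarrow> nat \<Rightarrow> real \<Rightarrow> complex mat measure" where
  "sketch_law d s \<epsilon> = distr (uniform_count_measure (seeds d s \<epsilon>))
     (count_space (seed_mat d s \<epsilon> ` seeds d s \<epsilon>)) (seed_mat d s \<epsilon>)"

abbreviation accurate :: "nat \<Rightarrow> real \<Rightarrow> complex vec \<Rightarrow> complex vec \<Rightarrow> complex vec \<Rightarrow> complex mat \<Rightarrow> bool" where
  "accurate s \<epsilon> x xs xt M \<equiv>
     (INF \<theta>\<in>{0..2 * pi}. norm2 (exp (\<i> * of_real \<theta>) \<cdot>\<^sub>v x - recovered s \<epsilon> M (sq_mag (M *\<^sub>v x))))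
        \<le> norm2 (x - xs) + 22 * \<epsilon> * norm1 (x - xt) / sqrt (real s)"

context
  fixes d s :: nat and \<epsilon> :: real
  assumes d: "4 \<le> d" and s: "s \<in> {1..d}" and \<epsilon>: "\<epsilon> \<in> {0<..1}"
begin

lemma level_ge: "real s \<le> real s / \<epsilon>" "1 \<le> real s / \<epsilon>"
proof -
  show "real s \<le> real s / \<epsilon>"
    using \<epsilon> mult_left_le_one_le[of "real s" \<epsilon>] by (simp add: field_simps)
  then show "1 \<le> real s / \<epsilon>"
    using s by (auto intro: order_trans[of 1 "real s"])
qed

lemma kept_pos: "1 \<le> kept d s \<epsilon>" and kept_le: "real (kept d s \<epsilon>) \<le> real s / \<epsilon>"
proof -
  have fl: "1 \<le> \<lfloor>real s / \<epsilon>\<rfloor>"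
    using level_ge by (simp add: le_floor_iff)
  then show "1 \<le> kept d s \<epsilon>"
    using d by (simp add: kept_def le_nat_iff)
  have "real (kept d s \<epsilon>) \<le> real (nat \<lfloor>real s / \<epsilon>\<rfloor>)"
    unfolding kept_def by (intro of_nat_mono) simp
  also have "\<dots> = of_int \<lfloor>real s / \<epsilon>\<rfloor>"
    using fl by simp
  also have "\<dots> \<le> real s / \<epsilon>"
    by (rule of_int_floor_le)
  finally show "real (kept d s \<epsilon>) \<le> real s / \<epsilon>" .
qed

lemma ln_d: "1 < ln (real d)"
proof -
  have "exp 1 < real d"
    using exp_le d by linarith
  then have "ln (exp 1) < ln (real d)"
    using d by (subst ln_less_cancel_iff) auto
  then show ?thesis
    by simp
qed

lemma bit_len_d: "1 \<le> bit_len d"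
  by (rule bit_len_pos) (use d in simp)

lemma slack_pos: "1 \<le> slack d s \<epsilon>"
  using bit_len_pos[of "kept d s \<epsilon> + bit_len d"] kept_pos bit_len_d by (simp add: slack_def)

lemma seeds_finite_nonempty: "finite (seeds d s \<epsilon>)" "seeds d s \<epsilon> \<noteq> {}"
proof -
  show "finite (seeds d s \<epsilon>)"
    unfolding seeds_def by (intro finite_cartesian_product finite_PiE) auto
  have "1 \<le> d * bit_len d ^ 5"
    using d bit_len_d by simp
  then have "1 \<in> {1..d * bit_len d ^ 5}"
    by simp
  moreover have "{..<repetitions d s \<epsilon>} \<rightarrow>\<^sub>E {..<d} \<rightarrow>\<^sub>E {..<buckets d s \<epsilon>} \<noteq> {}"
    using kept_pos by (auto simp: PiE_eq_empty_iff lessThan_empty_iff buckets_def)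
  ultimately show "seeds d s \<epsilon> \<noteq> {}"
    unfolding seeds_def by blast
qed

lemma space_sketch_law: "space (sketch_law d s \<epsilon>) = seed_mat d s \<epsilon> ` seeds d s \<epsilon>"
  by (simp add: sketch_law_def)

lemma random_matrix_law_sketch: "random_matrix_law (measurements d s \<epsilon>) d (sketch_law d s \<epsilon>)"
proof -
  have "prob_space (uniform_count_measure (seeds d s \<epsilon>))"
    using seeds_finite_nonempty by (rule prob_space_uniform_count_measure)
  then have "prob_space (sketch_law d s \<epsilon>)"
    unfolding sketch_law_def
    by (rule prob_space.prob_space_distr) (auto simp: measurable_def space_uniform_count_measure sets_uniform_count_measure)
  moreover have "space (sketch_law d s \<epsilon>) \<subseteq> carrier_mat (measurements d s \<epsilon>) d"
    unfolding space_sketch_law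
  proof (rule image_subsetI)
    show "seed_mat d s \<epsilon> \<omega> \<in> carrier_mat (measurements d s \<epsilon>) d" for \<omega>
      by (cases \<omega>) (rule carrier_matI; simp only: seed_mat_def prod.case dim_sketch_mat measurements_def)
  qed
  moreover have "g \<in> borel_measurable (sketch_law d s \<epsilon>)" for g :: "complex mat \<Rightarrow> complex"
    unfolding sketch_law_def by simp
  ultimately show ?thesis
    unfolding random_matrix_law_def by blast
qed

lemma prob_sketch_law:
  "\<P>(M in sketch_law d s \<epsilon>. P M) = real (card {\<omega> \<in> seeds d s \<epsilon>. P (seed_mat d s \<epsilon> \<omega>)}) / real (card (seeds d s \<epsilon>))"
proof -
  let ?U = "uniform_count_measure (seeds d s \<epsilon>)"
  let ?A = "seed_mat d s \<epsilon> ` seeds d s \<epsilon>"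
  have "measure (sketch_law d s \<epsilon>) {M \<in> space (sketch_law d s \<epsilon>). P M} =
      measure ?U (seed_mat d s \<epsilon> -` {M \<in> ?A. P M} \<inter> space ?U)"
    unfolding space_sketch_law unfolding sketch_law_def
    by (rule measure_distr) (auto simp: measurable_def space_uniform_count_measure sets_uniform_count_measure)
  also have "seed_mat d s \<epsilon> -` {M \<in> ?A. P M} \<inter> space ?U = {\<omega> \<in> seeds d s \<epsilon>. P (seed_mat d s \<epsilon> \<omega>)}"
    by (auto simp: space_uniform_count_measure)
  also have "measure ?U \<dots> = real (card {\<omega> \<in> seeds d s \<epsilon>. P (seed_mat d s \<epsilon> \<omega>)}) / real (card (seeds d s \<epsilon>))"
    using seeds_finite_nonempty by (intro measure_uniform_count_measure) auto
  finally show ?thesis .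
qed

lemma sketch_params: "sketch d (bit_len d) s"
  using d s bit_len by unfold_locales auto

lemma sketch_terminates:
  assumes "M \<in> space (sketch_law d s \<epsilon>)"
  shows "terminates (assemble 0 decoder_code) 8 s \<epsilon> M y"
    "run_time (assemble 0 decoder_code) 8 s \<epsilon> M y \<le>
       repetitions d s \<epsilon> * buckets d s \<epsilon> * (26 * bit_len d + 12 * repetitions d s \<epsilon> + 92) +
       s * (30 * bit_len d + 40) + 4 * bit_len d + 22"
  using assms sketch.decoder_run(1,2)[OF sketch_params] unfolding space_sketch_law seed_mat_def by auto

text \<open>
  The reference measurement is the value at \<open>t\<close> of the polynomial whose coefficients are the entries of \<open>x\<close>.
\<close>

lemma few_roots:
  assumes "j < d" "x $ j \<noteq> 0"
  shows "card {t \<in> {1..n}. (\<Sum>i<d. of_nat t ^ i * x $ i) = (0::complex)} \<le> d"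
proof -
  define p where "p = (\<Sum>i<d. Polynomial.monom (x $ i) i)"
  have coeff: "poly.coeff p j = x $ j"
    using assms unfolding p_def by (simp add: coeff_sum)
  then have "p \<noteq> 0"
    using assms by auto
  have poly_eq: "poly p (of_nat t) = (\<Sum>i<d. of_nat t ^ i * x $ i)" for t :: nat
    unfolding p_def by (simp add: poly_sum poly_monom mult.commute)
  have "card {t \<in> {1..n}. (\<Sum>i<d. of_nat t ^ i * x $ i) = (0::complex)} \<le> card {z. poly p z = 0}"
  proof (rule card_inj_on_le[where f = of_nat])
    show "finite {z. poly p z = 0}"
      using \<open>p \<noteq> 0\<close> by (rule poly_roots_finite)
  qed (auto simp: inj_on_def poly_eq)
  also have "\<dots> \<le> Polynomial.degree p"
    using \<open>p \<noteq> 0\<close> by (rule card_poly_roots_bound)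
  also have "\<dots> \<le> d"
    unfolding p_def by (intro degree_sum_le) (auto intro: order_trans[OF degree_monom_le])
  finally show ?thesis .
qed


lemma hashing_params:
  assumes x: "x \<in> carrier_vec d" and xt: "opt_sparse_approx x (real s / \<epsilon>) xt"
  obtains S where "hashing d (buckets d s \<epsilon>) (kept d s \<epsilon>) (repetitions d s \<epsilon>) (slack d s \<epsilon>)
      (\<lambda>i. cmod (x $ i)) S (norm1 (x - xt) / kept d s \<epsilon>) (decodes d (bit_len d) x)"
    "S \<subseteq> {..<d}" "card S = kept d s \<epsilon>" "norm1 (x - xt) = (\<Sum>i\<in>{..<d} - S. cmod (x $ i))"
proof -
  have dim: "dim_vec x = d"
    using x by simp
  obtain S where S: "S \<subseteq> {..<d}" "card S = kept d s \<epsilon>" "xt = vec d (\<lambda>i. if i \<in> S then x $ i else 0)"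
    using xt unfolding opt_sparse_approx_def dim kept_def by auto
  have "norm1 (x - xt) = (\<Sum>i<d. cmod ((x - xt) $ i))"
    unfolding norm1_def by (simp add: S(3))
  also have "\<dots> = (\<Sum>i\<in>{..<d} - S. cmod ((x - xt) $ i))"
    by (rule sum.mono_neutral_right) (auto simp: S(3))
  also have "\<dots> = (\<Sum>i\<in>{..<d} - S. cmod (x $ i))"
    by (rule sum.cong) (auto simp: S(3))
  finally have n1: "norm1 (x - xt) = (\<Sum>i\<in>{..<d} - S. cmod (x $ i))" .
  have "hashing d (buckets d s \<epsilon>) (kept d s \<epsilon>) (repetitions d s \<epsilon>) (slack d s \<epsilon>)
      (\<lambda>i. cmod (x $ i)) S (norm1 (x - xt) / kept d s \<epsilon>) (decodes d (bit_len d) x)"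
    by unfold_locales (use kept_pos slack_pos S n1 decodes_inj in \<open>auto simp: buckets_def repetitions_def\<close>)
  then show ?thesis
    using that S n1 by blast
qed

text \<open>
  Rounding \<open>s / \<epsilon>\<close> down loses at most a factor 2, and if the dimension limits the number of entries,
  then there is no tail. The resulting constant is 12.
\<close>

lemma error_bound:
  assumes x: "x \<in> carrier_vec d" and xt: "opt_sparse_approx x (real s / \<epsilon>) xt"
  shows "6 * (norm1 (x - xt) / kept d s \<epsilon>) * sqrt (real s) \<le> 22 * \<epsilon> * norm1 (x - xt) / sqrt (real s)"
proof -
  obtain S where S: "S \<subseteq> {..<d}" "card S = kept d s \<epsilon>" "norm1 (x - xt) = (\<Sum>i\<in>{..<d} - S. cmod (x $ i))"
    by (rule hashing_params[OF x xt], (rule that; assumption))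
  have nn: "0 \<le> norm1 (x - xt)"
    unfolding S(3) by (intro sum_nonneg) simp
  show ?thesis
  proof (cases "kept d s \<epsilon> = d")
    case True
    then have "S = {..<d}"
      using S by (intro card_subset_eq) auto
    then have "norm1 (x - xt) = 0"
      unfolding S(3) by simp
    then show ?thesis
      by simp
  next
    case False
    define u where "u = real s / \<epsilon>"
    have u: "1 \<le> u" "real s = u * \<epsilon>"
      using level_ge \<epsilon> by (auto simp: u_def)
    have "kept d s \<epsilon> = nat \<lfloor>u\<rfloor>"
      using False unfolding kept_def u_def by auto
    then have "real (kept d s \<epsilon>) = of_int \<lfloor>u\<rfloor>"
      using u(1) by simp
    moreover have "u \<le> 2 * of_int \<lfloor>u\<rfloor>"
    proof -
      have "1 \<le> \<lfloor>u\<rfloor>"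
        using u(1) by (simp add: le_floor_iff)
      then have "1 \<le> real_of_int \<lfloor>u\<rfloor>"
        by simp
      then show ?thesis
        using real_of_int_floor_add_one_gt[of u] by linarith
    qed
    ultimately have k: "u / 2 \<le> real (kept d s \<epsilon>)"
      by simp
    have "norm1 (x - xt) / kept d s \<epsilon> \<le> norm1 (x - xt) / (u / 2)"
      using k nn u by (intro divide_left_mono) auto
    also have "\<dots> = 2 * \<epsilon> * norm1 (x - xt) / real s"
      unfolding u(2) using u \<epsilon> by (simp add: field_simps)
    finally have "6 * (norm1 (x - xt) / kept d s \<epsilon>) * sqrt (real s) \<le> 6 * (2 * \<epsilon> * norm1 (x - xt) / real s) * sqrt (real s)"
      by (intro mult_right_mono mult_left_mono) auto
    also have "\<dots> = 12 * (\<epsilon> * norm1 (x - xt)) / sqrt (real s)"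
    proof -
      have "sqrt (real s) / real s = 1 / sqrt (real s)"
        using s by (simp add: real_div_sqrt field_simps)
      moreover have "6 * (2 * \<epsilon> * norm1 (x - xt) / real s) * sqrt (real s) = 12 * (\<epsilon> * norm1 (x - xt)) * (sqrt (real s) / real s)"
        by simp
      ultimately show ?thesis
        by simp
    qed
    also have "\<dots> \<le> 22 * (\<epsilon> * norm1 (x - xt)) / sqrt (real s)"
      using nn \<epsilon> by (intro divide_right_mono mult_right_mono) auto
    finally show ?thesis
      by (simp add: mult.assoc)
  qed
qed

lemma INF_le_at:
  fixes g :: "real \<Rightarrow> real"
  assumes "\<theta> \<in> A" "g \<theta> \<le> b" "\<And>\<theta>. 0 \<le> g \<theta>"
  shows "(INF \<theta>\<in>A. g \<theta>) \<le> b"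
  by (rule cINF_lower2[where f = g and x = \<theta>, OF _ assms(1,2)]) (use assms(3) in \<open>auto intro!: bdd_belowI[of _ 0]\<close>)

text \<open>
  The three sources of failure: a vanishing reference, missed heavy entries, and noisy votes.
\<close>

lemma success_probability:
  assumes x: "x \<in> carrier_vec d" and xs: "opt_sparse_approx x (real s) xs"
    and xt: "opt_sparse_approx x (real s / \<epsilon>) xt"
  shows "\<P>(M in sketch_law d s \<epsilon>. accurate s \<epsilon> x xs xt M) \<ge> 1 - 8195 / real (bit_len d) ^ 5"
proof -
  let ?L = "bit_len d" and ?K = "kept d s \<epsilon>" and ?B = "buckets d s \<epsilon>" and ?R = "repetitions d s \<epsilon>" and ?m = "slack d s \<epsilon>"
  let ?F = "{..<?R} \<rightarrow>\<^sub>E {..<d} \<rightarrow>\<^sub>E {..<?B}"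
  let ?n = "d * ?L ^ 5"
  let ?P = "accurate s \<epsilon> x xs xt"
  define \<eta> where "\<eta> = norm1 (x - xt) / ?K"
  obtain S where hash: "hashing d ?B ?K ?R ?m (\<lambda>i. cmod (x $ i)) S (norm1 (x - xt) / ?K) (decodes d ?L x)"
    and tail_eq: "norm1 (x - xt) = (\<Sum>i\<in>{..<d} - S. cmod (x $ i))"
    by (rule hashing_params[OF x xt], (rule that; assumption))
  interpret hashing d ?B ?K ?R ?m "\<lambda>i. cmod (x $ i)" S \<eta> "decodes d ?L x"
    unfolding \<eta>_def by (rule hash)
  have input: "sketch_input d ?L ?B ?R ?m s ?K f x S \<eta>" if "f \<in> ?F" for f
    using d s bit_len x hash[folded \<eta>_def] that by unfold_locales auto
  have eb: "6 * \<eta> * sqrt (real s) \<le> 22 * \<epsilon> * norm1 (x - xt) / sqrt (real s)"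
    unfolding \<eta>_def by (rule error_bound[OF x xt])
  have n1: "0 \<le> norm1 (x - xt)"
    unfolding tail_eq by (intro sum_nonneg) simp
  have n2: "0 \<le> norm2 v" for v
    by (simp add: norm2_def)
  define bad where "bad = {\<omega> \<in> seeds d s \<epsilon>. \<not> ?P (seed_mat d s \<epsilon> \<omega>)}"
  let ?T0 = "{t \<in> {1..?n}. (\<exists>j<d. x $ j \<noteq> 0) \<and> (\<Sum>i<d. of_nat t ^ i * x $ i) = 0}"
  have "bad \<subseteq> ?T0 \<times> ?F \<union> ({1..?n} \<times> {f \<in> ?F. bad_heavy f} \<union> {1..?n} \<times> {f \<in> ?F. bad_decoded f})"
  proof
    fix \<omega> assume \<omega>: "\<omega> \<in> bad"
    obtain t f where tf: "\<omega> = (t, f)"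
      by (cases \<omega>)
    have t: "t \<in> {1..?n}" and f: "f \<in> ?F" and nP: "\<not> ?P (seed_mat d s \<epsilon> (t, f))"
      using \<omega> unfolding bad_def seeds_def tf by auto
    interpret sketch_input d ?L ?B ?R ?m s t ?K f x S \<eta>
      by (rule input[OF f])
    have M: "seed_mat d s \<epsilon> (t, f) = M"
      by (simp add: seed_mat_def)
    show "\<omega> \<in> ?T0 \<times> ?F \<union> ({1..?n} \<times> {f \<in> ?F. bad_heavy f} \<union> {1..?n} \<times> {f \<in> ?F. bad_decoded f})"
    proof (rule ccontr)
      assume "\<omega> \<notin> ?T0 \<times> ?F \<union> ({1..?n} \<times> {f \<in> ?F. bad_heavy f} \<union> {1..?n} \<times> {f \<in> ?F. bad_decoded f})"
      then have good: "\<not> bad_heavy f" "\<not> bad_decoded f" and t0: "t \<notin> ?T0"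
        using t f unfolding tf by auto
      have "\<exists>\<theta>\<in>{0..2 * pi}. norm2 (exp (\<i> * of_real \<theta>) \<cdot>\<^sub>v x - recovered s \<epsilon> M y)
          \<le> norm2 (x - xs) + 22 * \<epsilon> * norm1 (x - xt) / sqrt (real s)"
      proof (cases "\<exists>j<d. x $ j \<noteq> 0")
        case True
        then have "ref \<noteq> 0"
          using t0 t unfolding ref_def by auto
        from recover_error[OF this good(2,1) xs, of \<epsilon>] show ?thesis
          using eb by (meson add_left_mono order_trans)
      next
        case False
        have "0 \<le> norm2 (x - xs) + 22 * \<epsilon> * norm1 (x - xt) / sqrt (real s)"
          using n2[of "x - xs"] n1 \<epsilon> by (intro add_nonneg_nonneg divide_nonneg_nonneg mult_nonneg_nonneg) auto
        then show ?thesis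
          using recover_error_zero[of 0 \<epsilon>] False by (intro bexI[of _ 0]) auto
      qed
      then obtain \<theta> where "\<theta> \<in> {0..2 * pi}" "norm2 (exp (\<i> * of_real \<theta>) \<cdot>\<^sub>v x - recovered s \<epsilon> M y)
          \<le> norm2 (x - xs) + 22 * \<epsilon> * norm1 (x - xt) / sqrt (real s)"
        by blast
      then have "?P M"
        by (rule INF_le_at) (rule n2)
      then show False
        using nP unfolding M by simp
    qed
  qed
  moreover have finF: "finite ?F"
    by (intro finite_PiE) auto
  ultimately have "card bad \<le> card (?T0 \<times> ?F \<union> ({1..?n} \<times> {f \<in> ?F. bad_heavy f} \<union> {1..?n} \<times> {f \<in> ?F. bad_decoded f}))"
    by (intro card_mono) auto
  also have "\<dots> \<le> card ?T0 * card ?F + (?n * card {f \<in> ?F. bad_heavy f} + ?n * card {f \<in> ?F. bad_decoded f})"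
    by (intro order_trans[OF card_Un_le] add_mono) (simp_all add: card_cartesian_product)
  finally have "real (card bad) \<le> real (card ?T0 * card ?F + (?n * card {f \<in> ?F. bad_heavy f} + ?n * card {f \<in> ?F. bad_decoded f}))"
    by (rule of_nat_mono)
  also have "\<dots> = real (card ?T0) * card ?F + (?n * real (card {f \<in> ?F. bad_heavy f}) + ?n * real (card {f \<in> ?F. bad_decoded f}))"
    by simp
  also have "\<dots> \<le> real d * card ?F + (?n * (2 * ?K / 8 ^ ?m * card ?F) + ?n * (8192 * ?K / 8 ^ ?m * card ?F))"
  proof (intro add_mono mult_left_mono mult_right_mono bad_heavy_prob bad_decoded_prob)
    have "card ?T0 \<le> d"
    proof (cases "\<exists>j<d. x $ j \<noteq> 0")
      case True
      then show ?thesis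
        using few_roots[of _ x ?n] by auto
    next
      case False
      then have "?T0 = {}"
        by blast
      then show ?thesis
        by (metis card.empty le0)
    qed
    then show "real (card ?T0) \<le> real d"
      by simp
  qed auto
  also have "\<dots> = (real d / ?n + 8194 * (?K / 8 ^ ?m)) * (?n * card ?F)"
    using d bit_len_d by (simp add: field_simps)
  also have "?n * card ?F = card (seeds d s \<epsilon>)"
    by (simp add: seeds_def card_cartesian_product)
  finally have "real (card bad) / card (seeds d s \<epsilon>) \<le> real d / ?n + 8194 * (?K / 8 ^ ?m)"
    using seeds_finite_nonempty by (simp add: divide_le_eq card_gt_0_iff mult.commute)
  also have "\<dots> \<le> 1 / real ?L ^ 5 + 8194 * (1 / real ?L ^ 5)"
  proof (intro add_mono mult_left_mono)
    show "real d / ?n \<le> 1 / real ?L ^ 5"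
      using d by simp
    have eight: "(8::nat) = 2 ^ 3"
      by simp
    have "(8::nat) ^ ?m = (2 ^ bit_len (?K + ?L)) ^ 6"
      unfolding slack_def eight power_mult[symmetric] by (rule arg_cong[where f = "\<lambda>k. 2 ^ k"]) simp
    moreover have "(?K + ?L) ^ 6 \<le> (2 ^ bit_len (?K + ?L)) ^ 6"
      by (intro power_mono bit_len) simp
    moreover have "?K * ?L ^ 5 \<le> (?K + ?L) * (?K + ?L) ^ 5"
      by (intro mult_mono power_mono) auto
    ultimately have "?K * ?L ^ 5 \<le> 8 ^ ?m"
      by (simp add: eval_nat_numeral)
    then have "real (?K * ?L ^ 5) \<le> real (8 ^ ?m)"
      by (rule of_nat_mono)
    then show "?K / 8 ^ ?m \<le> 1 / real ?L ^ 5"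
      using bit_len_d by (simp add: field_simps)
  qed simp
  finally have "real (card bad) / card (seeds d s \<epsilon>) \<le> 8195 / real ?L ^ 5"
    by simp
  moreover have "real (card {\<omega> \<in> seeds d s \<epsilon>. ?P (seed_mat d s \<epsilon> \<omega>)}) = card (seeds d s \<epsilon>) - real (card bad)"
  proof -
    have "card (seeds d s \<epsilon>) = card ({\<omega> \<in> seeds d s \<epsilon>. ?P (seed_mat d s \<epsilon> \<omega>)} \<union> bad)"
      unfolding bad_def by (rule arg_cong[where f = card]) auto
    also have "\<dots> = card {\<omega> \<in> seeds d s \<epsilon>. ?P (seed_mat d s \<epsilon> \<omega>)} + card bad"
      using seeds_finite_nonempty by (intro card_Un_disjoint) (auto simp: bad_def)
    finally show ?thesis
      by simp
  qed
  ultimately show ?thesis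
    using seeds_finite_nonempty unfolding prob_sketch_law by (simp add: diff_divide_distrib card_gt_0_iff)
qed


lemma failure_bound:
  "8195 / real (bit_len d) ^ 5 \<le> 1 / (1 / 8195 * (ln (real d)) ^ 2 * (ln (ln (real d))) ^ 3)"
proof -
  define l where "l = ln (real d)"
  have l: "1 < l"
    unfolding l_def by (rule ln_d)
  have pos: "0 < ln l" "ln l \<le> l"
    using l ln_bound[of l] by auto
  have L: "l \<le> real (bit_len d)"
    unfolding l_def using d by (intro ln_le_bit_len) auto
  have "l ^ 2 * ln l ^ 3 \<le> l ^ 2 * l ^ 3"
    using l pos by (intro mult_left_mono power_mono) auto
  also have "\<dots> = l ^ 5"
    by (simp flip: power_add)
  also have "\<dots> \<le> real (bit_len d) ^ 5"
    using L l by (intro power_mono) auto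
  finally have "8195 / real (bit_len d) ^ 5 \<le> 8195 / (l ^ 2 * ln l ^ 3)"
    using l pos bit_len_d by (intro divide_left_mono mult_pos_pos) auto
  then show ?thesis
    unfolding l_def by simp
qed

text \<open>
  Here \<open>s = \<Omega>(ln d)\<close> enters: it bounds \<open>bit_len d\<close> polynomially in \<open>u\<close>, so that the number of
  repetitions is \<open>O(ln u)\<close>.
\<close>

lemma size_bounds:
  fixes c :: real
  defines "u \<equiv> real s / \<epsilon>"
  assumes c: "0 < c" "c * ln (real d) \<le> real s" and large: "1 + 3 / c \<le> u" "exp 1 \<le> u"
  shows "real (bit_len d) \<le> 3 * ln (real d)" "real (repetitions d s \<epsilon>) \<le> 30 * ln u"
    "real (repetitions d s \<epsilon> * buckets d s \<epsilon>) \<le> 3840 * (u * ln u)"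
proof -
  define l where "l = ln (real d)"
  have l: "1 < l"
    unfolding l_def by (rule ln_d)
  show bl: "real (bit_len d) \<le> 3 * ln (real d)"
    using bit_len_le_ln[of d] l d unfolding l_def by simp
  have u: "1 \<le> u" "0 < u"
    using level_ge unfolding u_def by auto
  have lnu: "1 \<le> ln u"
    using large u by (simp add: ln_ge_iff)
  define n where "n = kept d s \<epsilon> + bit_len d"
  have n1: "1 \<le> n"
    using kept_pos by (simp add: n_def)
  have "real s \<le> u"
    using level_ge unfolding u_def by simp
  then have "l \<le> u / c"
    using c unfolding l_def by (simp add: field_simps)
  then have "real n \<le> u + 3 * (u / c)"
    using kept_le bl unfolding n_def u_def l_def by simp
  also have "\<dots> = u * (1 + 3 / c)"
    by (simp add: field_simps)
  also have "\<dots> \<le> u * u"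
    using large u by (intro mult_left_mono) auto
  finally have "ln (real n) \<le> ln (u * u)"
    using n1 by (intro ln_mono) auto
  also have "\<dots> = 2 * ln u"
    using u by (simp add: ln_mult)
  finally have "real (bit_len n) \<le> 5 * ln u"
    using bit_len_le_ln[OF n1] lnu by simp
  then show R: "real (repetitions d s \<epsilon>) \<le> 30 * ln u"
    unfolding repetitions_def slack_def n_def by simp
  have "real (repetitions d s \<epsilon> * buckets d s \<epsilon>) \<le> 30 * ln u * (128 * u)"
    unfolding of_nat_mult using R kept_le lnu unfolding u_def buckets_def by (intro mult_mono) auto
  then show "real (repetitions d s \<epsilon> * buckets d s \<epsilon>) \<le> 3840 * (u * ln u)"
    by (simp add: mult_ac)
qed

text \<open>
  The number of rows is \<open>O(u * ln u * ln d)\<close> and the number of steps \<open>O(u * (ln u)\<^sup>2 * ln d)\<close>; the further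
  factors on the right-hand sides are at least 1 when \<open>u\<close> is large.
\<close>

lemma complexity_bounds:
  fixes c :: real
  defines "u \<equiv> real s / \<epsilon>"
  assumes c: "0 < c" "c * ln (real d) \<le> real s" and large: "1 + 3 / c \<le> u" "exp (exp 1) \<le> u"
  shows "real (measurements d s \<epsilon>) \<le> 3000000 * (u * ln u ^ 3 * ln (ln u) ^ 3 * ln (real d))"
    "real (repetitions d s \<epsilon> * buckets d s \<epsilon> * (26 * bit_len d + 12 * repetitions d s \<epsilon> + 92) +
       s * (30 * bit_len d + 40) + 4 * bit_len d + 22)
      \<le> 3000000 * (u * ln u ^ 4 * ln (ln u) ^ 3 * ln (real d))"
proof -
  define l where "l = ln (real d)"
  define v where "v = ln u"
  have l: "1 < l"
    unfolding l_def by (rule ln_d)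
  have u: "1 \<le> u" "0 < u"
    using level_ge unfolding u_def by auto
  have v: "exp 1 \<le> v"
    using large u unfolding v_def by (simp add: ln_ge_iff)
  then have v1: "1 \<le> v"
    using exp_ge_add_one_self[of 1] by linarith
  have lnv: "1 \<le> ln v"
    using v v1 by (simp add: ln_ge_iff)
  have "exp 1 \<le> u"
    using large exp_ge_add_one_self[of "exp 1"] by linarith
  note sb = size_bounds[OF c large(1)[unfolded u_def] this[unfolded u_def], folded u_def, folded l_def v_def]
  have w1: "1 \<le> u * v" "u \<le> u * v" "u * v \<le> u * v * l" "u \<le> u * v * v * l" "1 \<le> u * v * v * l"
    "u * l \<le> u * v * v * l" "u * v \<le> u * v * v * l" "u * v * l \<le> u * v * v * l" "u * v * v \<le> u * v * v * l"
    "l \<le> u * v * v * l" "1 \<le> u * v * l"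
  proof -
    have m: "a \<le> a * b" if "0 \<le> a" "1 \<le> b" for a b :: real
      using that mult_left_mono[of 1 b a] by simp
    show a1: "u \<le> u * v"
      using u v1 by (intro m) auto
    then show a2: "1 \<le> u * v"
      using u by linarith
    show a3: "u * v \<le> u * v * l"
      using a2 l by (intro m) auto
    show a4: "1 \<le> u * v * l"
      using a2 a3 by linarith
    have a5: "u * v \<le> u * v * v"
      using a2 v1 by (intro m) auto
    show a6: "u * v * v \<le> u * v * v * l"
      using a2 a5 l by (intro m) auto
    show a7: "u * v \<le> u * v * v * l" "u \<le> u * v * v * l" "1 \<le> u * v * v * l"
      using a1 a2 a5 a6 by linarith+
    show "u * v * l \<le> u * v * v * l"
      using l by (intro mult_right_mono[OF a5]) auto
    show "u * l \<le> u * v * v * l"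
      using l by (intro mult_right_mono[OF order_trans[OF a1 a5]]) auto
    show "l \<le> u * v * v * l"
      using a2 a5 l mult_right_mono[of 1 "u * v * v" l] by simp
  qed
  have RB: "real (repetitions d s \<epsilon> * buckets d s \<epsilon>) \<le> 3840 * (u * v)"
    using sb(3) .
  have "real (measurements d s \<epsilon>) = 2 + real (repetitions d s \<epsilon> * buckets d s \<epsilon>) * (2 * real (bit_len d) + 3)"
    unfolding measurements_def by simp
  also have "\<dots> \<le> 2 + 3840 * (u * v) * (2 * (3 * l) + 3)"
    using RB sb(1) w1 by (intro add_left_mono mult_mono) auto
  also have "\<dots> = 2 + 23040 * (u * v * l) + 11520 * (u * v)"
    by (simp add: algebra_simps)
  also have "\<dots> \<le> 3000000 * (u * v * l)"
    using w1 by linarith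
  also have "\<dots> \<le> 3000000 * (u * v ^ 3 * ln v ^ 3 * l)"
  proof -
    have "v * 1 \<le> v ^ 3 * ln v ^ 3"
      using v1 lnv self_le_power[of v 3] by (intro mult_mono one_le_power) auto
    then have "u * l * v \<le> u * l * (v ^ 3 * ln v ^ 3)"
      using u l by (intro mult_left_mono) auto
    then show ?thesis
      by (simp add: mult_ac)
  qed
  finally show "real (measurements d s \<epsilon>) \<le> 3000000 * (u * ln u ^ 3 * ln (ln u) ^ 3 * ln (real d))"
    unfolding v_def l_def .
  have "real s \<le> u"
    using level_ge unfolding u_def by simp
  have "real (repetitions d s \<epsilon> * buckets d s \<epsilon> * (26 * bit_len d + 12 * repetitions d s \<epsilon> + 92) +
       s * (30 * bit_len d + 40) + 4 * bit_len d + 22) =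
     real (repetitions d s \<epsilon> * buckets d s \<epsilon>) * (26 * real (bit_len d) + 12 * real (repetitions d s \<epsilon>) + 92) +
       real s * (30 * real (bit_len d) + 40) + 4 * real (bit_len d) + 22"
    by simp
  also have "\<dots> \<le> 3840 * (u * v) * (26 * (3 * l) + 12 * (30 * v) + 92) + u * (30 * (3 * l) + 40) + 4 * (3 * l) + 22"
    using RB sb(1,2) w1 \<open>real s \<le> u\<close> u by (intro add_mono mult_mono) auto
  also have "\<dots> = 299520 * (u * v * l) + 1382400 * (u * v * v) + 353280 * (u * v) + 90 * (u * l) + 40 * u + 12 * l + 22"
    by (simp add: algebra_simps)
  also have "\<dots> \<le> 3000000 * (u * v * v * l)"
    using w1 by linarith
  also have "\<dots> \<le> 3000000 * (u * v ^ 4 * ln v ^ 3 * l)"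
  proof -
    have "v * v * 1 \<le> v ^ 4 * ln v ^ 3"
      using v1 lnv power_increasing[of 2 4 v] by (intro mult_mono one_le_power) (auto simp: power2_eq_square)
    then have "u * l * (v * v) \<le> u * l * (v ^ 4 * ln v ^ 3)"
      using u l by (intro mult_left_mono) auto
    then show ?thesis
      by (simp add: mult_ac)
  qed
  finally show "real (repetitions d s \<epsilon> * buckets d s \<epsilon> * (26 * bit_len d + 12 * repetitions d s \<epsilon> + 92) +
       s * (30 * bit_len d + 40) + 4 * bit_len d + 22)
      \<le> 3000000 * (u * ln u ^ 4 * ln (ln u) ^ 3 * ln (real d))"
    unfolding v_def l_def .
qed

lemma success_probability_ln:
  assumes "x \<in> carrier_vec d" "opt_sparse_approx x (real s) xs" "opt_sparse_approx x (real s / \<epsilon>) xt"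
  shows "\<P>(M in sketch_law d s \<epsilon>. accurate s \<epsilon> x xs xt M)
    \<ge> 1 - 1 / (1 / 8195 * (ln (real d)) ^ 2 * (ln (ln (real d))) ^ 3)"
  using success_probability[OF assms] failure_bound by linarith

end

text \<open>
  From this dimension on, \<open>c * ln d\<close>, and hence \<open>s / \<epsilon>\<close>, reaches both lower bounds that the
  complexity estimates ask for.
\<close>

definition threshold :: "real \<Rightarrow> nat" where
  "threshold c = max 4 (nat \<lceil>exp (max (1 + 3 / c) (exp (exp 1)) / c)\<rceil>)"

lemma complexity:
  assumes c: "0 < c" and d: "threshold c \<le> d" and s: "s \<in> {1..d}" and \<epsilon>: "\<epsilon> \<in> {0<..1}"
    and s_ge: "c * ln (real d) \<le> real s"
  shows "real (measurements d s \<epsilon>)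
      \<le> 3000000 * (real s / \<epsilon> * (ln (real s / \<epsilon>)) ^ 3 * (ln (ln (real s / \<epsilon>))) ^ 3 * ln (real d))"
    "M \<in> space (sketch_law d s \<epsilon>) \<Longrightarrow> real (run_time (assemble 0 decoder_code) 8 s \<epsilon> M y)
      \<le> 3000000 * (real s / \<epsilon> * (ln (real s / \<epsilon>)) ^ 4 * (ln (ln (real s / \<epsilon>))) ^ 3 * ln (real d))"
proof -
  define e where "e = max (1 + 3 / c) (exp (exp 1)) / c"
  have d4: "4 \<le> d"
    using d unfolding threshold_def by simp
  have "exp e \<le> real (nat \<lceil>exp e\<rceil>)"
    by (rule real_nat_ceiling_ge)
  also have "\<dots> \<le> real d"
    using d unfolding threshold_def e_def by (intro of_nat_mono) (erule max.boundedE)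
  finally have "e \<le> ln (real d)"
    using d4 by (subst ln_ge_iff) auto
  then have "max (1 + 3 / c) (exp (exp 1)) \<le> c * ln (real d)"
    using c unfolding e_def by (simp add: field_simps)
  also have "\<dots> \<le> real s / \<epsilon>"
    using s_ge level_ge(1)[OF d4 s \<epsilon>] by linarith
  finally have large: "1 + 3 / c \<le> real s / \<epsilon>" "exp (exp 1) \<le> real s / \<epsilon>"
    by auto
  note bounds = complexity_bounds[OF d4 s \<epsilon> c s_ge large]
  show "real (measurements d s \<epsilon>)
      \<le> 3000000 * (real s / \<epsilon> * (ln (real s / \<epsilon>)) ^ 3 * (ln (ln (real s / \<epsilon>))) ^ 3 * ln (real d))"
    by (rule bounds(1))
  assume "M \<in> space (sketch_law d s \<epsilon>)"
  from of_nat_mono[OF sketch_terminates(2)[OF d4 s \<epsilon> this]] bounds(2)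
  show "real (run_time (assemble 0 decoder_code) 8 s \<epsilon> M y)
      \<le> 3000000 * (real s / \<epsilon> * (ln (real s / \<epsilon>)) ^ 4 * (ln (ln (real s / \<epsilon>))) ^ 3 * ln (real d))"
    by (rule order_trans)
qed

theorem theorem7:
  shows "\<exists>(C::real) (P::program) (\<kappa>::nat) (d0::nat)
      (D :: nat \<Rightarrow> nat \<Rightarrow> real \<Rightarrow> nat) (\<mu> :: nat \<Rightarrow> nat \<Rightarrow> real \<Rightarrow> complex mat measure).
    C > 0 \<and>
    (\<forall>d\<ge>d0. \<forall>s\<in>{1..d}. \<forall>\<epsilon>\<in>{0<..1}.
       random_matrix_law (D d s \<epsilon>) d (\<mu> d s \<epsilon>) \<and>
       (\<forall>M\<in>space (\<mu> d s \<epsilon>). \<forall>y\<in>carrier_vec (D d s \<epsilon>). terminates P \<kappa> s \<epsilon> M y) \<and>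
       (\<forall>x\<in>carrier_vec d. \<forall>xs xt.
          opt_sparse_approx x (real s) xs \<longrightarrow> opt_sparse_approx x (real s / \<epsilon>) xt \<longrightarrow>
          \<P>(M in \<mu> d s \<epsilon>.
             (INF \<theta>\<in>{0..2 * pi}.
                norm2 (exp (\<i> * of_real \<theta>) \<cdot>\<^sub>v x - recover P \<kappa> s \<epsilon> M (sq_mag (M *\<^sub>v x))))
             \<le> norm2 (x - xs) + 22 * \<epsilon> * norm1 (x - xt) / sqrt (real s))
          \<ge> 1 - 1 / (C * (ln (real d)) ^ 2 * (ln (ln (real d))) ^ 3))) \<and>
    (\<forall>c>0. \<exists>K d1. \<forall>d\<ge>d1. \<forall>s\<in>{1..d}. \<forall>\<epsilon>\<in>{0<..1}.
       real s \<ge> c * ln (real d) \<longrightarrow>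
       real (D d s \<epsilon>)
         \<le> K * (real s / \<epsilon> * (ln (real s / \<epsilon>)) ^ 3 * (ln (ln (real s / \<epsilon>))) ^ 3 * ln (real d)) \<and>
       (\<forall>M\<in>space (\<mu> d s \<epsilon>). \<forall>y\<in>carrier_vec (D d s \<epsilon>).
          real (run_time P \<kappa> s \<epsilon> M y)
            \<le> K * (real s / \<epsilon> * (ln (real s / \<epsilon>)) ^ 4 * (ln (ln (real s / \<epsilon>))) ^ 3 * ln (real d))))"
  (* 8195 = 1 + 2 + 8192 adds up the bounds for a vanishing reference, a missed heavy entry and noisy
     votes; from dimension 4 on, ln d > 1 follows from the bound 3 on the base of ln. *)
  apply (rule exI[of _ "1 / 8195"], rule exI[of _ "assemble 0 decoder_code"], rule exI[of _ 8], rule exI[of _ 4])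
  apply (rule exI[of _ measurements], rule exI[of _ sketch_law], intro conjI allI ballI impI)
  subgoal by simp
  subgoal by (rule random_matrix_law_sketch)
  subgoal by (rule sketch_terminates(1))
  subgoal by (rule success_probability_ln)
  subgoal for c
    by (rule exI[of _ 3000000], rule exI[of _ "threshold c"], intro allI ballI impI conjI)
      (rule complexity; assumption)+
  done

end
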